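(* Let $\omega_1 = 1$, $\omega_2=\sqrt{2}$, $\omega_3=\sqrt{3}$, $a=\frac{\omega_1+\omega_2+\omega_3}{2}$, and let $$\Lambda_1=\{a+n_1\omega_1+n_2\omega_2+n_3\omega_3 : n_1,n_2,n_3\in\mathbb{Z}_{+}\},\qquad \Lambda=\Lambda_1\cup(-\Lambda_1).$$ Put $P=\omega_1\omega_2\omega_3=\sqrt{6}$ and $Q=\omega_1^2+\omega_2^2+\omega_3^2=6$. For every nonzero integer $k$ define $$b_k=\frac{(-1)^{k+1}}{4\omega_1\sin\left(\pi k\frac{\omega_2}{\omega_1}\right)\sin\left(\pi k\frac{\omega_3}{\omega_1}\right)},\qquad c_k=\frac{(-1)^{k+1}}{4\omega_2\sin\left(\pi k\frac{\omega_1}{\omega_2}\right)\sin\left(\pi k\frac{\omega_3}{\omega_2}\right)},$$ $$d_k=\frac{(-1)^{k+1}}{4\omega_3\sin\left(\pi k\frac{\omega_1}{\omega_3}\right)\sin\left(\pi k\frac{\omega_2}{\omega_3}\right)}.$$ Then the following identity holds in the space $\mathcal{S}'(\mathbb{R})$ of tempered distributions: $$\widehat{\delta}_\Lambda=-\frac{1}{8\pi^2P}\,\delta_0''-\frac{Q}{24P}\,\delta_0+\sum_{k\in\mathbb{Z},\,k\neq 0}\left(b_k\delta_k+c_k\delta_{k/\sqrt{2}}+d_k\delta_{k/\sqrt{3}}\right),$$ where the series converges unconditionally in $\mathcal{S}'(\mathbb{R})$ (that is, after testing against any Schwartz function one gets an absolutely convergent series). In particular, $$\operatorname{supp}\wi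dehat{\delta}_\Lambda=\mathbb{Z}\cup\left(\tfrac{1}{\sqrt{2}}\mathbb{Z}\right)\cup\left(\tfrac{1}{\sqrt{3}}\mathbb{Z}\right).$$
   Context: $\mathbb{Z}_+$ denotes the set of nonnegative integers. For a discrete (locally finite) set $\Lambda\subset\mathbb{R}$, $\delta_\Lambda=\sum_{\lambda\in\Lambda}\delta_\lambda$ is the measure with unit mass at each point of $\Lambda$. For the set $\Lambda$ of the claim one has $\#(\Lambda\cap[-R,R])=O(R^3)$ as $R\to\infty$, so $\delta_\Lambda$ is a tempered distribution. Here $\delta_x$ is the Dirac mass at $x$, and $\delta_0''$ is the second distributional derivative of $\delta_0$, so $\langle\delta_0'',f\rangle=f''(0)$. The Fourier transform of a Schwartz function $f\in\mathcal{S}(\mathbb{R})$ is normalized as $\widehat{f}(t)=\int_{\mathbb{R}}e^{-2\pi i t x}f(x)\,dx$, and the Fourier transform of a tempered distribution $u$ is defined by $\langle\widehat{u},f\rangle=\langle u,\widehat{f}\rangle$ for all $f\in\mathcal{S}(\mathbb{R})$ (bilinear pairing). *)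

theory Defs
  imports "HOL-Analysis.Analysis"
begin

definition vderiv :: "(real \<Rightarrow> complex) \<Rightarrow> real \<Rightarrow> complex"
  where "vderiv f = (\<lambda>x. vector_derivative f (at x))"

definition smooth :: "(real \<Rightarrow> complex) \<Rightarrow> bool"
  where "smooth f \<longleftrightarrow> (\<forall>n x. (vderiv ^^ n) f differentiable (at x))"

definition schwartz :: "(real \<Rightarrow> complex) \<Rightarrow> bool"
  where "schwartz f \<longleftrightarrow>
    smooth f \<and> (\<forall>m n. bounded (range (\<lambda>x. x ^ m *\<^sub>R (vderiv ^^ n) f x)))"

definition schwartz_seminorm :: "nat \<Rightarrow> nat \<Rightarrow> (real \<Rightarrow> complex) \<Rightarrow> real"
  where "schwartz_seminorm m n f = (SUP x. norm (x ^ m *\<^sub>R (vderiv ^^ n) f x))"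

definition fourier :: "(real \<Rightarrow> complex) \<Rightarrow> real \<Rightarrow> complex"
  where "fourier f = (\<lambda>t. LINT x|lborel. exp (- 2 * pi * \<i> * t * x) * f x)"

text \<open>
  A distribution is represented by a functional on all functions of type
  \<^typ>\<open>real \<Rightarrow> complex\<close>; only its values on Schwartz functions are meaningful. Two
  tempered distributions are equal iff they agree on all Schwartz functions.
\<close>

type_synonym functional = "(real \<Rightarrow> complex) \<Rightarrow> complex"

definition tempered_distribution :: "functional \<Rightarrow> bool"
  where "tempered_distribution u \<longleftrightarrow>
    (\<forall>f g. schwartz f \<longrightarrow> schwartz g \<longrightarrow> u (\<lambda>x. f x + g x) = u f + u g) \<and>
    (\<forall>c f. schwartz f \<longrightarrow> u (\<lambda>x. c * f x) = c * u f) \<and>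
    (\<exists>C N. \<forall>f. schwartz f \<longrightarrow> norm (u f) \<le> C * (\<Sum>m\<le>N. \<Sum>n\<le>N. schwartz_seminorm m n f))"

definition dirac :: "real \<Rightarrow> functional"
  where "dirac x f = f x"

text \<open>
  The pairing of a Schwartz function with the measure having unit mass at each point of
  \<open>\<Lambda>\<close>. It is intended for sets with polynomially growing counting function, where the sum
  converges absolutely; the library assigns the value 0 to a sum that does not converge.
\<close>

definition dirac_comb :: "real set \<Rightarrow> functional"
  where "dirac_comb \<Lambda> f = (\<Sum>\<^sub>\<infinity>x\<in>\<Lambda>. dirac x f)"

definition distr_deriv :: "functional \<Rightarrow> functional"
  where "distr_deriv u f = - u (vderiv f)"

definition distr_fourier :: "functional \<Rightarrow> functional"
  where "distr_fourier u f = u (fourier f)"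

definition vanishes_on :: "functional \<Rightarrow> real set \<Rightarrow> bool"
  where "vanishes_on u U \<longleftrightarrow>
    (\<forall>\<phi>. smooth \<phi> \<longrightarrow> compact (closure {x. \<phi> x \<noteq> 0}) \<longrightarrow> closure {x. \<phi> x \<noteq> 0} \<subseteq> U \<longrightarrow> u \<phi> = 0)"

definition distr_supp :: "functional \<Rightarrow> real set"
  where "distr_supp u = - \<Union>{U. open U \<and> vanishes_on u U}"

end

theory Submission
  imports Defs "HOL-Probability.Sinc_Integral"
begin

text \<open>
  Write \<open>s\<^sub>j(t) = sin (\<pi> \<omega>\<^sub>j t)\<close>. If \<open>f = s\<^sub>2 s\<^sub>3 g\<close> with \<open>g\<close> Schwartz, then the Fourier transform
  of \<open>f\<close> is a second difference, with steps \<open>\<omega>\<^sub>2\<close> and \<open>\<omega>\<^sub>3\<close>, of that of \<open>g\<close>; summing over the lattice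
  cone telescopes in two directions, and the remaining sum over \<open>\<omega>\<^sub>1 (\<int> + 1/2)\<close> is evaluated by Poisson
  summation. If \<open>f = \<sigma> g\<close> with \<open>\<sigma>(t) = \<Prod>\<^sub>j s\<^sub>j(t) / (\<pi> t)\<close>, the Fourier transform of \<open>f\<close> is a third difference of
  a triple antiderivative of that of \<open>g\<close>, everything telescopes, and Fourier inversion gives the
  contribution of the triple pole at \<open>0\<close>. An arbitrary Schwartz function is a sum of functions of these
  kinds: the numbers \<open>1, \<surd>2, \<surd>3\<close> are badly approximable by each other, so
  \<open>D = \<sigma>\<^sup>2 + (s\<^sub>2 s\<^sub>3)\<^sup>2 + (s\<^sub>1 s\<^sub>3)\<^sup>2 + (s\<^sub>1 s\<^sub>2)\<^sup>2\<close> is bounded below by a negative power of \<open>1 + \<bar>t\<bar>\<close>, and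
  \<open>f = \<Sum>\<^sub>q (f q / D) q\<close>, where \<open>q\<close> runs over the four functions whose squares add up to \<open>D\<close>.
\<close>

subsection \<open>Schwartz functions and their multipliers\<close>

text \<open>Formally, summing geometric series over the cone gives i / (8 s_1 s_2 s_3) in the lower
  half plane, and the reflected cone gives the negative of this function in the upper half plane.
  The transform of the whole point set is the jump of a meromorphic function across the real line: 2
  pi i times the residue at each simple pole, which is where the coefficients \<open>b\<close>,
  \<open>c\<close>, \<open>d\<close> come from, and a combination of \<delta>'' and \<delta> at the
  triple pole 0. The proof itself stays on the real line. The obstacle is that poles of different
  families come arbitrarily close to each other, so a test function can be divided by sines only at
  a cost that has to be controlled. Away from 0 at most one of the three sines is very small at a
  given point, hence some product of two of them is not; as a factor of the test function, such a
  product cancels two families of poles and leaves the third. At 0 all these products vanish, and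
  \<sigma>, which does not vanish there, takes over. Adding squares gives a positive common
  denominator, so that no cutoff functions enter the decomposition.\<close>

lemma vderiv_eqI: "(\<And>x. (f has_vector_derivative f' x) (at x)) \<Longrightarrow> vderiv f = f'"
  unfolding vderiv_def by (auto intro: vector_derivative_at)

lemma vderiv_works: "f differentiable (at x) \<Longrightarrow> (f has_vector_derivative vderiv f x) (at x)"
  unfolding vderiv_def by (simp add: vector_derivative_works)

lemma differentiableI_vderiv: "(f has_vector_derivative D) (at x) \<Longrightarrow> f differentiable (at x)"
  unfolding has_vector_derivative_def by (rule differentiableI)

text \<open>The definitions of \<open>smooth\<close> and \<open>schwartz\<close> iterate the
  derivative, which would force the full Leibniz formula on products. Peeling off one derivative at
  a time turns each closure property into an induction that uses only the one-step rule. The bound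
  \<open>B\<close> is a parameter so that rapid decay, polynomial growth and plain smoothness share
  these inductions.\<close>

fun diff_class :: "((real \<Rightarrow> complex) \<Rightarrow> bool) \<Rightarrow> nat \<Rightarrow> (real \<Rightarrow> complex) \<Rightarrow> bool" where
  "diff_class B 0 f \<longleftrightarrow> B f"
| "diff_class B (Suc n) f \<longleftrightarrow> B f \<and> (\<forall>x. f differentiable (at x)) \<and> diff_class B n (vderiv f)"

lemma diff_class_bound: "diff_class B n f \<Longrightarrow> B f"
  by (cases n) auto

lemma diff_class_Suc_D: "diff_class B (Suc n) f \<Longrightarrow> diff_class B n f"
  by (induction n arbitrary: f) auto

lemma diff_class_SucI:
  assumes "B f" and "\<And>x. (f has_vector_derivative f' x) (at x)" and "diff_class B n f'"
  shows "diff_class B (Suc n) f"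
  using assms vderiv_eqI[OF assms(2)] by (auto intro: differentiableI_vderiv)

text \<open>For a fixed \<open>n\<close> the predicate stops short of differentiability of the
  \<open>n\<close>-th derivative, so the equivalence holds only after quantifying over all
  orders.\<close>

lemma all_diff_class_iff:
  "(\<forall>n. diff_class B n f) \<longleftrightarrow>
     (\<forall>n. B ((vderiv ^^ n) f) \<and> (\<forall>x. (vderiv ^^ n) f differentiable (at x)))"
proof
  assume L: "\<forall>n. diff_class B n f"
  have "diff_class B m ((vderiv ^^ n) f)" if "diff_class B (m + n) f" for m n
    using that
  proof (induction n arbitrary: f)
    case (Suc n)
    then show ?case by (simp add: funpow_Suc_right del: funpow.simps)
  qed auto
  then have "diff_class B (Suc 0) ((vderiv ^^ n) f)" for n
    using L by blast
  then show "\<forall>n. B ((vderiv ^^ n) f) \<and> (\<forall>x. (vderiv ^^ n) f differentiable (at x))"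
    by auto
next
  assume R: "\<forall>n. B ((vderiv ^^ n) f) \<and> (\<forall>x. (vderiv ^^ n) f differentiable (at x))"
  have "diff_class B n f" for n
    using R
  proof (induction n arbitrary: f)
    case 0 then show ?case by (metis diff_class.simps(1) funpow_0)
  next
    case (Suc n)
    have "\<forall>n. B ((vderiv ^^ n) (vderiv f)) \<and> (\<forall>x. (vderiv ^^ n) (vderiv f) differentiable (at x))"
      using Suc.prems by (metis comp_apply funpow_Suc_right)
    moreover have "B f" "\<forall>x. f differentiable (at x)"
      using Suc.prems by (metis funpow_0)+
    ultimately show ?case using Suc.IH by simp
  qed
  then show "\<forall>n. diff_class B n f" by blast
qed

lemma diff_class_add:
  assumes B: "\<And>f g. B f \<Longrightarrow> B g \<Longrightarrow> B (\<lambda>x. f x + g x)"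
    and "diff_class B n f" "diff_class B n g"
  shows "diff_class B n (\<lambda>x. f x + g x)"
  using assms(2,3)
proof (induction n arbitrary: f g)
  case (Suc n)
  show ?case
  proof (rule diff_class_SucI)
    show "((\<lambda>x. f x + g x) has_vector_derivative (vderiv f x + vderiv g x)) (at x)" for x
      using Suc.prems by (intro has_vector_derivative_add vderiv_works) auto
  qed (use Suc B in auto)
qed (use B in auto)

text \<open>Three bounds, because decay times polynomial growth is decay, while growth times growth
  is growth. Both summands \<open>f g'\<close> and \<open>f' g\<close> fall under the induction
  hypothesis since order n + 1 includes order n.\<close>

lemma diff_class_mult:
  assumes M: "\<And>f g. B1 f \<Longrightarrow> B2 g \<Longrightarrow> B3 (\<lambda>x. f x * g x)"
    and A: "\<And>f g. B3 f \<Longrightarrow> B3 g \<Longrightarrow> B3 (\<lambda>x. f x + g x)"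
    and "diff_class B1 n f" "diff_class B2 n g"
  shows "diff_class B3 n (\<lambda>x. f x * g x)"
  using assms(3,4)
proof (induction n arbitrary: f g)
  case (Suc n)
  show ?case
  proof (rule diff_class_SucI)
    show "((\<lambda>x. f x * g x) has_vector_derivative (f x * vderiv g x + vderiv f x * g x)) (at x)" for x
      using Suc.prems by (intro has_vector_derivative_mult vderiv_works) auto
    show "diff_class B3 n (\<lambda>x. f x * vderiv g x + vderiv f x * g x)"
      using Suc.prems diff_class_Suc_D[OF Suc.prems(1)] diff_class_Suc_D[OF Suc.prems(2)]
      by (intro diff_class_add A Suc.IH) simp_all
  qed (use Suc M in auto)
qed (use M in auto)

definition poly_bounded :: "(real \<Rightarrow> complex) \<Rightarrow> bool" where
  "poly_bounded f \<longleftrightarrow> (\<exists>C N. \<forall>x. norm (f x) \<le> C * (1 + \<bar>x\<bar>) ^ N)"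

definition rapid_decay :: "(real \<Rightarrow> complex) \<Rightarrow> bool" where
  "rapid_decay f \<longleftrightarrow> (\<forall>m. \<exists>C. \<forall>x. norm (f x) * (1 + \<bar>x\<bar>) ^ m \<le> C)"

text \<open>The space usually written O_M: smooth functions all of whose derivatives grow at most
  polynomially. Multiplication by them preserves Schwartz functions.\<close>

definition multiplier :: "(real \<Rightarrow> complex) \<Rightarrow> bool" where
  "multiplier f \<longleftrightarrow> (\<forall>n. diff_class poly_bounded n f)"

lemma poly_boundedE:
  assumes "poly_bounded f"
  obtains C N where "C \<ge> 0" "\<And>x. norm (f x) \<le> C * (1 + \<bar>x\<bar>) ^ N"
proof -
  obtain C N where *: "\<And>x. norm (f x) \<le> C * (1 + \<bar>x\<bar>) ^ N"
    using assms unfolding poly_bounded_def by blast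
  have "0 \<le> C" using *[of 0] order_trans[OF norm_ge_zero[of "f 0"]] by simp
  with * show thesis using that by blast
qed

lemma poly_boundedI: "(\<And>x. norm (f x) \<le> C * (1 + \<bar>x\<bar>) ^ N) \<Longrightarrow> poly_bounded f"
  unfolding poly_bounded_def by blast

lemma bounded_imp_poly_bounded: "(\<And>x. norm (f x) \<le> C) \<Longrightarrow> poly_bounded f"
  by (rule poly_boundedI[of _ C 0]) auto

lemma poly_bounded_add:
  assumes "poly_bounded f" "poly_bounded g" shows "poly_bounded (\<lambda>x. f x + g x)"
proof -
  obtain C N where 1: "C \<ge> 0" "\<And>x. norm (f x) \<le> C * (1 + \<bar>x\<bar>) ^ N"
    using assms(1) poly_boundedE by blast
  obtain D M where 2: "D \<ge> 0" "\<And>x. norm (g x) \<le> D * (1 + \<bar>x\<bar>) ^ M"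
    using assms(2) poly_boundedE by blast
  show ?thesis
  proof (rule poly_boundedI)
    fix x
    have "norm (f x + g x) \<le> C * (1 + \<bar>x\<bar>) ^ N + D * (1 + \<bar>x\<bar>) ^ M"
      using 1(2)[of x] 2(2)[of x] norm_triangle_ineq[of "f x" "g x"] by linarith
    also have "\<dots> \<le> C * (1 + \<bar>x\<bar>) ^ (N + M) + D * (1 + \<bar>x\<bar>) ^ (N + M)"
      using 1(1) 2(1) by (intro add_mono mult_left_mono power_increasing) auto
    finally show "norm (f x + g x) \<le> (C + D) * (1 + \<bar>x\<bar>) ^ (N + M)" by (simp add: algebra_simps)
  qed
qed

lemma poly_bounded_mult:
  assumes "poly_bounded f" "poly_bounded g" shows "poly_bounded (\<lambda>x. f x * g x)"
proof -
  obtain C N where 1: "C \<ge> 0" "\<And>x. norm (f x) \<le> C * (1 + \<bar>x\<bar>) ^ N"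
    using assms(1) poly_boundedE by blast
  obtain D M where 2: "D \<ge> 0" "\<And>x. norm (g x) \<le> D * (1 + \<bar>x\<bar>) ^ M"
    using assms(2) poly_boundedE by blast
  show ?thesis
  proof (rule poly_boundedI)
    fix x
    have "norm (f x * g x) \<le> (C * (1 + \<bar>x\<bar>) ^ N) * (D * (1 + \<bar>x\<bar>) ^ M)"
      unfolding norm_mult using 1 2 by (intro mult_mono) auto
    then show "norm (f x * g x) \<le> (C * D) * (1 + \<bar>x\<bar>) ^ (N + M)"
      by (simp add: power_add mult_ac)
  qed
qed

lemma rapid_decayE:
  assumes "rapid_decay f"
  obtains C where "C \<ge> 0" "\<And>x. norm (f x) * (1 + \<bar>x\<bar>) ^ m \<le> C"
proof -
  obtain C where *: "\<And>x. norm (f x) * (1 + \<bar>x\<bar>) ^ m \<le> C"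
    using assms unfolding rapid_decay_def by blast
  have "0 \<le> C" using *[of 0] order_trans[OF norm_ge_zero[of "f 0"]] by simp
  with * show thesis using that by blast
qed

lemma rapid_decay_bound:
  assumes "rapid_decay f"
  obtains C where "C \<ge> 0" "\<And>x. norm (f x) \<le> C / (1 + \<bar>x\<bar>) ^ m"
proof -
  obtain C where *: "C \<ge> 0" "\<And>x. norm (f x) * (1 + \<bar>x\<bar>) ^ m \<le> C"
    using rapid_decayE[OF assms] by blast
  then have "norm (f x) \<le> C / (1 + \<bar>x\<bar>) ^ m" for x
    by (simp add: pos_le_divide_eq)
  with * show thesis using that by blast
qed

lemma rapid_decay_add:
  assumes "rapid_decay f" "rapid_decay g" shows "rapid_decay (\<lambda>x. f x + g x)"
  unfolding rapid_decay_def
proof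
  fix m
  obtain C where 1: "\<And>x. norm (f x) * (1 + \<bar>x\<bar>) ^ m \<le> C"
    using rapid_decayE[OF assms(1)] by blast
  obtain D where 2: "\<And>x. norm (g x) * (1 + \<bar>x\<bar>) ^ m \<le> D"
    using rapid_decayE[OF assms(2)] by blast
  have "norm (f x + g x) * (1 + \<bar>x\<bar>) ^ m \<le> C + D" for x
  proof -
    have "norm (f x + g x) * (1 + \<bar>x\<bar>) ^ m \<le> (norm (f x) + norm (g x)) * (1 + \<bar>x\<bar>) ^ m"
      by (intro mult_right_mono norm_triangle_ineq) auto
    then show ?thesis using 1[of x] 2[of x] by (simp add: algebra_simps)
  qed
  then show "\<exists>C. \<forall>x. norm (f x + g x) * (1 + \<bar>x\<bar>) ^ m \<le> C" by blast
qed

lemma rapid_decay_mult: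
  assumes "rapid_decay f" "poly_bounded g" shows "rapid_decay (\<lambda>x. f x * g x)"
  unfolding rapid_decay_def
proof
  fix m
  obtain D M where 2: "D \<ge> 0" "\<And>x. norm (g x) \<le> D * (1 + \<bar>x\<bar>) ^ M"
    using assms(2) poly_boundedE by blast
  obtain C where 1: "\<And>x. norm (f x) * (1 + \<bar>x\<bar>) ^ (M + m) \<le> C"
    using rapid_decayE[OF assms(1)] by blast
  have "norm (f x * g x) * (1 + \<bar>x\<bar>) ^ m \<le> D * C" for x
  proof -
    have "norm (f x * g x) * (1 + \<bar>x\<bar>) ^ m \<le> norm (f x) * (D * (1 + \<bar>x\<bar>) ^ M) * (1 + \<bar>x\<bar>) ^ m"
      unfolding norm_mult using 2 by (intro mult_mono) auto
    also have "\<dots> = D * (norm (f x) * (1 + \<bar>x\<bar>) ^ (M + m))" by (simp add: power_add mult_ac)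
    also have "\<dots> \<le> D * C" using 1 2 by (intro mult_left_mono) auto
    finally show ?thesis .
  qed
  then show "\<exists>C. \<forall>x. norm (f x * g x) * (1 + \<bar>x\<bar>) ^ m \<le> C" by blast
qed

text \<open>The weights \<open>x ^ m\<close> vanish at the origin, powers of 1 + \<bar>x\<bar> do
  not. The case \<open>m = 0\<close> supplies the control near the origin, through (1 +
  \<bar>x\<bar>)^m \<le> 2^m (1 + \<bar>x\<bar>^m).\<close>

lemma rapid_decay_iff_bounded:
  "rapid_decay f \<longleftrightarrow> (\<forall>m. bounded (range (\<lambda>x. x ^ m *\<^sub>R f x)))"
proof
  assume f: "rapid_decay f"
  show "\<forall>m. bounded (range (\<lambda>x. x ^ m *\<^sub>R f x))"
  proof
    fix m
    obtain C where C: "\<And>x. norm (f x) * (1 + \<bar>x\<bar>) ^ m \<le> C" using rapid_decayE[OF f] by blast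
    have "norm (x ^ m *\<^sub>R f x) \<le> C" for x
    proof -
      have "norm (x ^ m *\<^sub>R f x) \<le> norm (f x) * (1 + \<bar>x\<bar>) ^ m"
        by (subst mult.commute) (auto simp: power_abs intro!: mult_right_mono power_mono)
      with C[of x] show ?thesis by linarith
    qed
    then show "bounded (range (\<lambda>x. x ^ m *\<^sub>R f x))" unfolding bounded_iff by blast
  qed
next
  assume b: "\<forall>m. bounded (range (\<lambda>x. x ^ m *\<^sub>R f x))"
  show "rapid_decay f" unfolding rapid_decay_def
  proof
    fix m
    obtain A where A: "\<And>x. norm (x ^ 0 *\<^sub>R f x) \<le> A" using b unfolding bounded_iff by (metis rangeI)
    obtain B where B: "\<And>x. norm (x ^ m *\<^sub>R f x) \<le> B" using b unfolding bounded_iff by (metis rangeI)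
    have "norm (f x) * (1 + \<bar>x\<bar>) ^ m \<le> 2 ^ m * (A + B)" for x
    proof -
      have "(1 + \<bar>x\<bar>) ^ m \<le> (2 * max 1 \<bar>x\<bar>) ^ m" by (intro power_mono) auto
      also have "\<dots> \<le> 2 ^ m * (1 + \<bar>x\<bar> ^ m)"
        unfolding power_mult_distrib by (intro mult_left_mono) (auto simp: max_def)
      finally have "norm (f x) * (1 + \<bar>x\<bar>) ^ m \<le> norm (f x) * (2 ^ m * (1 + \<bar>x\<bar> ^ m))"
        by (intro mult_left_mono) auto
      also have "\<dots> = 2 ^ m * (norm (x ^ 0 *\<^sub>R f x) + norm (x ^ m *\<^sub>R f x))"
        by (simp add: algebra_simps power_abs)
      also have "\<dots> \<le> 2 ^ m * (A + B)" using A[of x] B[of x] by (intro mult_left_mono add_mono) auto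
      finally show ?thesis .
    qed
    then show "\<exists>C. \<forall>x. norm (f x) * (1 + \<bar>x\<bar>) ^ m \<le> C" by blast
  qed
qed

lemma schwartz_iff: "schwartz f \<longleftrightarrow> (\<forall>n. diff_class rapid_decay n f)"
  unfolding schwartz_def smooth_def all_diff_class_iff rapid_decay_iff_bounded by blast

lemma schwartz_diff_class: "schwartz f \<Longrightarrow> diff_class rapid_decay n f"
  by (simp add: schwartz_iff)

lemma schwartz_rapid: "schwartz f \<Longrightarrow> rapid_decay f"
  using schwartz_diff_class[of f 0] by simp

lemma schwartz_vderiv: "schwartz f \<Longrightarrow> schwartz (vderiv f)"
  unfolding schwartz_iff by (metis diff_class.simps(2))

lemma schwartz_has_vderiv: "schwartz f \<Longrightarrow> (f has_vector_derivative vderiv f x) (at x)"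
  using schwartz_diff_class[of f 1] by (auto intro: vderiv_works)

lemma schwartz_continuous: "schwartz f \<Longrightarrow> continuous_on S f"
  by (meson continuous_at_imp_continuous_on has_vector_derivative_continuous schwartz_has_vderiv)

lemma schwartz_add: "schwartz f \<Longrightarrow> schwartz g \<Longrightarrow> schwartz (\<lambda>x. f x + g x)"
  unfolding schwartz_iff by (auto intro!: diff_class_add rapid_decay_add)

lemma schwartz_times_multiplier: "schwartz f \<Longrightarrow> multiplier g \<Longrightarrow> schwartz (\<lambda>x. f x * g x)"
  unfolding schwartz_iff multiplier_def
  by (auto intro!: diff_class_mult[of rapid_decay poly_bounded] rapid_decay_mult rapid_decay_add)

lemma multiplier_add: "multiplier f \<Longrightarrow> multiplier g \<Longrightarrow> multiplier (\<lambda>x. f x + g x)"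
  unfolding multiplier_def by (auto intro!: diff_class_add poly_bounded_add)

lemma multiplier_mult: "multiplier f \<Longrightarrow> multiplier g \<Longrightarrow> multiplier (\<lambda>x. f x * g x)"
  unfolding multiplier_def
  by (auto intro!: diff_class_mult[of poly_bounded poly_bounded] poly_bounded_mult poly_bounded_add)

lemma multiplier_has_vderiv: "multiplier f \<Longrightarrow> (f has_vector_derivative vderiv f x) (at x)"
  unfolding multiplier_def by (metis diff_class.simps(2) vderiv_works)

text \<open>A real frequency keeps the exponential bounded. The free constant \<open>c\<close> makes
  the family closed under differentiation, which multiplies it by \<i> a.\<close>

lemma multiplier_exp: "multiplier (\<lambda>t. c * exp (\<i> * a * of_real t))" if "a \<in> \<real>"
proof -
  obtain r where r: "a = of_real r" using \<open>a \<in> \<real>\<close> by (auto elim: Reals_cases)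
  have "diff_class poly_bounded n (\<lambda>t. c * exp (\<i> * a * of_real t))" for n
  proof (induction n arbitrary: c)
    case 0
    show ?case by (auto intro!: bounded_imp_poly_bounded[of _ "norm c"] simp: norm_mult r)
  next
    case (Suc n)
    show ?case
    proof (rule diff_class_SucI)
      show "poly_bounded (\<lambda>t. c * exp (\<i> * a * of_real t))"
        by (auto intro!: bounded_imp_poly_bounded[of _ "norm c"] simp: norm_mult r)
      show "((\<lambda>t. c * exp (\<i> * a * of_real t)) has_vector_derivative
          (c * \<i> * a) * exp (\<i> * a * of_real x)) (at x)" for x
        by (auto intro!: derivative_eq_intros has_vector_derivative_real_field simp: algebra_simps)
    qed (rule Suc)
  qed
  then show ?thesis by (simp add: multiplier_def)
qed

lemma multiplier_const: "multiplier (\<lambda>_. c)"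
  using multiplier_exp[of 0 c] by simp

text \<open>The derivative of 1/D is -D' times the square of 1/D, so by induction every derivative
  is polynomially bounded once 1/D is. The lower bound on \<open>D\<close> may itself decay
  polynomially, which is all that small denominators provide.\<close>

lemma multiplier_inverse:
  assumes D: "multiplier D" and c: "c > 0" and low: "\<And>x. norm (D x) * (1 + \<bar>x\<bar>) ^ N \<ge> c"
  shows "multiplier (\<lambda>x. inverse (D x))"
proof -
  have nz: "D x \<noteq> 0" for x using low[of x] c by auto
  have pb: "poly_bounded (\<lambda>x. inverse (D x))"
  proof (rule poly_boundedI[of _ "1 / c" N])
    fix x show "norm (inverse (D x)) \<le> 1 / c * (1 + \<bar>x\<bar>) ^ N"
      using low[of x] nz[of x] c by (simp add: norm_divide divide_simps mult_ac)
  qed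
  have "diff_class poly_bounded n (\<lambda>x. inverse (D x))" for n
  proof (induction n)
    case (Suc n)
    show ?case
    proof (rule diff_class_SucI)
      show "poly_bounded (\<lambda>x. inverse (D x))" by (rule pb)
      show "((\<lambda>x. inverse (D x)) has_vector_derivative
          ((-1) * vderiv D x) * (inverse (D x) * inverse (D x))) (at x)" for x
        using field_vector_diff_chain_at[OF multiplier_has_vderiv[OF D] DERIV_inverse[OF nz], of x]
        by (simp add: o_def field_simps power2_eq_square)
      have "diff_class poly_bounded n (vderiv D)"
        using D unfolding multiplier_def by (metis diff_class.simps(2))
      then show "diff_class poly_bounded n (\<lambda>x. ((-1) * vderiv D x) * (inverse (D x) * inverse (D x)))"
        using Suc multiplier_const[of "-1"] unfolding multiplier_def
        by (intro diff_class_mult[of poly_bounded poly_bounded poly_bounded] poly_bounded_mult poly_bounded_add) auto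
    qed
  qed (use pb in simp)
  then show ?thesis by (simp add: multiplier_def)
qed

text \<open>The weights 1 + \<bar>x\<bar> and 1 + \<bar>a x\<bar> are comparable; the auxiliary
  factor \<open>c\<close> collects the powers of \<open>a\<close> produced by
  differentiation.\<close>

lemma schwartz_scale:
  assumes f: "schwartz f" and a: "a \<noteq> 0" shows "schwartz (\<lambda>x. f (a * x))"
proof -
  have rd: "rapid_decay (\<lambda>x. c * f (a * x))" if f: "rapid_decay f" for f c
    unfolding rapid_decay_def
  proof
    fix m
    obtain C where C: "C \<ge> 0" "\<And>x. norm (f x) * (1 + \<bar>x\<bar>) ^ m \<le> C"
      using rapid_decayE[OF f] by blast
    have "norm (c * f (a * x)) * (1 + \<bar>x\<bar>) ^ m \<le> norm c * (max 1 (1 / \<bar>a\<bar>)) ^ m * C" for x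
    proof -
      have "1 + \<bar>x\<bar> \<le> max 1 (1/\<bar>a\<bar>) * (1 + \<bar>a * x\<bar>)"
      proof -
        have "\<bar>x\<bar> = 1/\<bar>a\<bar> * \<bar>a * x\<bar>" using a by (simp add: abs_mult)
        also have "\<dots> \<le> max 1 (1/\<bar>a\<bar>) * \<bar>a * x\<bar>" by (intro mult_right_mono) auto
        finally show ?thesis by (simp add: algebra_simps) (smt (verit) max.cobounded1)
      qed
      then have "(1 + \<bar>x\<bar>) ^ m \<le> (max 1 (1/\<bar>a\<bar>) * (1 + \<bar>a * x\<bar>)) ^ m" by (intro power_mono) auto
      then have "norm (c * f (a * x)) * (1 + \<bar>x\<bar>) ^ m
          \<le> norm (c * f (a * x)) * (max 1 (1/\<bar>a\<bar>) * (1 + \<bar>a * x\<bar>)) ^ m"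
        by (intro mult_left_mono) auto
      also have "\<dots> = norm c * (max 1 (1 / \<bar>a\<bar>)) ^ m * (norm (f (a * x)) * (1 + \<bar>a * x\<bar>) ^ m)"
        by (simp add: norm_mult power_mult_distrib mult_ac)
      also have "\<dots> \<le> norm c * (max 1 (1 / \<bar>a\<bar>)) ^ m * C"
        using C by (intro mult_left_mono) auto
      finally show ?thesis .
    qed
    then show "\<exists>C. \<forall>x. norm (c * f (a * x)) * (1 + \<bar>x\<bar>) ^ m \<le> C" by blast
  qed
  have "diff_class rapid_decay n (\<lambda>x. c * f (a * x))" if "diff_class rapid_decay n f" for n c
    using that
  proof (induction n arbitrary: f c)
    case (Suc n)
    show ?case
    proof (rule diff_class_SucI)
      show "rapid_decay (\<lambda>x. c * f (a * x))" using Suc.prems by (auto intro: rd)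
      show "((\<lambda>x. c * f (a * x)) has_vector_derivative (c * a) * vderiv f (a * x)) (at x)" for x
      proof -
        have "((\<lambda>x. a * x) has_vector_derivative a) (at x)"
          by (auto intro!: derivative_eq_intros)
        then have "(f \<circ> (\<lambda>x. a * x) has_vector_derivative a *\<^sub>R vderiv f (a * x)) (at x)"
          using Suc.prems by (intro vector_diff_chain_at vderiv_works) auto
        then have "((\<lambda>x. c * f (a * x)) has_vector_derivative c * (a *\<^sub>R vderiv f (a * x))) (at x)"
          unfolding o_def by (rule has_vector_derivative_mult_right)
        then show ?thesis by (simp add: scaleR_conv_of_real mult_ac)
      qed
      show "diff_class rapid_decay n (\<lambda>x. (c * a) * vderiv f (a * x))"
        using Suc by auto
    qed
  qed (auto intro: rd)
  from this[OF schwartz_diff_class[OF f], of _ 1] show ?thesis by (simp add: schwartz_iff)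
qed

lemma schwartz_cmult: "schwartz f \<Longrightarrow> schwartz (\<lambda>x. c * f x)"
  using schwartz_times_multiplier[OF _ multiplier_const[of c]] by (simp add: mult.commute)

lemma multiplier_sin: "multiplier (\<lambda>t. of_real (sin (a * t)))"
proof -
  have "multiplier (\<lambda>t. (1 / (2 * \<i>)) * exp (\<i> * complex_of_real a * of_real t)
         + (- 1 / (2 * \<i>)) * exp (\<i> * complex_of_real (- a) * of_real t))"
    by (intro multiplier_add multiplier_exp) auto
  also have "(\<lambda>t. (1 / (2 * \<i>)) * exp (\<i> * complex_of_real a * of_real t)
         + (- 1 / (2 * \<i>)) * exp (\<i> * complex_of_real (- a) * of_real t)) = (\<lambda>t. of_real (sin (a * t)))"
    by (simp add: sin_of_real[symmetric] sin_exp_eq fun_eq_iff diff_divide_distrib mult_ac)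
  finally show ?thesis .
qed

subsection \<open>The Fourier transform\<close>

lemma integrable_of_quadratic_decay:
  fixes f :: "real \<Rightarrow> complex"
  assumes "continuous_on UNIV f" and "\<And>x. norm (f x) \<le> C / (1 + \<bar>x\<bar>) ^ 2"
  shows "integrable lborel f"
proof (rule Bochner_Integration.integrable_bound)
  have "set_integrable lborel (einterval (-\<infinity>) \<infinity>) (\<lambda>x::real. inverse (1 + x^2))"
    by (rule integrable_inverse_1_plus_square)
  then have "integrable lborel (\<lambda>x::real. inverse (1 + x^2))" by (simp add: set_integrable_def)
  then show "integrable lborel (\<lambda>x::real. C * inverse (1 + x^2))" by simp
  show "f \<in> borel_measurable lborel"
    using borel_measurable_continuous_onI[OF assms(1)] by simp
  have C: "C \<ge> 0" using assms(2)[of 0] order_trans[OF norm_ge_zero[of "f 0"]] by simp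
  have "norm (f x) \<le> norm (C * inverse (1 + x^2))" for x
  proof -
    have "C / (1 + \<bar>x\<bar>) ^ 2 \<le> C / (1 + x^2)"
      using C by (intro divide_left_mono mult_pos_pos add_pos_nonneg zero_less_power)
        (auto simp: power2_sum)
    with assms(2)[of x] C show ?thesis
      by (simp add: divide_inverse abs_mult)
  qed
  then show "AE x in lborel. norm (f x) \<le> norm (C * inverse (1 + x^2))" by simp
qed

lemma schwartz_integrable: "schwartz f \<Longrightarrow> integrable lborel f"
  by (metis integrable_of_quadratic_decay rapid_decay_bound schwartz_continuous schwartz_rapid)

lemma fourier_integrable:
  fixes t :: real
  assumes "integrable lborel f"
  shows "integrable lborel (\<lambda>x::real. exp (- 2 * pi * \<i> * t * x) * f x)"
  by (rule Bochner_Integration.integrable_bound[OF assms])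
     (use assms in \<open>auto simp: norm_mult\<close>)

lemma fourier_bound:
  assumes "integrable lborel f"
  shows "norm (fourier f t) \<le> (LINT x|lborel. norm (f x))"
proof -
  have "norm (fourier f t) \<le> (LINT x|lborel. norm (exp (- 2 * pi * \<i> * t * x) * f x))"
    unfolding fourier_def by (rule integral_norm_bound)
  then show ?thesis by (simp add: norm_mult)
qed

lemma fourier_add:
  "integrable lborel f \<Longrightarrow> integrable lborel g \<Longrightarrow> fourier (\<lambda>x. f x + g x) t = fourier f t + fourier g t"
  unfolding fourier_def distrib_left by (intro Bochner_Integration.integral_add fourier_integrable)

lemma fourier_cmult: "fourier (\<lambda>x. c * f x) t = c * fourier f t"
  unfolding fourier_def by (subst integral_mult_right_zero[symmetric]) (simp add: mult_ac)

lemma fourier_modulate: "fourier (\<lambda>x. exp (2 * pi * \<i> * c * x) * f x) t = fourier f (t - c)"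
proof -
  have "exp (- 2 * pi * \<i> * t * x) * exp (2 * pi * \<i> * c * x) = exp (- 2 * pi * \<i> * (t - c) * x)" for x :: real
    by (simp add: exp_add[symmetric] algebra_simps)
  then show ?thesis unfolding fourier_def of_real_diff
    by (intro Bochner_Integration.integral_cong refl) (simp only: mult.assoc[symmetric])
qed

lemma fourier_scale:
  assumes "a \<noteq> 0" shows "fourier (\<lambda>x. f (a * x)) t = fourier f (t / a) / \<bar>a\<bar>"
proof -
  have "fourier f (t / a) = \<bar>a\<bar> *\<^sub>R (LINT x|lborel. exp (- 2 * pi * \<i> * (t / a) * (0 + a * x)) * f (0 + a * x))"
    unfolding fourier_def by (subst lborel_integral_real_affine[OF assms, of _ 0]) simp
  also have "(LINT x|lborel. exp (- 2 * pi * \<i> * (t / a) * (0 + a * x)) * f (0 + a * x))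
     = fourier (\<lambda>x. f (a * x)) t"
    unfolding fourier_def using assms
    by (intro Bochner_Integration.integral_cong refl) (simp add: mult_ac)
  finally show ?thesis using assms by (simp add: scaleR_conv_of_real)
qed

lemma fourier_reflect: "fourier (\<lambda>x. f (- x)) t = fourier f (- t)"
  using fourier_scale[of "-1" f t] by simp

lemma rapid_decay_tendsto_0:
  assumes "rapid_decay f" shows "(f \<longlongrightarrow> 0) at_infinity"
proof -
  obtain C where C: "C \<ge> 0" "\<And>x. norm (f x) \<le> C / (1 + \<bar>x\<bar>) ^ 1" using rapid_decay_bound[OF assms] by blast
  have "filterlim (\<lambda>x::real. 1 + norm x) at_infinity at_infinity"
    by (intro filterlim_at_top_imp_at_infinity filterlim_tendsto_add_at_top[OF tendsto_const] filterlim_norm_at_top)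
  then have "((\<lambda>x::real. C / (1 + norm x)) \<longlongrightarrow> 0) at_infinity"
    by (rule tendsto_divide_0[OF tendsto_const])
  then show ?thesis
    by (rule Lim_null_comparison[rotated]) (use C in auto)
qed

lemma integral_derivative_eq_0:
  fixes F :: "real \<Rightarrow> complex"
  assumes "\<And>x. (F has_vector_derivative f x) (at x)" "continuous_on UNIV f" "integrable lborel f"
    "rapid_decay F"
  shows "(LINT x|lborel. f x) = 0"
proof -
  have 1: "(F \<longlongrightarrow> 0) at_top" "(F \<longlongrightarrow> 0) at_bot"
    using rapid_decay_tendsto_0[OF assms(4)]
    by (meson at_top_le_at_infinity at_bot_le_at_infinity tendsto_mono)+
  have "(LBINT x=-\<infinity>..\<infinity>. f x) = 0 - 0"
    using assms(1-3) 1
    by (intro interval_integral_FTC_integrable[where F = F])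
       (auto simp: ereal_tendsto_simps continuous_on_eq_continuous_at set_integrable_def)
  then show ?thesis by (simp add: interval_lebesgue_integral_def set_lebesgue_integral_def)
qed

text \<open>Integration by parts: e f' - 2 pi \<i> t e f is the derivative of e f, which tends to 0
  at both ends.\<close>

lemma fourier_vderiv:
  assumes f: "schwartz f" shows "fourier (vderiv f) t = 2 * pi * \<i> * t * fourier f t"
proof -
  define e where "e = (\<lambda>x::real. exp (- 2 * pi * \<i> * t * x))"
  have int: "integrable lborel (\<lambda>x. e x * f x)" "integrable lborel (\<lambda>x. e x * vderiv f x)"
    unfolding e_def using f by (intro fourier_integrable schwartz_integrable schwartz_vderiv; simp)+
  have cont: "continuous_on UNIV e" unfolding e_def by (intro continuous_intros)
  have d: "((\<lambda>x. e x * f x) has_vector_derivative e x * vderiv f x - 2 * pi * \<i> * t * (e x * f x)) (at x)" for x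
  proof -
    have "(e has_vector_derivative (- 2 * pi * \<i> * t) * e x) (at x)"
      unfolding e_def by (auto intro!: derivative_eq_intros has_vector_derivative_real_field)
    from has_vector_derivative_mult[OF this schwartz_has_vderiv[OF f]] show ?thesis
      by (simp add: algebra_simps)
  qed
  have "(LINT x|lborel. e x * vderiv f x - 2 * pi * \<i> * t * (e x * f x)) = 0"
  proof (rule integral_derivative_eq_0[OF d])
    show "continuous_on UNIV (\<lambda>x. e x * vderiv f x - 2 * pi * \<i> * t * (e x * f x))"
      using f by (intro continuous_intros cont schwartz_continuous schwartz_vderiv)
    have "poly_bounded e" unfolding e_def by (rule bounded_imp_poly_bounded[of _ 1]) auto
    then show "rapid_decay (\<lambda>x. e x * f x)"
      using rapid_decay_mult[OF schwartz_rapid[OF f]] by (simp add: mult.commute)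
  qed (use int in auto)
  moreover have "fourier g t = (LINT x|lborel. e x * g x)" for g
    by (simp add: fourier_def e_def)
  ultimately show ?thesis using int by simp
qed

lemma schwartz_funpow: "schwartz f \<Longrightarrow> schwartz ((vderiv ^^ n) f)"
  by (induction n) (auto intro: schwartz_vderiv)

lemma fourier_funpow_vderiv:
  assumes f: "schwartz f" shows "fourier ((vderiv ^^ n) f) t = (2 * pi * \<i> * t) ^ n * fourier f t"
  by (induction n) (simp_all add: fourier_vderiv schwartz_funpow f)

text \<open>Up to the factor (2 pi \<i>)^m, multiplying the transform by t^m means transforming the
  \<open>m\<close>-th derivative, and a transform is bounded by an L^1 norm.\<close>

lemma fourier_rapid:
  assumes f: "schwartz f" shows "rapid_decay (fourier f)"
  unfolding rapid_decay_iff_bounded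
proof
  fix m
  define C where "C = (LINT x|lborel. norm ((vderiv ^^ m) f x))"
  have "norm (t ^ m *\<^sub>R fourier f t) \<le> C" for t
  proof -
    have "norm (fourier ((vderiv ^^ m) f) t) \<le> C"
      unfolding C_def using f by (intro fourier_bound schwartz_integrable schwartz_funpow)
    then have "(2 * pi) ^ m * norm (t ^ m *\<^sub>R fourier f t) \<le> C"
      by (simp add: fourier_funpow_vderiv[OF f] norm_mult norm_power power_mult_distrib mult_ac abs_mult power_abs)
    moreover have "1 * norm (t ^ m *\<^sub>R fourier f t) \<le> (2 * pi) ^ m * norm (t ^ m *\<^sub>R fourier f t)"
      using pi_gt3 by (intro mult_right_mono one_le_power) auto
    ultimately show ?thesis by linarith
  qed
  then show "bounded (range (\<lambda>t. t ^ m *\<^sub>R fourier f t))" unfolding bounded_iff by blast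
qed

lemma continuous_fourier:
  assumes f: "integrable lborel f" shows "continuous_on S (fourier f)"
proof -
  have "isCont (fourier f) t" for t
    unfolding continuous_at_sequentially
  proof (intro allI impI)
    fix X :: "nat \<Rightarrow> real" assume X: "X \<longlonglongrightarrow> t"
    show "(fourier f \<circ> X) \<longlonglongrightarrow> fourier f t"
      unfolding fourier_def o_def
    proof (rule integral_dominated_convergence[where w = "\<lambda>x. norm (f x)"])
      show "AE x in lborel. (\<lambda>n. exp (- 2 * pi * \<i> * X n * x) * f x) \<longlonglongrightarrow> exp (- 2 * pi * \<i> * t * x) * f x"
        using X by (auto intro!: tendsto_intros)
    qed (use f in \<open>auto simp: norm_mult intro!: borel_measurable_integrable\<close>)
  qed
  then show ?thesis by (simp add: continuous_at_imp_continuous_on)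
qed

section \<open>Sine quotients as transforms of intervals\<close>

text \<open>This is sin(pi w t) / (pi t). As an integral over an interval it is smooth across t = 0
  without a case distinction, and multiplication by it becomes averaging over that interval on the
  transform side.\<close>

definition sincw :: "real \<Rightarrow> real \<Rightarrow> complex" where
  "sincw w t = integral {- w/2..w/2} (\<lambda>u::real. exp (2 * pi * \<i> * t * u))"

text \<open>Differentiation in \<open>t\<close> multiplies the density \<open>p\<close> by 2 pi \<i>
  u, so these integrals form a family closed under derivatives. This gives smoothness of
  \<open>sincw\<close> and its Taylor coefficients at once.\<close>

lemma trig_moment_has_vector_derivative:
  fixes p :: "real \<Rightarrow> complex"
  assumes "continuous_on {a..b} p"
  shows "((\<lambda>t. integral {a..b} (\<lambda>u. p u * exp (2 * pi * \<i> * t * u))) has_vector_derivative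
     integral {a..b} (\<lambda>u. (2 * pi * \<i> * u * p u) * exp (2 * pi * \<i> * t * u))) (at t)"
proof -
  have "((\<lambda>t. integral (cbox a b) (\<lambda>u. p u * exp (2 * pi * \<i> * t * u))) has_vector_derivative
     integral (cbox a b) (\<lambda>u. (2 * pi * \<i> * u * p u) * exp (2 * pi * \<i> * t * u))) (at t within UNIV)"
  proof (rule leibniz_rule_vector_derivative)
    show "((\<lambda>t. p u * exp (2 * pi * \<i> * t * u)) has_vector_derivative
       (2 * pi * \<i> * u * p u) * exp (2 * pi * \<i> * t * u)) (at t within UNIV)" for t u :: real
      by (auto intro!: derivative_eq_intros has_vector_derivative_real_field simp: algebra_simps)
    show "(\<lambda>u. p u * exp (2 * pi * \<i> * t * u)) integrable_on cbox a b" for t :: real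
      using assms by (intro integrable_continuous continuous_intros) auto
    show "continuous_on (UNIV \<times> cbox a b) (\<lambda>(t::real, u). (2 * pi * \<i> * u * p u) * exp (2 * pi * \<i> * t * u))"
      unfolding split_beta using assms
      by (intro continuous_intros continuous_on_compose2[OF assms]) auto
  qed auto
  then show ?thesis by simp
qed

lemma multiplier_trig_moment:
  fixes p :: "real \<Rightarrow> complex"
  assumes "continuous_on {a..b} p"
  shows "multiplier (\<lambda>t::real. integral {a..b} (\<lambda>u. p u * exp (2 * pi * \<i> * t * u)))"
proof -
  have pb: "poly_bounded (\<lambda>t::real. integral {a..b} (\<lambda>u. p u * exp (2 * pi * \<i> * t * u)))"
    if p: "continuous_on {a..b} p" for p :: "real \<Rightarrow> complex"
  proof (rule bounded_imp_poly_bounded)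
    fix t :: real
    show "norm (integral {a..b} (\<lambda>u. p u * exp (2 * pi * \<i> * t * u))) \<le> integral {a..b} (\<lambda>u. norm (p u))"
      using p by (intro integral_norm_bound_integral integrable_continuous_real continuous_intros)
        (auto simp: norm_mult)
  qed
  have "diff_class poly_bounded n (\<lambda>t::real. integral {a..b} (\<lambda>u. p u * exp (2 * pi * \<i> * t * u)))" for n
    using assms
  proof (induction n arbitrary: p)
    case (Suc n)
    show ?case
    proof (rule diff_class_SucI)
      show "poly_bounded (\<lambda>t::real. integral {a..b} (\<lambda>u. p u * exp (2 * pi * \<i> * t * u)))"
        by (rule pb[OF Suc.prems])
      show "((\<lambda>t. integral {a..b} (\<lambda>u. p u * exp (2 * pi * \<i> * t * u))) has_vector_derivative
         integral {a..b} (\<lambda>u. (2 * pi * \<i> * u * p u) * exp (2 * pi * \<i> * t * u))) (at t)" for t :: real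
        by (rule trig_moment_has_vector_derivative[OF Suc.prems])
      show "diff_class poly_bounded n (\<lambda>t. integral {a..b} (\<lambda>u. (2 * pi * \<i> * u * p u) * exp (2 * pi * \<i> * t * u)))"
        by (rule Suc.IH) (intro continuous_intros Suc.prems)
    qed
  qed (use pb in auto)
  then show ?thesis by (simp add: multiplier_def)
qed

lemma multiplier_sincw: "multiplier (sincw w)"
  using multiplier_trig_moment[of "-w/2" "w/2" "\<lambda>_. 1"] unfolding sincw_def by simp

lemma sincw_0: "w \<ge> 0 \<Longrightarrow> sincw w 0 = w"
  by (simp add: sincw_def field_simps scaleR_conv_of_real)

text \<open>These are moments of the interval: the first vanishes by symmetry, the second yields the
  expansion w - pi^2 w^3 t^2 / 6 + .... The sum of squares \<open>Q\<close> in the final formula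
  originates here.\<close>

lemma sincw_vderiv_0:
  assumes "w \<ge> 0"
  shows "vderiv (sincw w) 0 = 0" "vderiv (vderiv (sincw w)) 0 = - (pi\<^sup>2 * w ^ 3 / 3)"
proof -
  have 1: "vderiv (sincw w) = (\<lambda>t. integral {- w/2..w/2} (\<lambda>u::real. (2 * pi * \<i> * u) * exp (2 * pi * \<i> * t * u)))"
    using trig_moment_has_vector_derivative[of "-w/2" "w/2" "\<lambda>_. 1"]
    by (intro vderiv_eqI) (simp add: sincw_def[abs_def])
  have 2: "vderiv (vderiv (sincw w)) = (\<lambda>t. integral {- w/2..w/2}
     (\<lambda>u::real. (2 * pi * \<i> * u * (2 * pi * \<i> * u)) * exp (2 * pi * \<i> * t * u)))"
    unfolding 1
    by (intro vderiv_eqI trig_moment_has_vector_derivative continuous_intros)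
  have "((\<lambda>u::real. 2 * pi * \<i> * u) has_integral (pi * \<i> * of_real (w/2) ^ 2 - pi * \<i> * of_real (-w/2) ^ 2)) {-w/2..w/2}"
    using assms by (intro fundamental_theorem_of_calculus)
      (auto intro!: derivative_eq_intros has_vector_derivative_real_field simp: algebra_simps)
  from integral_unique[OF this] show "vderiv (sincw w) 0 = 0" unfolding 1 by (simp add: power2_eq_square)
  have I2: "((\<lambda>u::real. 2 * pi * \<i> * u * (2 * pi * \<i> * u)) has_integral
     (- 4 * complex_of_real pi ^ 2 / 3 * of_real (w/2) ^ 3 - (- 4 * complex_of_real pi ^ 2 / 3 * of_real (-w/2) ^ 3))) {-w/2..w/2}"
    using assms by (intro fundamental_theorem_of_calculus)
      (auto intro!: derivative_eq_intros has_vector_derivative_real_field simp: algebra_simps power2_eq_square)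
  have "(- 4 * complex_of_real pi ^ 2 / 3 * of_real (w/2) ^ 3 - (- 4 * complex_of_real pi ^ 2 / 3 * of_real (-w/2) ^ 3))
     = - (complex_of_real pi ^ 2 * of_real w ^ 3 / 3)"
    by (simp add: power_divide power3_eq_cube)
  with integral_unique[OF I2] show "vderiv (vderiv (sincw w)) 0 = - (pi\<^sup>2 * w ^ 3 / 3)"
    unfolding 2 by (simp only: of_real_0 mult_zero_left mult_zero_right exp_zero mult_1_right of_real_minus of_real_divide of_real_mult of_real_power of_real_numeral)
qed

lemma sin_eq_sincw:
  assumes "w \<ge> 0" shows "of_real (sin (pi * w * t)) = pi * t * sincw w t"
proof (cases "t = 0")
  case False
  define G where "G = (\<lambda>u::real. exp (2 * pi * \<i> * t * u) / (2 * pi * \<i> * t))"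
  have "((\<lambda>u::real. exp (2 * pi * \<i> * t * u)) has_integral (G (w/2) - G (-w/2))) {-w/2..w/2}"
    unfolding G_def using assms False by (intro fundamental_theorem_of_calculus)
      (auto intro!: derivative_eq_intros has_vector_derivative_real_field)
  then have "sincw w t = G (w/2) - G (-w/2)" unfolding sincw_def by (rule integral_unique)
  also have "pi * t * \<dots> = (exp (\<i> * (pi * w * t)) - exp (- (\<i> * (pi * w * t)))) / (2 * \<i>)"
    unfolding G_def using False by (simp add: field_simps)
  also have "\<dots> = of_real (sin (pi * w * t))"
    by (simp add: sin_of_real[symmetric] sin_exp_eq)
  finally show ?thesis by simp
qed auto

text \<open>By Fubini, multiplication by the transform of an interval is convolution with its
  indicator function.\<close>

lemma fourier_sincw:
  assumes h: "integrable lborel h"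
  shows "fourier (\<lambda>t. sincw w t * h t) x = integral {- w/2..w/2} (\<lambda>u. fourier h (x - u))"
proof -
  let ?I = "indicator {- w/2..w/2} :: real \<Rightarrow> real"
  define g where "g = (\<lambda>t u. ?I u *\<^sub>R (exp (- 2 * pi * \<i> * (x - u) * t) * h t))"
  have [measurable]: "h \<in> borel_measurable borel" using h by (simp add: borel_measurable_integrable)
  have int: "integrable (lborel \<Otimes>\<^sub>M lborel) (\<lambda>(t, u). g t u)"
  proof (rule lborel_pair.Fubini_integrable)
    show "(\<lambda>(t, u). g t u) \<in> borel_measurable (lborel \<Otimes>\<^sub>M lborel)" unfolding g_def by measurable
    have *: "norm (g t u) = ?I u * norm (h t)" for t u
      by (simp add: g_def norm_mult)
    have "integrable lborel (\<lambda>t. measure lborel {- w/2..w/2} * norm (h t))" using h by auto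
    then show "integrable lborel (\<lambda>t. LINT u|lborel. norm (case (t, u) of (t, u) \<Rightarrow> g t u))"
      by (simp add: * )
    have "integrable lborel (g t)" for t
    proof (rule Bochner_Integration.integrable_bound)
      show "integrable lborel (\<lambda>u. ?I u * norm (h t))" by (intro integrable_mult_left) (auto simp: emeasure_lborel_Icc_eq)
      show "g t \<in> borel_measurable lborel" unfolding g_def by measurable
    qed (simp add: * )
    then show "AE t in lborel. integrable lborel (\<lambda>u. case (t, u) of (t, u) \<Rightarrow> g t u)" by simp
  qed
  have "sincw w t = (LINT u|lborel. ?I u *\<^sub>R exp (2 * pi * \<i> * t * u))" for t
    unfolding sincw_def
    using set_borel_integral_eq_integral(2)[OF borel_integrable_atLeastAtMost', of "- w/2" "w/2" "\<lambda>u::real. exp (2 * pi * \<i> * t * u)"]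
    by (simp add: set_lebesgue_integral_def continuous_intros)
  then have "fourier (\<lambda>t. sincw w t * h t) x
     = (LINT t|lborel. exp (- 2 * pi * \<i> * x * t) * (LINT u|lborel. ?I u *\<^sub>R exp (2 * pi * \<i> * t * u)) * h t)"
    unfolding fourier_def by (simp add: mult.assoc)
  also have "\<dots> = (LINT t|lborel. LINT u|lborel. g t u)"
  proof (rule Bochner_Integration.integral_cong[OF refl])
    fix t :: real
    have "exp (- 2 * pi * \<i> * (x - u) * t) = exp (- 2 * pi * \<i> * x * t) * exp (2 * pi * \<i> * t * u)" for u :: real
      by (simp add: exp_add[symmetric] algebra_simps)
    then have "g t u = exp (- 2 * pi * \<i> * x * t) * (?I u *\<^sub>R exp (2 * pi * \<i> * t * u)) * h t" for u
      unfolding g_def by (simp only: scaleR_conv_of_real mult_ac)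
    then show "exp (- 2 * pi * \<i> * x * t) * (LINT u|lborel. ?I u *\<^sub>R exp (2 * pi * \<i> * t * u)) * h t = (LINT u|lborel. g t u)"
      by (simp only: integral_mult_left_zero integral_mult_right_zero)
  qed
  also have "\<dots> = (LINT u|lborel. LINT t|lborel. g t u)"
    using lborel_pair.Fubini_integral[OF int] by simp
  also have "\<dots> = (LINT u:{- w/2..w/2}|lborel. fourier h (x - u))"
    unfolding set_lebesgue_integral_def g_def fourier_def by simp
  also have "\<dots> = integral {- w/2..w/2} (\<lambda>u. fourier h (x - u))"
    by (intro set_borel_integral_eq_integral borel_integrable_atLeastAtMost'
        continuous_on_compose2[OF continuous_fourier[OF h, of UNIV]] continuous_intros) auto
  finally show ?thesis .
qed

section \<open>Sums over the integers and integrals over unit cells\<close>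

lemma summable_on_bounded_by:
  fixes f :: "'a \<Rightarrow> complex"
  assumes "g summable_on A" "\<And>x. x \<in> A \<Longrightarrow> norm (f x) \<le> g x"
  shows "(\<lambda>x. norm (f x)) summable_on A" "f summable_on A"
proof -
  have "(\<lambda>x. norm (g x)) summable_on A"
    using assms(1) by (rule iffD1[OF summable_on_iff_abs_summable_on_real])
  moreover have "norm (f x) \<le> norm (g x)" if "x \<in> A" for x
    using assms(2)[OF that] order_trans[OF norm_ge_zero assms(2)[OF that]] by simp
  ultimately show 1: "(\<lambda>x. norm (f x)) summable_on A"
    by (rule Infinite_Sum.abs_summable_on_comparison_test)
  show "f summable_on A" by (rule abs_summable_summable[OF 1])
qed

lemma summable_on_nat_inverse_square: "(\<lambda>n::nat. 1 / (1 + real n) ^ 2) summable_on UNIV"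
proof -
  have "summable (\<lambda>n. inverse (real (Suc n) ^ 2))"
    by (subst summable_Suc_iff) (rule inverse_power_summable, simp)
  then have "summable (\<lambda>n. 1 / (1 + real n) ^ 2)" by (simp add: field_simps)
  then show ?thesis by (subst summable_on_UNIV_nonneg_real_iff) auto
qed

lemma summable_on_int_inverse_square: "(\<lambda>k::int. C / (1 + \<bar>real_of_int k\<bar>) ^ 2) summable_on UNIV"
proof -
  let ?f = "\<lambda>k::int. 1 / (1 + \<bar>real_of_int k\<bar>) ^ 2"
  have 1: "?f summable_on (range int)"
    by (subst summable_on_reindex) (auto simp: o_def summable_on_nat_inverse_square)
  have 2: "?f summable_on (range (\<lambda>n. - int n))"
    by (subst summable_on_reindex) (auto simp: o_def summable_on_nat_inverse_square inj_on_def)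
  have U: "UNIV = range int \<union> (range (\<lambda>n. - int n) - range int)"
    by (auto, metis int_cases2 rangeI)
  have "?f summable_on UNIV"
    by (subst U, rule summable_on_Un_disjoint) (use 1 2 in \<open>auto intro: summable_on_subset_banach\<close>)
  then have "(\<lambda>k. C * ?f k) summable_on UNIV" by (rule summable_on_cmult_right)
  then show ?thesis by simp
qed

lemma rapid_decay_summable_int:
  assumes "rapid_decay f" shows "(\<lambda>k::int. norm (f (of_int k))) summable_on UNIV"
    "(\<lambda>k::int. f (of_int k)) summable_on UNIV"
proof -
  obtain C where C: "C \<ge> 0" "\<And>x. norm (f x) \<le> C / (1 + \<bar>x\<bar>) ^ 2" using rapid_decay_bound[OF assms] by blast
  from summable_on_bounded_by[OF summable_on_int_inverse_square, of _ C, OF C(2)]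
  show "(\<lambda>k::int. norm (f (of_int k))) summable_on UNIV" "(\<lambda>k::int. f (of_int k)) summable_on UNIV"
    by auto
qed

text \<open>The sets from -N to N eventually contain every finite set of integers, so once
  unconditional summability is known the symmetric partial sums determine the value.\<close>

lemma has_sum_int_of_symmetric_limit:
  fixes f :: "int \<Rightarrow> complex"
  assumes "f summable_on UNIV" "(\<lambda>N. \<Sum>k=- int N..int N. f k) \<longlonglongrightarrow> L"
  shows "(f has_sum L) UNIV"
proof -
  obtain S where S: "(f has_sum S) UNIV" using assms(1) summable_on_def by blast
  have "filterlim (\<lambda>N. {- int N..int N}) (finite_subsets_at_top UNIV) sequentially"
    unfolding filterlim_finite_subsets_at_top
  proof (intro allI impI)
    fix X :: "int set" assume X: "finite X \<and> X \<subseteq> UNIV"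
    define M where "M = nat (Max (insert 0 (abs ` X)))"
    have "X \<subseteq> {- int N..int N}" if "N \<ge> M" for N
    proof
      fix x assume "x \<in> X"
      then have "\<bar>x\<bar> \<le> Max (insert 0 (abs ` X))" using X by (intro Max_ge) auto
      then show "x \<in> {- int N..int N}" using that by (auto simp: M_def)
    qed
    then show "eventually (\<lambda>N. finite {- int N..int N} \<and> X \<subseteq> {- int N..int N} \<and> {- int N..int N} \<subseteq> UNIV) sequentially"
      by (auto simp: eventually_sequentially)
  qed
  with S have "(\<lambda>N. \<Sum>k=- int N..int N. f k) \<longlonglongrightarrow> S"
    unfolding has_sum_def by (rule filterlim_compose)
  with assms(2) S show ?thesis using LIMSEQ_unique by blast
qed

text \<open>The endpoints are half-integers because these intervals are unions of the unit cells
  centred at the integers from -N to N.\<close>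

lemma symmetric_integral_tendsto:
  fixes f :: "real \<Rightarrow> complex"
  assumes f: "continuous_on UNIV f" "integrable lborel f"
  shows "(\<lambda>N::nat. integral {- (real N + 1/2)..real N + 1/2} f) \<longlonglongrightarrow> (LINT t|lborel. f t)"
proof -
  have "(\<lambda>N::nat. LINT t|lborel. indicator {- (real N + 1/2)..real N + 1/2} t *\<^sub>R f t) \<longlonglongrightarrow> (LINT t|lborel. f t)"
  proof (rule integral_dominated_convergence[where w = "\<lambda>t. norm (f t)"])
    have "(\<lambda>N::nat. indicator {- (real N + 1/2)..real N + 1/2} t *\<^sub>R f t) \<longlonglongrightarrow> f t" for t
    proof (rule tendsto_eventually)
      obtain M :: nat where "\<bar>t\<bar> \<le> real M" using real_arch_simple by blast
      then show "\<forall>\<^sub>F N in sequentially. indicator {- (real N + 1/2)..real N + 1/2} t *\<^sub>R f t = f t"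
        by (intro eventually_sequentiallyI[of M]) (auto simp: indicator_def)
    qed
    then show "AE t in lborel. (\<lambda>N::nat. indicator {- (real N + 1/2)..real N + 1/2} t *\<^sub>R f t) \<longlonglongrightarrow> f t" by simp
  qed (use f in \<open>auto simp: indicator_def intro!: borel_measurable_integrable\<close>)
  moreover have "(LINT t|lborel. indicator {- (real N + 1/2)..real N + 1/2} t *\<^sub>R f t)
      = integral {- (real N + 1/2)..real N + 1/2} f" for N
    using set_borel_integral_eq_integral(2)[OF borel_integrable_atLeastAtMost', of "- (real N + 1/2)" "real N + 1/2" f]
      f(1) by (simp add: set_lebesgue_integral_def continuous_on_subset)
  ultimately show ?thesis by simp
qed

lemma one_plus_abs_shift_le:
  fixes t y :: real assumes "\<bar>t\<bar> \<le> 1/2" shows "1 + \<bar>y\<bar> \<le> 2 * (1 + \<bar>t + y\<bar>)"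
proof -
  have "\<bar>y\<bar> \<le> \<bar>t + y\<bar> + \<bar>t\<bar>" using abs_triangle_ineq4[of "t + y" t] by simp
  also have "\<dots> \<le> \<bar>t + y\<bar> + 1/2" using assms by simp
  finally have "1 + \<bar>y\<bar> \<le> 3/2 + \<bar>t + y\<bar>" by simp
  also have "\<dots> \<le> 2 * (1 + \<bar>t + y\<bar>)" by simp
  finally show ?thesis .
qed

text \<open>Makes a decay bound uniform over a unit cell; 4 is the square of the constant 2 in
  \<open>one_plus_abs_shift_le\<close>.\<close>

lemma quadratic_decay_shift:
  fixes t y :: real assumes "\<bar>t\<bar> \<le> 1/2" "C \<ge> 0" shows "C / (1 + \<bar>t + y\<bar>) ^ 2 \<le> 4 * C / (1 + \<bar>y\<bar>) ^ 2"
proof -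
  have pos: "1 + \<bar>y\<bar> > 0" "1 + \<bar>t + y\<bar> > 0" by auto
  have "(1 + \<bar>y\<bar>) ^ 2 \<le> (2 * (1 + \<bar>t + y\<bar>)) ^ 2"
    using one_plus_abs_shift_le[OF assms(1), of y] by (intro power_mono) auto
  then have le: "(1 + \<bar>y\<bar>) ^ 2 \<le> 4 * (1 + \<bar>t + y\<bar>) ^ 2" unfolding power_mult_distrib by simp
  have "C / (1 + \<bar>t + y\<bar>) ^ 2 = 4 * C / (4 * (1 + \<bar>t + y\<bar>) ^ 2)" by simp
  also have "\<dots> \<le> 4 * C / (1 + \<bar>y\<bar>) ^ 2"
    using le assms(2) pos by (intro divide_left_mono mult_pos_pos zero_less_power) auto
  finally show ?thesis .
qed

lemma integral_over_unit_intervals: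
  fixes f :: "real \<Rightarrow> complex"
  assumes f: "continuous_on UNIV f" and C: "C \<ge> 0" "\<And>x. norm (f x) \<le> C / (1 + \<bar>x\<bar>) ^ 2"
  shows "((\<lambda>k::int. integral {-1/2..1/2} (\<lambda>t. f (t + of_int k))) has_sum (LINT t|lborel. f t)) UNIV"
proof (rule has_sum_int_of_symmetric_limit)
  have cont: "continuous_on S (\<lambda>t. f (t + c))" for S c
    by (intro continuous_on_compose2[OF f] continuous_intros) auto
  show "(\<lambda>k::int. integral {-1/2..1/2} (\<lambda>t. f (t + of_int k))) summable_on UNIV"
  proof (rule summable_on_bounded_by(2)[OF summable_on_int_inverse_square])
    fix k :: int
    have "norm (integral {-1/2..1/2} (\<lambda>t. f (t + of_int k))) \<le> integral {-1/2..1/2::real} (\<lambda>_. 4 * C / (1 + \<bar>real_of_int k\<bar>) ^ 2)"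
    proof (rule integral_norm_bound_integral)
      fix t :: real assume t: "t \<in> {-1/2..1/2}"
      show "norm (f (t + of_int k)) \<le> 4 * C / (1 + \<bar>real_of_int k\<bar>) ^ 2"
        by (rule order_trans[OF C(2) quadratic_decay_shift]) (use t C(1) in auto)
    qed (auto intro!: integrable_continuous_real cont)
    then show "norm (integral {-1/2..1/2} (\<lambda>t. f (t + of_int k))) \<le> 4 * C / (1 + \<bar>real_of_int k\<bar>) ^ 2" by simp
  qed
  have shift: "integral {-1/2..1/2} (\<lambda>t. f (t + c)) = integral {c-1/2..c+1/2} f" for c
    using integral_shift_real_ivl[of "c - 1/2" c "c + 1/2" f] by simp
  have int: "f integrable_on {a..b}" for a b
    using f by (intro integrable_continuous_real) (auto intro: continuous_on_subset)
  have "(\<Sum>k=- int N..int N. integral {-1/2..1/2} (\<lambda>t. f (t + of_int k))) = integral {- (real N + 1/2)..real N + 1/2} f" for N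
  proof (induction N)
    case 0 show ?case by simp
  next
    case (Suc N)
    have "{- int (Suc N)..int (Suc N)} = insert (- int (Suc N)) (insert (int (Suc N)) {- int N..int N})" by auto
    then have "(\<Sum>k=- int (Suc N)..int (Suc N). integral {-1/2..1/2} (\<lambda>t. f (t + of_int k)))
       = integral {- (real N + 3/2)..- (real N + 1/2)} f + (integral {real N + 1/2..real N + 3/2} f
         + integral {- (real N + 1/2)..real N + 1/2} f)"
      using Suc.IH shift[of "- 1 - real N"] shift[of "1 + real N"]
      by (simp add: algebra_simps minus_diff_commute)
    also have "\<dots> = integral {- (real N + 3/2)..- (real N + 1/2)} f + integral {- (real N + 1/2)..real N + 3/2} f"
      using Henstock_Kurzweil_Integration.integral_combine[of "- (real N + 1/2)" "real N + 1/2" "real N + 3/2" f] int by (simp add: add.commute)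
    also have "\<dots> = integral {- (real N + 3/2)..real N + 3/2} f"
      using int by (intro Henstock_Kurzweil_Integration.integral_combine) auto
    finally show ?case by (simp add: algebra_simps)
  qed
  then show "(\<lambda>N. \<Sum>k=- int N..int N. integral {-1/2..1/2} (\<lambda>t. f (t + of_int k))) \<longlonglongrightarrow> (LINT t|lborel. f t)"
    using symmetric_integral_tendsto[OF f integrable_of_quadratic_decay[OF f C(2)]] by simp
qed

text \<open>The M-test gives uniform convergence along the net of finite index sets, and uniform
  limits pass through an integral over a compact interval.\<close>

lemma has_sum_integral:
  fixes f :: "'a \<Rightarrow> real \<Rightarrow> complex"
  assumes "\<And>k. continuous_on {a..b} (f k)" "M summable_on UNIV"
    "\<And>k t. t \<in> {a..b} \<Longrightarrow> norm (f k t) \<le> M k"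
  shows "((\<lambda>k. integral {a..b} (f k)) has_sum integral {a..b} (\<lambda>t. \<Sum>\<^sub>\<infinity>k. f k t)) UNIV"
proof -
  have ul: "uniform_limit {a..b} (\<lambda>X t. \<Sum>k\<in>X. f k t) (\<lambda>t. \<Sum>\<^sub>\<infinity>k. f k t) (finite_subsets_at_top UNIV)"
    by (rule Weierstrass_m_test_general) (use assms in auto)
  obtain I J where IJ: "\<And>X. ((\<lambda>t. \<Sum>k\<in>X. f k t) has_integral I X) {a..b}"
    "((\<lambda>t. \<Sum>\<^sub>\<infinity>k. f k t) has_integral J) {a..b}" "(I \<longlongrightarrow> J) (finite_subsets_at_top UNIV)"
    by (rule uniform_limit_integral[OF ul]) (use assms(1) in \<open>auto intro!: continuous_on_sum\<close>)
  have "eventually (\<lambda>X. I X = (\<Sum>k\<in>X. integral {a..b} (f k))) (finite_subsets_at_top UNIV)"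
  proof (rule eventually_finite_subsets_at_top_weakI)
    fix X :: "'a set" assume "finite X"
    then have "((\<lambda>t. \<Sum>k\<in>X. f k t) has_integral (\<Sum>k\<in>X. integral {a..b} (f k))) {a..b}"
      using assms(1) by (intro has_integral_sum integrable_integral integrable_continuous_real)
    with IJ(1) show "I X = (\<Sum>k\<in>X. integral {a..b} (f k))" using has_integral_unique by blast
  qed
  then have "((\<lambda>X. \<Sum>k\<in>X. integral {a..b} (f k)) \<longlongrightarrow> J) (finite_subsets_at_top UNIV)"
    by (rule Lim_transform_eventually[OF IJ(3)])
  then show ?thesis using integral_unique[OF IJ(2)] by (simp add: has_sum_def)
qed

lemma integral_exp_int:
  "integral {-1/2..1/2} (\<lambda>u::real. exp (2 * pi * \<i> * of_int k * u)) = (if k = 0 then 1 else 0)"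
proof (cases "k = 0")
  case False
  have "of_real (sin (pi * of_int k)) = pi * of_int k * sincw 1 (of_int k)"
    using sin_eq_sincw[of 1 "of_int k"] by simp
  moreover have "sin (pi * of_int k) = 0" by (simp add: sin_int_times_real mult.commute)
  ultimately have "sincw 1 (of_int k) = 0" using False by simp
  then show ?thesis using False by (simp add: sincw_def)
qed simp

text \<open>Jordan's inequality: sine is concave on [0, pi/2], hence lies above its chord, here at
  the fraction 2\<bar>t\<bar> of that interval.\<close>

lemma two_abs_le_abs_sin_pi:
  assumes "\<bar>t\<bar> \<le> 1/2" shows "2 * \<bar>t\<bar> \<le> \<bar>sin (pi * t)\<bar>"
proof -
  have "concave_on {0..pi/2} sin"
    by (rule f''_le0_imp_concave[where f' = cos and f'' = "\<lambda>x. - sin x"])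
       (auto intro!: derivative_eq_intros sin_ge_zero)
  from concave_onD_Icc[OF this, of "2 * \<bar>t\<bar>"] assms
  have "2 * \<bar>t\<bar> \<le> sin (pi * \<bar>t\<bar>)" by (simp add: mult_ac)
  also have "\<dots> \<le> \<bar>sin (pi * \<bar>t\<bar>)\<bar>" by simp
  also have "\<dots> = \<bar>sin (pi * t)\<bar>" by (cases "t \<ge> 0") auto
  finally show ?thesis .
qed

subsection \<open>Poisson summation and Fourier inversion\<close>

text \<open>
  Poisson summation is tested with the kernel \<open>cos\<^bsup>2N\<^esup> (\<pi> t)\<close>, normalised to mean value \<open>1\<close>: it is positive and
  concentrates at the integers, and its Fourier coefficients tend to \<open>1\<close> with the explicit error \<open>n\<^sup>2 / N\<close>.
\<close>

definition cweight :: "nat \<Rightarrow> nat \<Rightarrow> real" where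
  "cweight N n = real (2 * N choose (N + n)) / real (2 * N choose N)"

lemma cweight_0: "cweight N 0 = 1" by (simp add: cweight_def)

lemma cweight_nonneg: "cweight N n \<ge> 0" by (simp add: cweight_def)

text \<open>The truncated subtraction is harmless: for n \<ge> N both sides are 0, because the
  binomial coefficient vanishes beyond N.\<close>

lemma cweight_Suc: "cweight N (Suc n) * (real N + real n + 1) = cweight N n * real (N - n)"
proof -
  have "Suc (N + n) * (2 * N choose Suc (N + n)) = 2 * N * ((2 * N - 1) choose (N + n))"
    by (rule binomial_absorption)
  also have "\<dots> = (2 * N - (N + n)) * (2 * N choose (N + n))"
    by (rule binomial_absorb_comp[symmetric])
  also have "2 * N - (N + n) = N - n" by simp
  finally have "real (Suc (N + n)) * real (2 * N choose Suc (N + n)) = real (N - n) * real (2 * N choose (N + n))"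
    by (simp only: of_nat_mult[symmetric])
  then show ?thesis unfolding cweight_def by (simp add: field_simps)
qed

lemma cweight_le_1: "cweight N n \<le> 1"
proof (induction n)
  case (Suc n)
  have "cweight N (Suc n) * (real N + real n + 1) \<le> cweight N n * (real N + real n + 1)"
    unfolding cweight_Suc using cweight_nonneg[of N n] by (intro mult_left_mono) auto
  then have "cweight N (Suc n) \<le> cweight N n"
    by (rule mult_right_le_imp_le) (auto simp: add_pos_nonneg add_nonneg_pos)
  with Suc show ?case by linarith
qed (simp add: cweight_0)

text \<open>Passing from n to n + 1 multiplies the weight by 1 - (2n + 1)/(N + n + 1), and the
  weight is at most 1, so at most (2n + 1)/N is lost. The odd numbers add up to n^2. For n > N the
  bound is not positive.\<close>

lemma cweight_ge: "N > 0 \<Longrightarrow> cweight N n \<ge> 1 - real n ^ 2 / real N"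
proof (induction n)
  case (Suc n)
  show ?case
  proof (cases "n \<le> N")
    case True
    have "cweight N (Suc n) = cweight N n * (real N - real n) / (real N + real n + 1)"
      using cweight_Suc[of N n] True by (simp add: field_simps of_nat_diff)
    also have "\<dots> = cweight N n - cweight N n * ((2 * real n + 1) / (real N + real n + 1))"
      by (simp add: field_simps)
    finally have *: "cweight N (Suc n) = cweight N n - cweight N n * ((2 * real n + 1) / (real N + real n + 1))" .
    have "cweight N n * ((2 * real n + 1) / (real N + real n + 1)) \<le> 1 * ((2 * real n + 1) / real N)"
      using Suc.prems by (intro mult_mono cweight_le_1 divide_left_mono) auto
    then have "cweight N (Suc n) \<ge> 1 - real n ^ 2 / real N - (2 * real n + 1) / real N"
      using * Suc by linarith
    also have "1 - real n ^ 2 / real N - (2 * real n + 1) / real N = 1 - real (Suc n) ^ 2 / real N"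
    proof -
      have "real (Suc n) ^ 2 = real n ^ 2 + (2 * real n + 1)" by (simp add: power2_eq_square algebra_simps)
      then show ?thesis by (simp only: add_divide_distrib diff_diff_eq)
    qed
    finally show ?thesis .
  next
    case False
    have "real N \<le> real (Suc n) * 1" using False by simp
    also have "\<dots> \<le> real (Suc n) ^ 2" unfolding power2_eq_square by (intro mult_left_mono) auto
    finally have "1 - real (Suc n) ^ 2 / real N \<le> 0" using Suc.prems by (simp add: field_simps)
    with cweight_nonneg[of N "Suc n"] show ?thesis by linarith
  qed
qed (simp add: cweight_0)

definition cker :: "nat \<Rightarrow> real \<Rightarrow> real" where
  "cker N t = 4 ^ N / real (2 * N choose N) * cos (pi * t) ^ (2 * N)"

lemma cker_nonneg: "cker N t \<ge> 0" by (simp add: cker_def)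

lemma continuous_cker [continuous_intros]: "continuous_on S (cker N)"
  unfolding cker_def by (intro continuous_intros)

lemma cker_periodic: "cker N (t + of_int k) = cker N t"
proof -
  have "cos (pi * (t + of_int k)) = cos (pi * t) * cos (pi * of_int k) - sin (pi * t) * sin (pi * of_int k)"
    by (simp add: distrib_left cos_add)
  also have "sin (pi * of_int k) = 0" by (simp add: sin_int_times_real mult.commute)
  finally have "cos (pi * (t + of_int k)) ^ 2 = cos (pi * t) ^ 2 * cos (pi * of_int k) ^ 2"
    by (simp add: power_mult_distrib)
  also have "cos (pi * of_int k) ^ 2 = 1"
    using sin_cos_squared_add[of "pi * of_int k"] \<open>sin (pi * of_int k) = 0\<close> by simp
  finally show ?thesis by (simp add: cker_def power_mult)
qed

text \<open>Binomial expansion of the 2N-th power of exp(-\<i> pi t) + exp(\<i> pi t): the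
  \<open>j\<close>-th term has frequency N - j up to sign, and the symmetry of binomial coefficients
  makes its weight depend on \<bar>j - N\<bar> alone.\<close>

lemma cker_expansion:
  "complex_of_real (cker N t) = (\<Sum>k=- int N..int N. cweight N (nat \<bar>k\<bar>) * exp (- 2 * pi * \<i> * of_int k * t))"
proof -
  have "(\<Sum>k=- int N..int N. cweight N (nat \<bar>k\<bar>) * exp (- 2 * pi * \<i> * of_int k * t))
     = (\<Sum>j\<le>2*N. of_nat (2 * N choose j) / of_nat (2 * N choose N) * exp (- 2 * pi * \<i> * (of_nat j - of_nat N) * t))"
  proof (rule sum.reindex_bij_witness[of _ "\<lambda>j. int j - int N" "\<lambda>k. nat (k + int N)"])
    fix k assume k: "k \<in> {- int N..int N}"
    have *: "(2 * N choose (N + nat \<bar>k\<bar>)) = (2 * N choose nat (k + int N))"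
    proof (cases "k \<ge> 0")
      case True then show ?thesis by (simp add: nat_add_distrib add.commute)
    next
      case False
      have "N + nat \<bar>k\<bar> = 2 * N - nat (k + int N)" using False k by auto
      moreover have "nat (k + int N) \<le> 2 * N" using k by auto
      ultimately show ?thesis using binomial_symmetric[of "nat (k + int N)" "2 * N"] by (simp only:)
    qed
    have "complex_of_nat (nat (k + int N)) - of_nat N = of_int k"
      using k by (simp add: of_nat_nat)
    then show "of_nat (2 * N choose nat (k + int N)) / of_nat (2 * N choose N)
         * exp (- 2 * pi * \<i> * (of_nat (nat (k + int N)) - of_nat N) * t)
       = complex_of_real (cweight N (nat \<bar>k\<bar>)) * exp (- 2 * pi * \<i> * of_int k * t)"
      by (simp only: cweight_def * of_real_divide of_real_of_nat_eq)
  qed auto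
  also have "\<dots> = (\<Sum>j\<le>2*N. of_nat (2 * N choose j) * exp (- (\<i> * pi * t)) ^ j * exp (\<i> * pi * t) ^ (2 * N - j)) / of_nat (2 * N choose N)"
    unfolding sum_divide_distrib
  proof (rule sum.cong[OF refl])
    fix j assume "j \<in> {..2 * N}"
    then have "- 2 * pi * \<i> * (of_nat j - of_nat N) * t = of_nat j * (- (\<i> * pi * t)) + of_nat (2 * N - j) * (\<i> * pi * t)"
      by (simp add: of_nat_diff algebra_simps)
    then have "exp (- 2 * pi * \<i> * (of_nat j - of_nat N) * t) = exp (- (\<i> * pi * t)) ^ j * exp (\<i> * pi * t) ^ (2 * N - j)"
      by (simp only: exp_add exp_of_nat_mult)
    then show "of_nat (2 * N choose j) / of_nat (2 * N choose N) * exp (- 2 * pi * \<i> * (of_nat j - of_nat N) * t)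
      = of_nat (2 * N choose j) * exp (- (\<i> * pi * t)) ^ j * exp (\<i> * pi * t) ^ (2 * N - j) / of_nat (2 * N choose N)"
      by (simp only:) simp
  qed
  also have "\<dots> = (exp (- (\<i> * pi * t)) + exp (\<i> * pi * t)) ^ (2 * N) / of_nat (2 * N choose N)"
    by (simp add: binomial_ring)
  also have "exp (- (\<i> * pi * t)) + exp (\<i> * pi * t) = 2 * cos (complex_of_real (pi * t))"
    by (simp add: cos_exp_eq algebra_simps)
  also have "\<dots> = 2 * complex_of_real (cos (pi * t))" by (simp only: cos_of_real)
  finally show ?thesis by (simp add: cker_def power_mult_distrib power_mult)
qed

lemma cker_has_integral: "(cker N has_integral 1) {-1/2..1/2}"
proof -
  have E: "((\<lambda>t. cweight N (nat \<bar>k\<bar>) * exp (- 2 * pi * \<i> * of_int k * t)) has_integral (if k = 0 then 1 else 0)) {-1/2..1/2::real}" for k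
  proof -
    have "(\<lambda>t::real. exp (2 * pi * \<i> * of_int (- k) * t)) integrable_on {-1/2..1/2}"
      by (intro integrable_continuous_real continuous_intros)
    then have "((\<lambda>t::real. exp (2 * pi * \<i> * of_int (- k) * t)) has_integral (if k = 0 then 1 else 0)) {-1/2..1/2}"
      using integral_exp_int[of "- k"] by (simp add: has_integral_integral)
    from has_integral_mult_right[OF this, of "complex_of_real (cweight N (nat \<bar>k\<bar>))"] show ?thesis
      by (cases "k = 0") (auto simp: cweight_0)
  qed
  have "((\<lambda>t. \<Sum>k=- int N..int N. cweight N (nat \<bar>k\<bar>) * exp (- 2 * pi * \<i> * of_int k * t)) has_integral
     (\<Sum>k=- int N..int N. (if k = 0 then 1 else 0))) {-1/2..1/2::real}"
    by (intro has_integral_sum E) auto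
  also have "(\<Sum>k=- int N..int N. (if k = 0 then 1 else 0)) = (1::complex)" by simp
  finally have "((\<lambda>t. complex_of_real (cker N t)) has_integral 1) {-1/2..1/2}"
    by (simp only: cker_expansion)
  from has_integral_linear[OF this bounded_linear_Re] show ?thesis by (simp add: o_def)
qed

text \<open>Compares the normalising constants of the kernels of orders N and N + 1.\<close>

lemma central_binomial_Suc: "(N + 1) * (2 * (N + 1) choose (N + 1)) = 2 * (2 * N + 1) * (2 * N choose N)"
proof -
  have 1: "Suc N * (Suc (2 * N + 1) choose Suc N) = Suc (2 * N + 1) * (2 * N + 1 choose N)"
    by (rule Suc_times_binomial)
  have 2: "(2 * N + 1 choose N) = (2 * N + 1 choose Suc N)"
    using binomial_symmetric[of N "2 * N + 1"] by simp
  have 3: "Suc N * (Suc (2 * N) choose Suc N) = Suc (2 * N) * (2 * N choose N)"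
    by (rule Suc_times_binomial)
  have "(N + 1) * (2 * (N + 1) choose (N + 1)) = Suc (2 * N + 1) * (2 * N + 1 choose N)"
    using 1 by (simp only: Suc_eq_plus1 mult_2 add_ac)
  also have "\<dots> = 2 * (Suc N * (2 * N + 1 choose N))" by (simp only: Suc_eq_plus1 mult_2 distrib_right add_ac)
  also have "\<dots> = 2 * (Suc (2 * N) * (2 * N choose N))" using 2 3 by (simp only: Suc_eq_plus1)
  finally show ?thesis by (simp only: Suc_eq_plus1 mult.assoc)
qed

text \<open>Quantitative concentration at the integers. The periodic substitute sin^2 for t^2 has an
  exact moment, since cos^2 times the kernel is a multiple of the next kernel and all kernels have
  mean 1.\<close>

lemma cker_sin_has_integral: "((\<lambda>t. sin (pi * t) ^ 2 * cker N t) has_integral 1 / (2 * real N + 2)) {-1/2..1/2}"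
proof -
  define A where "A = real (2 * N choose N)"
  define B where "B = real (2 * (N + 1) choose (N + 1))"
  have "real ((N + 1) * (2 * (N + 1) choose (N + 1))) = real (2 * (2 * N + 1) * (2 * N choose N))"
    by (simp only: central_binomial_Suc)
  then have r: "(real N + 1) * B = 2 * (2 * real N + 1) * A" unfolding A_def B_def
    by (simp only: of_nat_mult of_nat_add of_nat_1 of_nat_numeral)
  have pos: "A > 0" "B > 0" unfolding A_def B_def of_nat_0_less_iff by (intro zero_less_binomial; simp)+
  have "cos (pi * t) ^ 2 * cker N t = (2 * real N + 1) / (2 * real N + 2) * cker (N + 1) t" for t
  proof -
    have q: "1 / A = (2 * real N + 1) / (2 * real N + 2) * (4 / B)"
    proof -
      have e: "(2 * real N + 2) * B = (4 * (2 * real N + 1)) * A" using r by (simp add: algebra_simps)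
      have "(2 * real N + 1) / (2 * real N + 2) * (4 / B) = (4 * (2 * real N + 1)) / ((2 * real N + 2) * B)" by simp
      also have "\<dots> = 1 / A" unfolding e by simp
      finally show ?thesis by simp
    qed
    have "cos (pi * t) ^ 2 * cker N t = (1 / A) * (4 ^ N * cos (pi * t) ^ (2 * N + 2))"
      by (simp add: cker_def A_def power_add power2_eq_square)
    also have "\<dots> = (2 * real N + 1) / (2 * real N + 2) * (4 ^ (N + 1) / B * cos (pi * t) ^ (2 * (N + 1)))"
      unfolding q by (simp add: mult_ac)
    finally show ?thesis by (simp only: cker_def B_def)
  qed
  then have "sin (pi * t) ^ 2 * cker N t = cker N t - (2 * real N + 1) / (2 * real N + 2) * cker (N + 1) t" for t
    by (simp add: sin_squared_eq left_diff_distrib)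
  then have "((\<lambda>t. sin (pi * t) ^ 2 * cker N t) has_integral 1 - (2 * real N + 1) / (2 * real N + 2) * 1) {-1/2..1/2}"
    by (simp only:) (intro has_integral_diff has_integral_mult_right cker_has_integral)
  then show ?thesis by (simp add: field_simps)
qed

lemma vector_derivative_lipschitz:
  fixes f :: "real \<Rightarrow> complex"
  assumes "\<And>x. x \<in> {a..b} \<Longrightarrow> (f has_vector_derivative f' x) (at x)" "\<And>x. x \<in> {a..b} \<Longrightarrow> norm (f' x) \<le> B"
    "x \<in> {a..b}" "y \<in> {a..b}"
  shows "norm (f x - f y) \<le> B * \<bar>x - y\<bar>"
proof -
  have "norm (f x - f y) \<le> B * norm (x - y)"
  proof (rule differentiable_bound[where S = "{a..b}" and f' = "\<lambda>x h. h *\<^sub>R f' x"])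
    show "(f has_derivative (\<lambda>h. h *\<^sub>R f' x)) (at x within {a..b})" if "x \<in> {a..b}" for x
      using assms(1)[OF that] has_derivative_at_withinI unfolding has_vector_derivative_def by blast
    show "onorm (\<lambda>h. h *\<^sub>R f' x) \<le> B" if "x \<in> {a..b}" for x
    proof (rule onorm_le)
      show "norm (h *\<^sub>R f' x) \<le> B * norm h" for h
        using mult_right_mono[OF assms(2)[OF that], of "\<bar>h\<bar>"] by (simp add: mult.commute)
    qed
  qed (use assms in auto)
  then show ?thesis by simp
qed

lemma has_integral_norm_le:
  fixes f :: "real \<Rightarrow> complex"
  assumes "(f has_integral i) S" "(g has_integral j) S" "\<And>x. x \<in> S \<Longrightarrow> norm (f x) \<le> g x"
  shows "norm i \<le> j"
  using has_integral_norm_bound_integral_component[OF assms(1,2), of 1] assms(3) by simp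

lemma has_sum_diff:
  fixes f g :: "'a \<Rightarrow> complex"
  assumes "(f has_sum a) A" "(g has_sum b) A" shows "((\<lambda>x. f x - g x) has_sum (a - b)) A"
  using has_sum_add[OF assms(1), of "\<lambda>x. - g x" "- b"] assms(2) by (simp add: has_sum_uminus)

text \<open>Against a trigonometric polynomial the integral is a finite weighted sum of values of
  the transform. The weights differ from 1 by at most n^2/N; of the four powers of decay two absorb
  n^2 and two remain for summability.\<close>

lemma poisson_summation_left:
  assumes g: "schwartz g"
  shows "\<exists>A. \<forall>N>0. norm ((LINT t|lborel. g t * cker N t) - (\<Sum>\<^sub>\<infinity>n::int. fourier g (of_int n))) \<le> A / real N"
proof -
  obtain C where C: "C \<ge> 0" "\<And>x. norm (fourier g x) \<le> C / (1 + \<bar>x\<bar>) ^ 4"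
    using rapid_decay_bound[OF fourier_rapid[OF g]] by blast
  have n2: "norm (fourier g (of_int n)) * of_int n ^ 2 \<le> C / (1 + \<bar>real_of_int n\<bar>) ^ 2" for n :: int
  proof -
    have "norm (fourier g (of_int n)) * of_int n ^ 2 \<le> C / (1 + \<bar>real_of_int n\<bar>) ^ 4 * (1 + \<bar>real_of_int n\<bar>) ^ 2"
      using C by (intro mult_mono) (auto simp: abs_le_square_iff[symmetric])
    also have "\<dots> = C / (1 + \<bar>real_of_int n\<bar>) ^ 2"
      by (simp add: power_numeral_reduce divide_simps)
    finally show ?thesis .
  qed
  define A where "A = (\<Sum>\<^sub>\<infinity>n::int. C / (1 + \<bar>real_of_int n\<bar>) ^ 2)"
  have A: "((\<lambda>n::int. C / (1 + \<bar>real_of_int n\<bar>) ^ 2) has_sum A) UNIV"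
    unfolding A_def by (intro has_sum_infsum summable_on_int_inverse_square)
  have "norm ((LINT t|lborel. g t * cker N t) - (\<Sum>\<^sub>\<infinity>n::int. fourier g (of_int n))) \<le> A / real N" if N: "N > 0" for N
  proof -
    have fs: "((\<lambda>n::int. fourier g (of_int n)) has_sum (\<Sum>\<^sub>\<infinity>n::int. fourier g (of_int n))) UNIV"
      by (intro has_sum_infsum rapid_decay_summable_int fourier_rapid g)
    have int: "integrable lborel (\<lambda>t. exp (- 2 * pi * \<i> * of_int n * t) * g t)" for n :: int
      using fourier_integrable[OF schwartz_integrable[OF g], of "of_int n"] by simp
    have "(LINT t|lborel. g t * cker N t) = (LINT t|lborel. (\<Sum>n=- int N..int N. cweight N (nat \<bar>n\<bar>) * (exp (- 2 * pi * \<i> * of_int n * t) * g t)))"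
      unfolding cker_expansion by (simp add: sum_distrib_left sum_distrib_right mult_ac)
    also have "\<dots> = (\<Sum>n=- int N..int N. cweight N (nat \<bar>n\<bar>) * fourier g (of_int n))"
      using int by (subst Bochner_Integration.integral_sum) (auto simp: fourier_def)
    finally have L: "(LINT t|lborel. g t * cker N t) = (\<Sum>n=- int N..int N. cweight N (nat \<bar>n\<bar>) * fourier g (of_int n))" .
    have "((\<lambda>n. cweight N (nat \<bar>n\<bar>) * fourier g (of_int n)) has_sum (LINT t|lborel. g t * cker N t)) {- int N..int N}"
      unfolding L by (rule has_sum_finite) simp
    \<comment> \<open>Outside -N..N the binomial coefficient is 0, so the finite sum extends to all
      integers without change.\<close>
    then have "((\<lambda>n. cweight N (nat \<bar>n\<bar>) * fourier g (of_int n)) has_sum (LINT t|lborel. g t * cker N t)) UNIV"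
      by (rule has_sum_cong_neutral[THEN iffD1, rotated -1]) (auto simp: cweight_def)
    from has_sum_diff[OF this fs]
    have hs: "((\<lambda>n. cweight N (nat \<bar>n\<bar>) * fourier g (of_int n) - fourier g (of_int n)) has_sum
       ((LINT t|lborel. g t * cker N t) - (\<Sum>\<^sub>\<infinity>n::int. fourier g (of_int n)))) UNIV" .
    show ?thesis
    proof (rule norm_infsum_le[OF hs])
      show "((\<lambda>n. C / (1 + \<bar>real_of_int n\<bar>) ^ 2 / real N) has_sum A / real N) UNIV"
        using has_sum_cmult_left[OF A, of "1 / real N"] by simp
      fix n :: int
      have "real (nat \<bar>n\<bar>) ^ 2 = of_int n ^ 2" by (simp add: of_nat_nat)
      then have w: "\<bar>cweight N (nat \<bar>n\<bar>) - 1\<bar> \<le> of_int n ^ 2 / real N"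
        using cweight_ge[OF N, of "nat \<bar>n\<bar>"] cweight_le_1[of N "nat \<bar>n\<bar>"] by simp
      have "cweight N (nat \<bar>n\<bar>) * fourier g (of_int n) - fourier g (of_int n) = of_real (cweight N (nat \<bar>n\<bar>) - 1) * fourier g (of_int n)"
        by (simp add: algebra_simps)
      then have "norm (cweight N (nat \<bar>n\<bar>) * fourier g (of_int n) - fourier g (of_int n)) = \<bar>cweight N (nat \<bar>n\<bar>) - 1\<bar> * norm (fourier g (of_int n))"
        by (simp only: norm_mult norm_of_real)
      also have "\<dots> \<le> of_int n ^ 2 / real N * norm (fourier g (of_int n))"
        by (intro mult_right_mono w) auto
      also have "\<dots> \<le> C / (1 + \<bar>real_of_int n\<bar>) ^ 2 / real N"
        using divide_right_mono[OF n2[of n], of "real N"] by (simp add: mult.commute)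
      finally show "norm (cweight N (nat \<bar>n\<bar>) * fourier g (of_int n) - fourier g (of_int n)) \<le> C / (1 + \<bar>real_of_int n\<bar>) ^ 2 / real N" .
    qed
  qed
  then show ?thesis by blast
qed

text \<open>On each unit cell the kernel is a probability density, so the error is the mean of g(t +
  k) - g(k), at most a summable Lipschitz constant times the mean of \<bar>t\<bar>. The parameter
  \<delta> is left free to be balanced against \<open>N\<close> later.\<close>

lemma poisson_summation_right:
  assumes g: "schwartz g"
  shows "\<exists>B\<ge>0. \<forall>N. \<forall>\<delta>>0. norm ((LINT t|lborel. g t * cker N t) - (\<Sum>\<^sub>\<infinity>k::int. g (of_int k))) \<le> B * (\<delta> + 1 / (\<delta> * (2 * real N + 2)))"
proof -
  obtain C where C: "C \<ge> 0" "\<And>x. norm (vderiv g x) \<le> C / (1 + \<bar>x\<bar>) ^ 2"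
    using rapid_decay_bound[OF schwartz_rapid[OF schwartz_vderiv[OF g]]] by blast
  obtain D where D: "D \<ge> 0" "\<And>x. norm (g x) \<le> D / (1 + \<bar>x\<bar>) ^ 2"
    using rapid_decay_bound[OF schwartz_rapid[OF g]] by blast
  define L where "L = (\<lambda>k::int. 4 * C / (1 + \<bar>real_of_int k\<bar>) ^ 2)"
  have L0: "L k \<ge> 0" for k using C by (simp add: L_def)
  define B where "B = infsum L UNIV"
  have B: "(L has_sum B) UNIV" unfolding B_def L_def by (intro has_sum_infsum summable_on_int_inverse_square)
  have lip: "norm (g (t + of_int k) - g (of_int k)) \<le> L k * \<bar>t\<bar>" if t: "t \<in> {-1/2..1/2}" for t k
  proof -
    have "norm (g (t + of_int k) - g (of_int k)) \<le> L k * \<bar>(t + of_int k) - of_int k\<bar>"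
    proof (rule vector_derivative_lipschitz)
      show "(g has_vector_derivative vderiv g x) (at x)" for x by (rule schwartz_has_vderiv[OF g])
      show "norm (vderiv g x) \<le> L k" if "x \<in> {of_int k - 1/2..of_int k + 1/2}" for x
      proof -
        have "\<bar>x - of_int k\<bar> \<le> 1/2" using that by (intro abs_leI) auto
        from quadratic_decay_shift[OF this C(1), of "of_int k"] show ?thesis
          using C(2)[of x] by (simp add: L_def)
      qed
    qed (use t in auto)
    then show ?thesis by simp
  qed
  have cg: "continuous_on S (\<lambda>t. g (t + c))" for S c
    by (intro continuous_on_compose2[OF schwartz_continuous[OF g, of UNIV]] continuous_intros) auto
  have "norm ((LINT t|lborel. g t * cker N t) - (\<Sum>\<^sub>\<infinity>k::int. g (of_int k))) \<le> B * (\<delta> + 1 / (\<delta> * (2 * real N + 2)))"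
    if \<delta>: "\<delta> > 0" for N \<delta>
  proof -
    \<comment> \<open>This sup bound depends on \<open>N\<close>; it serves only to cut the integral
      into absolutely summable cells and does not enter the final estimate.\<close>
    define M where "M = 4 ^ N / real (2 * N choose N)"
    have M: "M \<ge> 0" by (simp add: M_def)
    have ker_le: "cker N t \<le> M" for t
    proof -
      have "cos (pi * t) ^ (2 * N) \<le> 1"
        using power_le_one[of "cos (pi * t) ^ 2" N] by (simp add: abs_square_le_1 power_mult)
      from mult_left_mono[OF this M] show ?thesis by (simp add: cker_def M_def)
    qed
    have 1: "((\<lambda>k::int. integral {-1/2..1/2} (\<lambda>t. g (t + of_int k) * cker N (t + of_int k))) has_sum (LINT t|lborel. g t * cker N t)) UNIV"
    proof (rule integral_over_unit_intervals)
      show "continuous_on UNIV (\<lambda>t. g t * complex_of_real (cker N t))"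
        by (intro continuous_intros schwartz_continuous g)
      show "D * M \<ge> 0" using D M by simp
      show "norm (g x * complex_of_real (cker N x)) \<le> D * M / (1 + \<bar>x\<bar>) ^ 2" for x
      proof -
        have "norm (g x) * cker N x \<le> D / (1 + \<bar>x\<bar>) ^ 2 * M"
          using D ker_le[of x] cker_nonneg[of N x] by (intro mult_mono) auto
        then show ?thesis by (simp add: norm_mult abs_of_nonneg[OF cker_nonneg])
      qed
    qed
    have 2: "((\<lambda>k::int. g (of_int k)) has_sum (\<Sum>\<^sub>\<infinity>k::int. g (of_int k))) UNIV"
      by (intro has_sum_infsum rapid_decay_summable_int schwartz_rapid g)
    show ?thesis
    proof (rule norm_infsum_le[OF has_sum_diff[OF 1 2] has_sum_cmult_left[OF B]])
      fix k :: int
      have i1: "((\<lambda>t. g (of_int k) * complex_of_real (cker N t)) has_integral g (of_int k)) {-1/2..1/2}"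
        using has_integral_mult_right[OF has_integral_linear[OF cker_has_integral bounded_linear_of_real], of "g (of_int k)" N]
        by (simp add: o_def)
      have i2: "((\<lambda>t. g (t + of_int k) * complex_of_real (cker N t)) has_integral
          integral {-1/2..1/2} (\<lambda>t. g (t + of_int k) * complex_of_real (cker N t))) {-1/2..1/2}"
        by (intro integrable_integral integrable_continuous_real continuous_intros cg)
      have i3: "((\<lambda>t. L k * (\<delta> * cker N t + (1 / \<delta>) * (sin (pi * t) ^ 2 * cker N t))) has_integral
         L k * (\<delta> * 1 + (1 / \<delta>) * (1 / (2 * real N + 2)))) {-1/2..1/2}"
        by (intro has_integral_mult_right has_integral_add cker_has_integral cker_sin_has_integral)
      have "norm (integral {-1/2..1/2} (\<lambda>t. g (t + of_int k) * complex_of_real (cker N t)) - g (of_int k))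
         \<le> L k * (\<delta> * 1 + (1 / \<delta>) * (1 / (2 * real N + 2)))"
      proof (rule has_integral_norm_le[OF has_integral_diff[OF i2 i1] i3])
        fix t :: real assume t: "t \<in> {-1/2..1/2}"
        \<comment> \<open>The arithmetic-geometric inequality trades \<bar>t\<bar> for a constant
          and a multiple of sin^2, both with known kernel moments.\<close>
        have "\<bar>t\<bar> \<le> \<delta> + sin (pi * t) ^ 2 / \<delta>"
        proof -
          define s where "s = \<bar>sin (pi * t)\<bar>"
          have "0 \<le> (s - \<delta>) ^ 2" by simp
          then have "s * (2 * \<delta>) \<le> s ^ 2 + \<delta> ^ 2" by (simp add: power2_eq_square algebra_simps)
          then have "2 * s \<le> s ^ 2 / \<delta> + \<delta>" using \<delta> by (simp add: field_simps power2_eq_square)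
          moreover have "2 * \<bar>t\<bar> \<le> s" unfolding s_def using t by (intro two_abs_le_abs_sin_pi) auto
          ultimately have "\<bar>t\<bar> \<le> s ^ 2 / \<delta> + \<delta>" by linarith
          then show ?thesis by (simp add: s_def add.commute)
        qed
        then have "L k * \<bar>t\<bar> * cker N t \<le> L k * (\<delta> + sin (pi * t) ^ 2 / \<delta>) * cker N t"
          using L0 cker_nonneg by (intro mult_right_mono mult_left_mono)
        moreover have "norm (g (t + of_int k) * complex_of_real (cker N t) - g (of_int k) * complex_of_real (cker N t))
          \<le> L k * \<bar>t\<bar> * cker N t"
          using mult_right_mono[OF lip[OF t, of k] cker_nonneg[of N t]]
          by (simp add: left_diff_distrib[symmetric] norm_mult abs_of_nonneg[OF cker_nonneg])
        ultimately show "norm (g (t + of_int k) * complex_of_real (cker N t) - g (of_int k) * complex_of_real (cker N t))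
          \<le> L k * (\<delta> * cker N t + (1 / \<delta>) * (sin (pi * t) ^ 2 * cker N t))"
          by (simp add: algebra_simps)
      qed
      then show "norm (integral {-1/2..1/2} (\<lambda>t. g (t + of_int k) * complex_of_real (cker N (t + of_int k))) - g (of_int k))
         \<le> L k * (\<delta> + 1 / (\<delta> * (2 * real N + 2)))"
        by (simp add: cker_periodic)
    qed
  qed
  moreover have "B \<ge> 0" unfolding B_def by (intro infsum_nonneg L0)
  ultimately show ?thesis by blast
qed

theorem poisson_summation:
  assumes g: "schwartz g"
  shows "(\<Sum>\<^sub>\<infinity>n::int. fourier g (of_int n)) = (\<Sum>\<^sub>\<infinity>k::int. g (of_int k))"
proof -
  define S where "S = (\<Sum>\<^sub>\<infinity>n::int. fourier g (of_int n))"
  define R where "R = (\<Sum>\<^sub>\<infinity>k::int. g (of_int k))"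
  define I where "I = (\<lambda>N. LINT t|lborel. g t * cker N t)"
  obtain A where A: "\<And>N. N > 0 \<Longrightarrow> norm (I N - S) \<le> A / real N"
    using poisson_summation_left[OF g] unfolding I_def S_def by blast
  obtain B where B: "B \<ge> 0" "\<And>N \<delta>. \<delta> > 0 \<Longrightarrow> norm (I N - R) \<le> B * (\<delta> + 1 / (\<delta> * (2 * real N + 2)))"
    using poisson_summation_right[OF g] unfolding I_def R_def by blast
  \<comment> \<open>With M = m + 1, the choices N = M^2 and \<delta> = 1/M balance the errors
    \<delta> and 1/(\<delta> N), both of order 1/M.\<close>
  have "norm (S - R) \<le> (\<bar>A\<bar> + 2 * B) * inverse (real (Suc m))" for m
  proof -
    define M where "M = real (Suc m)"
    have M: "M \<ge> 1" by (simp add: M_def)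
    have N: "real ((Suc m) ^ 2) = M ^ 2" by (simp add: M_def)
    have "norm (I ((Suc m) ^ 2) - S) \<le> \<bar>A\<bar> / M"
    proof -
      have "A / M ^ 2 \<le> \<bar>A\<bar> / M ^ 2" using M by (intro divide_right_mono) auto
      also have "\<dots> \<le> \<bar>A\<bar> / M" using M by (intro divide_left_mono) (auto simp: power2_eq_square)
      finally show ?thesis using A[of "(Suc m) ^ 2"] N by simp
    qed
    moreover have "norm (I ((Suc m) ^ 2) - R) \<le> B * (2 / M)"
    proof -
      have "1 / (1 / M * (2 * M ^ 2 + 2)) \<le> 1 / M"
      proof -
        have "M / (2 * M ^ 2 + 2) \<le> 1 / M"
          using M by (subst pos_divide_le_eq) (auto simp: field_simps power2_eq_square add_nonneg_pos)
        then show ?thesis by simp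
      qed
      then have "B * (1 / M + 1 / (1 / M * (2 * M ^ 2 + 2))) \<le> B * (2 / M)"
        using B(1) by (intro mult_left_mono) auto
      then show ?thesis using B(2)[of "1 / M" "(Suc m) ^ 2"] M N by simp
    qed
    ultimately have "norm (S - R) \<le> \<bar>A\<bar> / M + B * (2 / M)"
      by (smt (verit, best) norm_minus_commute norm_diff_triangle_le)
    then have "norm (S - R) \<le> (\<bar>A\<bar> + 2 * B) * inverse M" by (simp add: divide_inverse algebra_simps)
    then show ?thesis by (simp only: M_def)
  qed
  moreover have "(\<lambda>m. (\<bar>A\<bar> + 2 * B) * inverse (real (Suc m))) \<longlonglongrightarrow> (\<bar>A\<bar> + 2 * B) * 0"
    by (intro tendsto_intros LIMSEQ_inverse_real_of_nat)
  ultimately have "norm (S - R) \<le> (\<bar>A\<bar> + 2 * B) * 0"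
    by (intro LIMSEQ_le_const) auto
  then show ?thesis by (simp add: S_def R_def)
qed

text \<open>Poisson summation is applied to \<open>h\<close> modulated by a parameter x and
  integrated over x in a unit cell: the shifted transforms assemble into the integral over the line,
  while orthogonality of the exponentials leaves only the term k = 0.\<close>

theorem fourier_inversion_at_0:
  assumes h: "schwartz h" shows "(LINT u|lborel. fourier h u) = h 0"
proof -
  obtain C where C: "C \<ge> 0" "\<And>x. norm (fourier h x) \<le> C / (1 + \<bar>x\<bar>) ^ 2"
    using rapid_decay_bound[OF fourier_rapid[OF h]] by blast
  have cf: "continuous_on S (fourier h)" for S by (intro continuous_fourier schwartz_integrable h)
  have cfc: "continuous_on S (\<lambda>x. fourier h (x + c))" for S c
    by (intro continuous_on_compose2[OF cf[of UNIV]] continuous_intros) auto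
  have P: "(\<Sum>\<^sub>\<infinity>n::int. fourier h (x + of_int n)) = (\<Sum>\<^sub>\<infinity>k::int. h (of_int k) * exp (2 * pi * \<i> * of_int (- k) * x))" for x :: real
  proof -
    define g where "g = (\<lambda>t::real. exp (2 * pi * \<i> * (- x) * t) * h t)"
    have "multiplier (\<lambda>t. 1 * exp (\<i> * complex_of_real (2 * pi * (- x)) * of_real t))" by (rule multiplier_exp) auto
    from schwartz_times_multiplier[OF h this] have "schwartz g" unfolding g_def by (simp add: mult_ac)
    from poisson_summation[OF this] have "(\<Sum>\<^sub>\<infinity>n::int. fourier g (of_int n)) = (\<Sum>\<^sub>\<infinity>k::int. g (of_int k))" .
    moreover have "fourier g (of_int n) = fourier h (x + of_int n)" for n :: int
      unfolding g_def using fourier_modulate[of "- x" h "of_int n"] by (simp add: add.commute)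
    moreover have "g (of_int k) = h (of_int k) * exp (2 * pi * \<i> * of_int (- k) * x)" for k :: int
      by (simp add: g_def mult_ac)
    ultimately show ?thesis by simp
  qed
  have 1: "((\<lambda>n::int. integral {-1/2..1/2} (\<lambda>x. fourier h (x + of_int n))) has_sum (LINT u|lborel. fourier h u)) UNIV"
    by (rule integral_over_unit_intervals[OF cf C])
  have 2: "((\<lambda>n::int. integral {-1/2..1/2} (\<lambda>x. fourier h (x + of_int n))) has_sum
     integral {-1/2..1/2} (\<lambda>x. \<Sum>\<^sub>\<infinity>n::int. fourier h (x + of_int n))) UNIV"
  proof (rule has_sum_integral[where M = "\<lambda>n::int. 4 * C / (1 + \<bar>real_of_int n\<bar>) ^ 2"])
    fix n :: int and x :: real assume x: "x \<in> {-1/2..1/2}"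
    show "norm (fourier h (x + of_int n)) \<le> 4 * C / (1 + \<bar>real_of_int n\<bar>) ^ 2"
      by (rule order_trans[OF C(2) quadratic_decay_shift]) (use x C(1) in auto)
  qed (auto intro: cfc summable_on_int_inverse_square)
  have 3: "((\<lambda>k::int. integral {-1/2..1/2} (\<lambda>x::real. h (of_int k) * exp (2 * pi * \<i> * of_int (- k) * x))) has_sum
     integral {-1/2..1/2} (\<lambda>x::real. \<Sum>\<^sub>\<infinity>k::int. h (of_int k) * exp (2 * pi * \<i> * of_int (- k) * x))) UNIV"
    by (rule has_sum_integral[where M = "\<lambda>k::int. norm (h (of_int k))"])
       (auto intro!: continuous_intros rapid_decay_summable_int schwartz_rapid h simp: norm_mult)
  have "integral {-1/2..1/2} (\<lambda>x::real. h (of_int k) * exp (2 * pi * \<i> * of_int (- k) * x)) = (if k = 0 then h 0 else 0)" for k :: int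
    unfolding integral_mult_right integral_exp_int by simp
  with 3 have "((\<lambda>k::int. if k = 0 then h 0 else 0) has_sum
     integral {-1/2..1/2} (\<lambda>x::real. \<Sum>\<^sub>\<infinity>k::int. h (of_int k) * exp (2 * pi * \<i> * of_int (- k) * x))) UNIV" by simp
  moreover have "((\<lambda>k::int. if k = 0 then h 0 else 0) has_sum h 0) {0::int}"
    using has_sum_finite[of "{0::int}" "\<lambda>k. if k = 0 then h 0 else 0"] by simp
  then have "((\<lambda>k::int. if k = 0 then h 0 else 0) has_sum h 0) UNIV"
    by (rule has_sum_cong_neutral[THEN iffD1, rotated -1]) auto
  ultimately have "integral {-1/2..1/2} (\<lambda>x::real. \<Sum>\<^sub>\<infinity>k::int. h (of_int k) * exp (2 * pi * \<i> * of_int (- k) * x)) = h 0"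
    using has_sum_unique by blast
  then show ?thesis using has_sum_unique[OF 1 2] by (simp only: P)
qed

subsection \<open>Sums over the lattice cone\<close>

lemma summable_on_UNIV_product:
  fixes f :: "'a \<Rightarrow> real" and g :: "'b \<Rightarrow> real"
  assumes "f summable_on UNIV" "g summable_on UNIV" "\<And>x. f x \<ge> 0" "\<And>y. g y \<ge> 0"
  shows "(\<lambda>p. f (fst p) * g (snd p)) summable_on UNIV"
proof -
  have "(\<lambda>p. f (fst p) * g (snd p)) summable_on (UNIV \<times> UNIV)"
  proof (rule summable_on_SigmaI)
    show "((\<lambda>y. f (fst (x, y)) * g (snd (x, y))) has_sum (f x * infsum g UNIV)) UNIV" for x
      using has_sum_cmult_right[OF has_sum_infsum[OF assms(2)], of "f x"] by simp
    show "(\<lambda>x. f x * infsum g UNIV) summable_on UNIV" by (intro summable_on_cmult_left assms)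
  qed (use assms in auto)
  then show ?thesis by simp
qed

text \<open>The nested pairs match the way sums are peeled: each step splits off the last component
  of a pair.\<close>

definition lat :: "real \<Rightarrow> real \<Rightarrow> real \<Rightarrow> (nat \<times> nat) \<times> nat \<Rightarrow> real" where
  "lat w1 w2 w3 p = real (fst (fst p)) * w1 + real (snd (fst p)) * w2 + real (snd p) * w3"

lemma lat_nonneg: "w1 > 0 \<Longrightarrow> w2 > 0 \<Longrightarrow> w3 > 0 \<Longrightarrow> lat w1 w2 w3 p \<ge> 0"
  by (simp add: lat_def)

text \<open>Each index i satisfies m (1 + i) \<le> 1 + lat, so the sixth power in the denominator
  dominates a product of three squares, one for each index.\<close>

lemma summable_on_lat:
  assumes w: "w1 > 0" "w2 > 0" "w3 > 0"
  shows "(\<lambda>p. C / (1 + lat w1 w2 w3 p) ^ 6) summable_on UNIV"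
proof -
  define m where "m = min 1 (min w1 (min w2 w3))"
  have m: "m > 0" "m \<le> 1" "m \<le> w1" "m \<le> w2" "m \<le> w3" using w by (auto simp: m_def)
  let ?q = "\<lambda>n::nat. 1 / (1 + real n) ^ 2"
  have "(\<lambda>p. (\<lambda>r. ?q (fst r) * ?q (snd r)) (fst p) * ?q (snd p)) summable_on (UNIV :: ((nat \<times> nat) \<times> nat) set)"
    by (intro summable_on_UNIV_product summable_on_nat_inverse_square) auto
  then have s: "(\<lambda>p. (1 / m ^ 6) * (?q (fst (fst p)) * ?q (snd (fst p)) * ?q (snd p))) summable_on (UNIV :: ((nat \<times> nat) \<times> nat) set)"
    by (intro summable_on_cmult_right)
  have "(\<lambda>p. 1 / (1 + lat w1 w2 w3 p) ^ 6) summable_on UNIV"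
  proof (rule summable_on_comparison_test[OF s])
    fix p :: "(nat \<times> nat) \<times> nat"
    obtain i j k where p: "p = ((i, j), k)" by (metis surj_pair)
    define S where "S = 1 + lat w1 w2 w3 p"
    have w0: "0 \<le> real i * w1" "0 \<le> real j * w2" "0 \<le> real k * w3" using w by auto
    have S: "m * (1 + real i) \<le> S" "m * (1 + real j) \<le> S" "m * (1 + real k) \<le> S"
    proof -
      have e1: "m * (1 + real n) = m + real n * m" for n by (simp add: algebra_simps)
      have e2: "S = 1 + (real i * w1 + real j * w2 + real k * w3)" by (simp add: S_def lat_def p)
      show "m * (1 + real i) \<le> S" "m * (1 + real j) \<le> S" "m * (1 + real k) \<le> S"
        unfolding e1 e2 using m w0 mult_left_mono[OF m(3) of_nat_0_le_iff, of i] mult_left_mono[OF m(4) of_nat_0_le_iff, of j]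
          mult_left_mono[OF m(5) of_nat_0_le_iff, of k]
        by - linarith+
    qed
    have sq: "(m * (1 + real n)) ^ 2 \<le> S ^ 2" if "m * (1 + real n) \<le> S" for n
      using that m by (intro power_mono) auto
    have "(m * (1 + real i)) ^ 2 * (m * (1 + real j)) ^ 2 * (m * (1 + real k)) ^ 2 \<le> S ^ 2 * S ^ 2 * S ^ 2"
      by (intro mult_mono sq S) auto
    then have le: "m ^ 6 * ((1 + real i) ^ 2 * (1 + real j) ^ 2 * (1 + real k) ^ 2) \<le> S ^ 6"
      by (simp add: power_mult_distrib mult_ac flip: power_add)
    have "1 / S ^ 6 \<le> 1 / (m ^ 6 * ((1 + real i) ^ 2 * (1 + real j) ^ 2 * (1 + real k) ^ 2))"
      using le m lat_nonneg[OF w, of p] by (intro divide_left_mono mult_pos_pos zero_less_power) (auto simp: S_def)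
    then show "1 / (1 + lat w1 w2 w3 p) ^ 6 \<le> (1 / m ^ 6) * (?q (fst (fst p)) * ?q (snd (fst p)) * ?q (snd p))"
      by (simp add: S_def p)
    show "0 \<le> 1 / (1 + lat w1 w2 w3 p) ^ 6" using lat_nonneg[OF w, of p] by auto
  qed
  then have "(\<lambda>p. C * (1 / (1 + lat w1 w2 w3 p) ^ 6)) summable_on UNIV" by (rule summable_on_cmult_right)
  then show ?thesis by simp
qed

lemma rapid_decay_summable_lat:
  assumes w: "w1 > 0" "w2 > 0" "w3 > 0" and a: "a \<ge> 0" and F: "rapid_decay F"
  shows "(\<lambda>p. F (lat w1 w2 w3 p + a)) summable_on UNIV" "(\<lambda>p. F (- (lat w1 w2 w3 p + a))) summable_on UNIV"
proof -
  obtain C where C: "C \<ge> 0" "\<And>x. norm (F x) \<le> C / (1 + \<bar>x\<bar>) ^ 6" using rapid_decay_bound[OF F] by blast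
  have "norm (F x) \<le> C / (1 + lat w1 w2 w3 p) ^ 6" if "\<bar>x\<bar> = lat w1 w2 w3 p + a" for x p
    using C(2)[of x] divide_left_mono[of "(1 + lat w1 w2 w3 p) ^ 6" "(1 + \<bar>x\<bar>) ^ 6" C] C(1) a lat_nonneg[OF w, of p]
    by (smt (verit, best) mult_pos_pos power_mono that zero_less_power)
  moreover have "\<bar>lat w1 w2 w3 p + a\<bar> = lat w1 w2 w3 p + a" for p using lat_nonneg[OF w] a by simp
  ultimately show "(\<lambda>p. F (lat w1 w2 w3 p + a)) summable_on UNIV" "(\<lambda>p. F (- (lat w1 w2 w3 p + a))) summable_on UNIV"
    by (intro summable_on_bounded_by(2)[OF summable_on_lat[OF w, of C]]; simp only: abs_minus_cancel)+
qed

text \<open>The sequential telescoping series identifies the value; unconditional summability is an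
  input, and the decay of \<open>H\<close> alone would not give it.\<close>

lemma telescoping_has_sum:
  fixes H :: "real \<Rightarrow> complex"
  assumes w: "w > 0" and H: "(H \<longlongrightarrow> 0) at_top"
    and s: "(\<lambda>n::nat. H (y + real n * w) - H (y + real n * w + w)) summable_on UNIV"
  shows "((\<lambda>n::nat. H (y + real n * w) - H (y + real n * w + w)) has_sum H y) UNIV"
proof -
  have "filterlim (\<lambda>n::nat. y + real n * w) at_top sequentially"
    by (intro filterlim_tendsto_add_at_top[OF tendsto_const]
        filterlim_at_top_mult_tendsto_pos[OF tendsto_const w] filterlim_real_sequentially)
  then have "(\<lambda>n::nat. H (y + real n * w)) \<longlonglongrightarrow> 0" by (rule filterlim_compose[OF H])
  from telescope_sums'[OF this]
  have "(\<lambda>n::nat. H (y + real n * w) - H (y + real n * w + w)) sums H y" by (simp add: algebra_simps)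
  moreover have "(\<lambda>n::nat. H (y + real n * w) - H (y + real n * w + w)) sums
      (\<Sum>\<^sub>\<infinity>n. H (y + real n * w) - H (y + real n * w + w))"
    by (intro has_sum_imp_sums has_sum_infsum s)
  ultimately show ?thesis using has_sum_infsum[OF s] sums_unique2 by fastforce
qed

text \<open>Unconditional summability over the product permits summing the last index first. That
  the remaining family is again summable is what lets the next direction be peeled in turn.\<close>

lemma telescoping_peel:
  fixes H :: "real \<Rightarrow> complex" and y :: "'a \<Rightarrow> real"
  assumes w: "w > 0" and H: "(H \<longlongrightarrow> 0) at_top"
    and s: "(\<lambda>q::'a \<times> nat. H (y (fst q) + real (snd q) * w) - H (y (fst q) + real (snd q) * w + w)) summable_on UNIV"
  shows "(\<lambda>p. H (y p)) summable_on UNIV"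
    "(\<Sum>\<^sub>\<infinity>q::'a \<times> nat. H (y (fst q) + real (snd q) * w) - H (y (fst q) + real (snd q) * w + w)) = (\<Sum>\<^sub>\<infinity>p. H (y p))"
proof -
  let ?f = "\<lambda>p n. H (y p + real n * w) - H (y p + real n * w + w)"
  have s': "(\<lambda>(p, n). ?f p n) summable_on (UNIV \<times> UNIV)" using s by (simp add: case_prod_unfold)
  have "?f p summable_on UNIV" for p
  proof -
    have "(\<lambda>(p, n). ?f p n) summable_on (Pair p ` UNIV)"
      by (rule summable_on_subset_banach[OF s']) auto
    then show ?thesis by (subst (asm) summable_on_reindex) (auto simp: inj_on_def o_def)
  qed
  then have inner: "infsum (?f p) UNIV = H (y p)" for p
    using telescoping_has_sum[OF w H] infsumI by blast
  show "(\<lambda>p. H (y p)) summable_on UNIV"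
    using summable_on_Sigma_banach[OF s'] by (simp add: inner)
  show "(\<Sum>\<^sub>\<infinity>q::'a \<times> nat. H (y (fst q) + real (snd q) * w) - H (y (fst q) + real (snd q) * w + w)) = (\<Sum>\<^sub>\<infinity>p. H (y p))"
    using infsum_Sigma'_banach[OF s'] by (simp add: inner case_prod_unfold)
qed

lemma lattice_peel:
  fixes H :: "real \<Rightarrow> complex"
  assumes w: "w3 > 0" and H: "(H \<longlongrightarrow> 0) at_top" and F: "\<And>x. F x = H x - H (x + w3)"
    and s: "(\<lambda>p. F (lat w1 w2 w3 p)) summable_on UNIV"
  shows "(\<lambda>q. H (real (fst q) * w1 + real (snd q) * w2)) summable_on UNIV"
    "(\<Sum>\<^sub>\<infinity>p. F (lat w1 w2 w3 p)) = (\<Sum>\<^sub>\<infinity>q. H (real (fst q) * w1 + real (snd q) * w2))"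
  using telescoping_peel[OF w H, of "\<lambda>q. real (fst q) * w1 + real (snd q) * w2"] s unfolding F lat_def by auto

section \<open>Sine factors as difference operators\<close>

lemma schwartz_sin_mult: "schwartz g \<Longrightarrow> schwartz (\<lambda>t. of_real (sin (pi * w * t)) * g t)"
  using schwartz_times_multiplier[OF _ multiplier_sin[of "pi * w"]] by (simp add: mult.commute)

lemma schwartz_sincw_mult: "schwartz g \<Longrightarrow> schwartz (\<lambda>t. sincw w t * g t)"
  using schwartz_times_multiplier[OF _ multiplier_sincw[of w]] by (simp add: mult.commute)

text \<open>A sine is a difference of two exponentials, which translate the transform by w/2 in
  opposite directions. Evaluating at x + w/2 turns this into a forward difference from x; the
  half-sum offset \<open>a\<close> of the point set is what supplies these half-steps.\<close>

lemma fourier_sin_mult: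
  assumes g: "integrable lborel g"
  shows "fourier (\<lambda>t. of_real (sin (pi * w * t)) * g t) (x + w/2) = (1 / (2 * \<i>)) * (fourier g x - fourier g (x + w))"
proof -
  have e: "complex_of_real (sin (pi * w * t)) * g t =
      (1 / (2 * \<i>)) * (exp (2 * pi * \<i> * (w/2) * t) * g t) + (- 1 / (2 * \<i>)) * (exp (2 * pi * \<i> * (- w/2) * t) * g t)" for t :: real
  proof -
    have "complex_of_real (sin (pi * w * t)) = (exp (2 * pi * \<i> * (w/2) * t) - exp (2 * pi * \<i> * (- w/2) * t)) / (2 * \<i>)"
      unfolding sin_of_real[symmetric] sin_exp_eq by (simp add: mult_ac)
    moreover have "(E - E') / (2 * \<i>) * G = (1 / (2 * \<i>)) * (E * G) + (- 1 / (2 * \<i>)) * (E' * G)" for E E' G :: complex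
      by (simp add: field_simps)
    ultimately show ?thesis by (simp only:)
  qed
  have i: "integrable lborel (\<lambda>t. exp (2 * pi * \<i> * c * t) * g t)" for c :: real
    using fourier_integrable[OF g, of "- c"] by simp
  have "fourier (\<lambda>t. of_real (sin (pi * w * t)) * g t) (x + w/2)
     = (1 / (2 * \<i>)) * fourier g (x + w/2 - w/2) + (- 1 / (2 * \<i>)) * fourier g (x + w/2 - (- w/2))"
    unfolding e by (subst fourier_add) (auto simp only: fourier_cmult fourier_modulate intro!: integrable_mult_right i)
  then show ?thesis by (simp add: algebra_simps)
qed

lemma fourier_tendsto_0: "schwartz g \<Longrightarrow> (fourier g \<longlongrightarrow> 0) at_top"
  using rapid_decay_tendsto_0[OF fourier_rapid] by (meson at_top_le_at_infinity tendsto_mono)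

lemma tendsto_at_top_shift: "(f \<longlongrightarrow> (0::complex)) at_top \<Longrightarrow> ((\<lambda>x::real. f (x + c)) \<longlongrightarrow> 0) at_top"
  by (erule filterlim_compose) (auto simp: add.commute[of _ c] intro!: filterlim_tendsto_add_at_top[OF tendsto_const] filterlim_ident)

text \<open>Each peel uses up one half-step of the offset (w1 + w2 + w3)/2. After the directions w3
  and w2 are gone, w1/2 remains, hence the half-integer multiples of w1.\<close>

lemma lattice_sum_two_sines:
  assumes w: "w1 > 0" "w2 > 0" "w3 > 0" and g: "schwartz g"
    and f: "f = (\<lambda>t. of_real (sin (pi * w3 * t)) * (of_real (sin (pi * w2 * t)) * g t))"
  shows "(\<lambda>n::nat. fourier g ((real n + 1/2) * w1)) summable_on UNIV"
    "(\<Sum>\<^sub>\<infinity>p. fourier f (lat w1 w2 w3 p + (w1 + w2 + w3)/2)) = - (1/4) * (\<Sum>\<^sub>\<infinity>n::nat. fourier g ((real n + 1/2) * w1))"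
proof -
  define h where "h = (\<lambda>t. complex_of_real (sin (pi * w2 * t)) * g t)"
  have h: "schwartz h" unfolding h_def by (rule schwartz_sin_mult[OF g])
  have fs: "schwartz f" unfolding f by (intro schwartz_sin_mult g)
  define H3 where "H3 = (\<lambda>x. (1 / (2 * \<i>)) * fourier h (x + (w1 + w2)/2))"
  \<comment> \<open>The factor -1/4 is the square of 1/(2 \<i>), one factor for each sine.\<close>
  define H2 where "H2 = (\<lambda>x. - (1/4) * fourier g (x + w1/2))"
  have fh: "f = (\<lambda>t. of_real (sin (pi * w3 * t)) * h t)" by (simp add: f h_def)
  have 3: "fourier f (x + (w1 + w2 + w3)/2) = H3 x - H3 (x + w3)" for x
    using fourier_sin_mult[OF schwartz_integrable[OF h], of w3 "x + (w1 + w2)/2"]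
    unfolding fh H3_def by (simp add: algebra_simps add_divide_distrib)
  have 2: "H3 x = H2 x - H2 (x + w2)" for x
  proof -
    have "fourier h (x + (w1 + w2)/2) = (1 / (2 * \<i>)) * (fourier g (x + w1/2) - fourier g (x + w2 + w1/2))"
      using fourier_sin_mult[OF schwartz_integrable[OF g], of w2 "x + w1/2"]
      unfolding h_def[symmetric] by (simp add: add_divide_distrib add_ac)
    moreover have "(1 / (2 * \<i>)) * ((1 / (2 * \<i>)) * (A - B)) = - (1/4) * A - - (1/4) * B" for A B :: complex
      by (simp add: field_simps)
    ultimately show ?thesis by (simp only: H3_def H2_def)
  qed
  have t3: "(H3 \<longlongrightarrow> 0) at_top" unfolding H3_def
    by (intro tendsto_mult_right_zero tendsto_at_top_shift fourier_tendsto_0 h)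
  have t2: "(H2 \<longlongrightarrow> 0) at_top" unfolding H2_def
    by (intro tendsto_mult_right_zero tendsto_at_top_shift fourier_tendsto_0 g)
  have s: "(\<lambda>p. fourier f (lat w1 w2 w3 p + (w1 + w2 + w3)/2)) summable_on UNIV"
    using w by (intro rapid_decay_summable_lat fourier_rapid fs) auto
  note p3 = lattice_peel[OF w(3) t3 3 s]
  have p2': "(\<lambda>q. H2 (real (fst q) * w1 + real (snd q) * w2) - H2 (real (fst q) * w1 + real (snd q) * w2 + w2)) summable_on (UNIV :: (nat \<times> nat) set)"
    using p3(1) by (simp only: 2)
  note p2 = telescoping_peel[OF w(2) t2, of "\<lambda>n. real n * w1", OF p2']
  have e: "H2 (real n * w1) = - (1/4) * fourier g ((real n + 1/2) * w1)" for n :: nat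
    by (simp add: H2_def algebra_simps)
  show "(\<lambda>n::nat. fourier g ((real n + 1/2) * w1)) summable_on UNIV"
    using p2(1) unfolding e by (subst (asm) summable_on_cmult_right') auto
  have "(\<Sum>\<^sub>\<infinity>p. fourier f (lat w1 w2 w3 p + (w1 + w2 + w3)/2)) = (\<Sum>\<^sub>\<infinity>n::nat. H2 (real n * w1))"
    using p3(2) p2(2) by (simp only: 2)
  also have "\<dots> = - (1/4) * (\<Sum>\<^sub>\<infinity>n::nat. fourier g ((real n + 1/2) * w1))"
    unfolding e by (rule infsum_cmult_right')
  finally show "(\<Sum>\<^sub>\<infinity>p. fourier f (lat w1 w2 w3 p + (w1 + w2 + w3)/2)) = - (1/4) * (\<Sum>\<^sub>\<infinity>n::nat. fourier g ((real n + 1/2) * w1))" .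
qed

text \<open>Summed over parameters rather than over points, so that it makes sense for all
  frequencies, including dependent ones where points would coincide. For 1, sqrt 2, sqrt 3 it agrees
  with the Dirac comb by injectivity.\<close>

definition lattice_pairing :: "real \<Rightarrow> real \<Rightarrow> real \<Rightarrow> (real \<Rightarrow> complex) \<Rightarrow> complex" where
  "lattice_pairing w1 w2 w3 F = (\<Sum>\<^sub>\<infinity>p. F (lat w1 w2 w3 p + (w1 + w2 + w3)/2))
     + (\<Sum>\<^sub>\<infinity>p. F (- (lat w1 w2 w3 p + (w1 + w2 + w3)/2)))"

lemma lattice_pairing_swap12: "lattice_pairing w1 w2 w3 F = lattice_pairing w2 w1 w3 F"
proof -
  have *: "(\<Sum>\<^sub>\<infinity>p. G (lat w1 w2 w3 p)) = (\<Sum>\<^sub>\<infinity>p. G (lat w2 w1 w3 p))" for G :: "real \<Rightarrow> complex"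
    by (rule infsum_reindex_bij_witness[where i = "\<lambda>p. ((snd (fst p), fst (fst p)), snd p)"
          and j = "\<lambda>p. ((snd (fst p), fst (fst p)), snd p)"]) (auto simp: lat_def add_ac)
  show ?thesis unfolding lattice_pairing_def
    using *[of "\<lambda>x. F (x + (w1 + w2 + w3)/2)"] *[of "\<lambda>x. F (- (x + (w1 + w2 + w3)/2))"]
    by (simp add: add.commute[of w1 w2])
qed

lemma lattice_pairing_swap13: "lattice_pairing w1 w2 w3 F = lattice_pairing w3 w2 w1 F"
proof -
  have *: "(\<Sum>\<^sub>\<infinity>p. G (lat w1 w2 w3 p)) = (\<Sum>\<^sub>\<infinity>p. G (lat w3 w2 w1 p))" for G :: "real \<Rightarrow> complex"
    by (rule infsum_reindex_bij_witness[where i = "\<lambda>p. ((snd p, snd (fst p)), fst (fst p))"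
          and j = "\<lambda>p. ((snd p, snd (fst p)), fst (fst p))"]) (auto simp: lat_def add_ac)
  have e: "w1 + w2 + w3 = w3 + w2 + w1" by simp
  show ?thesis unfolding lattice_pairing_def e
    using *[of "\<lambda>x. F (x + (w3 + w2 + w1)/2)"] *[of "\<lambda>x. F (- (x + (w3 + w2 + w1)/2))"] by simp
qed

lemma schwartz_reflect: "schwartz f \<Longrightarrow> schwartz (\<lambda>x. f (- x))"
  using schwartz_scale[of f "-1"] by simp

text \<open>The half-integer shift is produced by modulating the rescaled function with exp(-\<i> pi
  t), whose values at the integers are the signs (-1)^k.\<close>

lemma shifted_poisson_summation:
  assumes w: "w > 0" and g: "schwartz g"
  shows "(\<Sum>\<^sub>\<infinity>n::int. fourier g ((of_int n + 1/2) * w)) = (1 / w) * (\<Sum>\<^sub>\<infinity>k::int. (- 1) powi k * g (of_int k / w))"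
proof -
  define h where "h = (\<lambda>t. g ((1 / w) * t))"
  have h: "schwartz h" unfolding h_def using w by (intro schwartz_scale g) auto
  define G where "G = (\<lambda>t::real. exp (2 * pi * \<i> * (- (1/2) :: real) * t) * h t)"
  have "multiplier (\<lambda>t. 1 * exp (\<i> * complex_of_real (2 * pi * (- (1/2))) * of_real t))" by (rule multiplier_exp) auto
  from schwartz_times_multiplier[OF h this] have G: "schwartz G" unfolding G_def by (simp add: mult_ac)
  have 1: "fourier G (of_int n) = w * fourier g ((of_int n + 1/2) * w)" for n :: int
  proof -
    have "fourier G (of_int n) = fourier h (of_int n + 1/2)"
      unfolding G_def fourier_modulate by simp
    also have "\<dots> = fourier g ((of_int n + 1/2) / (1 / w)) / \<bar>1 / w\<bar>"
      unfolding h_def using w by (subst fourier_scale) auto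
    finally show ?thesis using w by (simp add: mult.commute)
  qed
  have 2: "G (of_int k) = (- 1) powi k * g (of_int k / w)" for k :: int
  proof -
    have "exp (2 * pi * \<i> * (- (1/2) :: real) * of_int k) = exp (of_int (- k) * (\<i> * pi))" by (simp add: mult_ac)
    also have "\<dots> = exp (\<i> * pi) powi (- k)" by (simp only: exp_power_int mult.commute)
    also have "\<dots> = (- 1) powi k" by (simp only: exp_pi_i' power_int_minus_one_minus)
    finally show ?thesis by (simp add: G_def h_def)
  qed
  have "w * (\<Sum>\<^sub>\<infinity>n::int. fourier g ((of_int n + 1/2) * w)) = (\<Sum>\<^sub>\<infinity>n::int. fourier G (of_int n))"
    unfolding 1 by (rule infsum_cmult_right'[symmetric])
  also have "\<dots> = (\<Sum>\<^sub>\<infinity>k::int. (- 1) powi k * g (of_int k / w))"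
    unfolding poisson_summation[OF G] 2 ..
  finally show ?thesis using w by (simp add: field_simps)
qed

lemma infsum_int_halves:
  fixes F :: "real \<Rightarrow> complex"
  assumes "(\<lambda>n::nat. F (real n + 1/2)) summable_on UNIV" "(\<lambda>n::nat. F (- (real n + 1/2))) summable_on UNIV"
  shows "(\<Sum>\<^sub>\<infinity>n::int. F (of_int n + 1/2)) = (\<Sum>\<^sub>\<infinity>n::nat. F (real n + 1/2)) + (\<Sum>\<^sub>\<infinity>n::nat. F (- (real n + 1/2)))"
proof -
  \<comment> \<open>The negative half-integers correspond to the integers -n - 1, so the two index
    ranges meet neither at 0 nor anywhere else.\<close>
  have e: "F (of_int (- int n - 1) + 1/2) = F (- (real n + 1/2))" for n by (simp add: algebra_simps)
  have 1: "((\<lambda>n::int. F (of_int n + 1/2)) has_sum (\<Sum>\<^sub>\<infinity>n::nat. F (real n + 1/2))) (range int)"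
    using has_sum_infsum[OF assms(1)] by (subst has_sum_reindex) (auto simp: o_def)
  have 2: "((\<lambda>n::int. F (of_int n + 1/2)) has_sum (\<Sum>\<^sub>\<infinity>n::nat. F (- (real n + 1/2)))) (range (\<lambda>n. - int n - 1))"
    using has_sum_infsum[OF assms(2)] by (subst has_sum_reindex) (auto simp: o_def inj_on_def algebra_simps)
  have "range int \<inter> range (\<lambda>n. - int n - 1) = {}" by auto
  from has_sum_Un_disjoint[OF 1 2 this] have "((\<lambda>n::int. F (of_int n + 1/2)) has_sum
    ((\<Sum>\<^sub>\<infinity>n::nat. F (real n + 1/2)) + (\<Sum>\<^sub>\<infinity>n::nat. F (- (real n + 1/2))))) (range int \<union> range (\<lambda>n. - int n - 1))" .
  moreover have "range int \<union> range (\<lambda>n. - int n - 1) = UNIV"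
  proof -
    have "n \<in> range int \<union> range (\<lambda>n. - int n - 1)" for n :: int
    proof (cases "n \<ge> 0")
      case True then have "n = int (nat n)" by simp
      then show ?thesis by blast
    next
      case False then have "n = - int (nat (- n - 1)) - 1" by simp
      then show ?thesis by blast
    qed
    then show ?thesis by blast
  qed
  ultimately show ?thesis using infsumI by metis
qed

text \<open>The reflected cone reduces to the first one: under t \<mapsto> -t the signs of the two
  sines cancel, so the reflected function has the same form with \<open>g\<close> reflected.
  Together both cones give all half-integer multiples of w1.\<close>

lemma lattice_pairing_two_sines:
  assumes w: "w1 > 0" "w2 > 0" "w3 > 0" and g: "schwartz g"
    and f: "f = (\<lambda>t. of_real (sin (pi * w3 * t)) * (of_real (sin (pi * w2 * t)) * g t))"
  shows "lattice_pairing w1 w2 w3 (fourier f) = - (1 / (4 * w1)) * (\<Sum>\<^sub>\<infinity>k::int. (- 1) powi k * g (of_int k / w1))"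
proof -
  define g' where "g' = (\<lambda>t. g (- t))"
  have g': "schwartz g'" unfolding g'_def by (rule schwartz_reflect[OF g])
  have f': "(\<lambda>t. f (- t)) = (\<lambda>t. of_real (sin (pi * w3 * t)) * (of_real (sin (pi * w2 * t)) * g' t))"
    by (simp add: f g'_def)
  note P = lattice_sum_two_sines[OF w g f] and M = lattice_sum_two_sines[OF w g' f']
  have r: "fourier g' x = fourier g (- x)" "fourier (\<lambda>t. f (- t)) x = fourier f (- x)" for x
    by (simp_all add: g'_def fourier_reflect)
  define G where "G = (\<lambda>x. fourier g (x * w1))"
  have "lattice_pairing w1 w2 w3 (fourier f) = - (1/4) * ((\<Sum>\<^sub>\<infinity>n::nat. G (real n + 1/2)) + (\<Sum>\<^sub>\<infinity>n::nat. G (- (real n + 1/2))))"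
    unfolding lattice_pairing_def using P(2) M(2) by (simp only: r G_def mult_minus_left distrib_left)
  also have "\<dots> = - (1/4) * (\<Sum>\<^sub>\<infinity>n::int. G (of_int n + 1/2))"
    using P(1) M(1) by (subst infsum_int_halves) (simp_all only: r G_def mult_minus_left)
  also have "\<dots> = - (1/4) * ((1 / w1) * (\<Sum>\<^sub>\<infinity>k::int. (- 1) powi k * g (of_int k / w1)))"
    unfolding G_def shifted_poisson_summation[OF w(1) g] by simp
  finally show ?thesis by simp
qed

section \<open>Triple antiderivatives and the pole at 0\<close>

text \<open>\<open>K\<close> is the tail integral of \<open>F\<close> from x to infinity, obtained
  as limit minus antiderivative; one power of decay is lost. Decay is claimed only on the right
  half-line, which is where the positive cone lies.\<close>

lemma decaying_antiderivative:
  fixes F :: "real \<Rightarrow> complex"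
  assumes F: "continuous_on UNIV F" and bd: "\<And>x. x \<ge> 0 \<Longrightarrow> norm (F x) \<le> C / (1 + x) ^ Suc (Suc p)"
  obtains K where "\<And>x. (K has_vector_derivative - F x) (at x)" "\<And>x. x \<ge> 0 \<Longrightarrow> norm (K x) \<le> C / (1 + x) ^ Suc p"
proof -
  have "C \<ge> 0" using bd[of 0] order_trans[OF norm_ge_zero[of "F 0"]] by simp
  obtain P where P: "\<And>x. (P has_vector_derivative F x) (at x)"
    using einterval_antiderivative[of "-\<infinity>" "\<infinity>" F] F by (auto simp: continuous_on_eq_continuous_at)
  \<comment> \<open>An explicit antiderivative of the majorant, so that increments of
    \<open>P\<close> are bounded by increments of \<phi>.\<close>
  define \<phi> where "\<phi> = (\<lambda>x::real. - (C / real (Suc p)) * inverse ((1 + x) ^ Suc p))"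
  have \<phi>: "(\<phi> has_real_derivative C / (1 + x) ^ Suc (Suc p)) (at x)" if "x \<ge> 0" for x
  proof -
    have "((\<lambda>x. (1 + x) ^ Suc p) has_real_derivative real (Suc p) * (1 + x) ^ p) (at x)"
      by (auto intro!: derivative_eq_intros simp del: power_Suc)
    from DERIV_cmult[OF DERIV_inverse'[OF this], of "- (C / real (Suc p))"]
    have "(\<phi> has_real_derivative - (C / real (Suc p)) *
        - (inverse ((1 + x) ^ Suc p) * (real (Suc p) * (1 + x) ^ p) * inverse ((1 + x) ^ Suc p))) (at x)"
      unfolding \<phi>_def using that by simp
    also have "- (C / real (Suc p)) * - (inverse ((1 + x) ^ Suc p) * (real (Suc p) * (1 + x) ^ p) * inverse ((1 + x) ^ Suc p))
        = C / (1 + x) ^ Suc (Suc p)"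
    proof -
      have "(1 + x) ^ p \<noteq> 0" using that by simp
      then have M: "- (C / m) * - (inverse ((1 + x) ^ Suc p) * (m * (1 + x) ^ p) * inverse ((1 + x) ^ Suc p)) = C / (1 + x) ^ Suc (Suc p)"
        if "m \<noteq> 0" for m using that by (simp add: divide_simps)
      show ?thesis by (rule M) simp
    qed
    finally show ?thesis .
  qed
  have key: "norm (P y - P x) \<le> C / (1 + x) ^ Suc p" if xy: "0 \<le> x" "x \<le> y" for x y
  proof -
    have i1: "(F has_integral P y - P x) {x..y}"
      using xy P by (intro fundamental_theorem_of_calculus) (auto intro: has_vector_derivative_at_within)
    have i2: "((\<lambda>u. C / (1 + u) ^ Suc (Suc p)) has_integral \<phi> y - \<phi> x) {x..y}"
    proof (rule fundamental_theorem_of_calculus[OF xy(2)])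
      fix u assume "u \<in> {x..y}"
      with xy have "u \<ge> 0" by simp
      from \<phi>[OF this] show "(\<phi> has_vector_derivative C / (1 + u) ^ Suc (Suc p)) (at u within {x..y})"
        by - (rule has_vector_derivative_at_within, simp only: has_real_derivative_iff_has_vector_derivative)
    qed
    have "norm (P y - P x) \<le> \<phi> y - \<phi> x"
      by (rule has_integral_norm_le[OF i1 i2]) (use bd xy in auto)
    also have "\<dots> \<le> (C / real (Suc p)) * inverse ((1 + x) ^ Suc p)"
      using xy \<open>C \<ge> 0\<close> by (simp add: \<phi>_def)
    also have "\<dots> \<le> C * inverse ((1 + x) ^ Suc p)"
      using xy \<open>C \<ge> 0\<close> by (intro mult_right_mono) (auto simp: divide_le_eq mult_le_cancel_left1)
    finally show ?thesis by (simp add: divide_inverse)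
  qed
  have "Cauchy (\<lambda>n::nat. P (real n))"
  proof (rule CauchyI')
    fix e :: real assume e: "e > 0"
    obtain M :: nat where M: "C / e < real M" using reals_Archimedean2 by blast
    have "dist (P (real m)) (P (real n)) < e" if "m \<ge> M" "m < n" for m n
    proof -
      have "C / (1 + real m) ^ Suc p \<le> C / (1 + real m)"
        using \<open>C \<ge> 0\<close> by (intro divide_left_mono) (auto intro!: self_le_power simp del: power_Suc)
      also have "\<dots> < e"
      proof -
        have "C < e * real M" using M e by (simp add: field_simps)
        also have "\<dots> \<le> e * (1 + real m)" using that e by (intro mult_left_mono) auto
        finally show ?thesis by (simp add: divide_less_eq)
      qed
      finally show ?thesis using key[of "real m" "real n"] that by (simp add: dist_norm norm_minus_commute)
    qed
    then show "\<exists>M. \<forall>m\<ge>M. \<forall>n>m. dist (P (real m)) (P (real n)) < e" by blast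
  qed
  then obtain L where L: "(\<lambda>n::nat. P (real n)) \<longlonglongrightarrow> L" using Cauchy_convergent_iff convergent_def by blast
  show thesis
  proof (rule that[of "\<lambda>x. L - P x"])
    show "((\<lambda>x. L - P x) has_vector_derivative - F x) (at x)" for x
      using P[of x] by (auto intro!: derivative_eq_intros)
    fix x :: real assume x: "x \<ge> 0"
    have "(\<lambda>n::nat. norm (P (real n) - P x)) \<longlonglongrightarrow> norm (L - P x)" by (intro tendsto_intros L)
    moreover have "\<exists>N. \<forall>n\<ge>N. norm (P (real n) - P x) \<le> C / (1 + x) ^ Suc p"
    proof -
      obtain N :: nat where "x \<le> real N" using real_arch_simple by blast
      then have "\<forall>n\<ge>N. norm (P (real n) - P x) \<le> C / (1 + x) ^ Suc p" using x by (intro allI impI key) auto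
      then show ?thesis by blast
    qed
    ultimately show "norm (L - P x) \<le> C / (1 + x) ^ Suc p" by (rule LIMSEQ_le_const2)
  qed
qed

text \<open>Removes the boundary terms at infinity in the repeated integration by parts
  below.\<close>

lemma tendsto_0_of_decay:
  fixes K :: "real \<Rightarrow> complex"
  assumes "\<And>x. x \<ge> 0 \<Longrightarrow> norm (K x) \<le> C / (1 + x) ^ (Suc p + q)"
  shows "((\<lambda>x. of_real (x ^ q) * K x) \<longlongrightarrow> 0) at_top"
proof (rule Lim_null_comparison)
  have C: "C \<ge> 0" using assms[of 0] order_trans[OF norm_ge_zero[of "K 0"]] by simp
  have "norm (of_real (x ^ q) * K x) \<le> C / (1 + x)" if x: "x \<ge> 0" for x
  proof -
    have "norm (of_real (x ^ q) * K x) \<le> (1 + x) ^ q * (C / (1 + x) ^ (Suc p + q))"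
      unfolding norm_mult using x assms[OF x] by (intro mult_mono) (auto intro!: power_mono simp: norm_power)
    also have "\<dots> = C / (1 + x) ^ Suc p" using x by (simp add: power_add)
    also have "\<dots> \<le> C / (1 + x)"
      using x C by (intro divide_left_mono) (auto intro!: self_le_power simp del: power_Suc)
    finally show ?thesis .
  qed
  then show "\<forall>\<^sub>F x in at_top. norm (of_real (x ^ q) * K x) \<le> C / (1 + x)"
    by (auto intro: eventually_at_top_linorderI[of 0])
  show "((\<lambda>x. C / (1 + x)) \<longlongrightarrow> 0) at_top"
    by (intro tendsto_divide_0[OF tendsto_const] filterlim_at_top_imp_at_infinity
        filterlim_tendsto_add_at_top[OF tendsto_const] filterlim_ident)
qed

text \<open>Averaging over an interval of length w is a difference of an antiderivative at its
  endpoints, so a sine quotient acts like a sine after one integration.\<close>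

lemma fourier_sincw_difference:
  assumes w: "w \<ge> 0" and h: "integrable lborel h"
    and K: "\<And>x. (K has_vector_derivative - fourier h (x + c)) (at x)"
  shows "fourier (\<lambda>t. sincw w t * h t) (x + c + w/2) = K x - K (x + w)"
proof -
  have i: "((\<lambda>u. fourier h (x + c + w/2 - u)) has_integral (K (x + w/2 - w/2) - K (x + w/2 - (- w/2)))) {- w/2..w/2}"
  proof (rule fundamental_theorem_of_calculus)
    fix u assume "u \<in> {- w/2..w/2}"
    have d: "((\<lambda>u. x + w/2 - u) has_vector_derivative -1) (at u)" by (auto intro!: derivative_eq_intros)
    show "((\<lambda>u. K (x + w/2 - u)) has_vector_derivative fourier h (x + c + w/2 - u)) (at u within {- w/2..w/2})"
    proof -
      have e: "x + w/2 - u + c = x + c + w/2 - u" by simp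
      from vector_diff_chain_at[OF d K] show ?thesis
        unfolding o_def e by - (rule has_vector_derivative_at_within, simp)
    qed
  qed (use w in auto)
  have "x + w/2 - (- w/2) = x + w" "x + w/2 - w/2 = x" by auto
  then show ?thesis unfolding fourier_sincw[OF h] integral_unique[OF i] by (simp only:)
qed

text \<open>The transform of \<open>f\<close> is a third difference of the threefold tail integral
  \<open>K3\<close>, so the cone sum collapses to \<open>K3 0\<close>. By Cauchy's formula for
  repeated integration this is the integral of u^2/2 times the transform of \<open>g\<close> over
  the half-line.\<close>

lemma lattice_sum_sincs:
  assumes w: "w1 > 0" "w2 > 0" "w3 > 0" and g: "schwartz g"
    and f: "f = (\<lambda>t. sincw w3 t * (sincw w2 t * (sincw w1 t * g t)))"
  shows "(\<lambda>N::nat. integral {0..real N + 1/2} (\<lambda>u. of_real (u\<^sup>2 / 2) * fourier g u)) \<longlonglongrightarrow>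
     (\<Sum>\<^sub>\<infinity>p. fourier f (lat w1 w2 w3 p + (w1 + w2 + w3)/2))"
proof -
  \<comment> \<open>From exponent 6 the three antiderivatives keep 5, 4 and 3 powers of decay,
    enough to beat x^2, x and 1 respectively.\<close>
  obtain C where C: "\<And>x. norm (fourier g x) \<le> C / (1 + \<bar>x\<bar>) ^ 6"
    using rapid_decay_bound[OF fourier_rapid[OF g]] by blast
  have cont: "continuous_on UNIV K" if "\<And>x. (K has_vector_derivative K' x) (at x)" for K K' :: "real \<Rightarrow> complex"
    using that by (meson continuous_at_imp_continuous_on has_vector_derivative_continuous)
  have cf: "continuous_on UNIV (fourier g)" by (intro continuous_fourier schwartz_integrable g)
  have b0: "norm (fourier g x) \<le> C / (1 + x) ^ Suc (Suc 4)" if "x \<ge> 0" for x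
    using C[of x] that by (simp add: numeral_eq_Suc)
  obtain K1 where K1: "\<And>x. (K1 has_vector_derivative - fourier g x) (at x)" "\<And>x. x \<ge> 0 \<Longrightarrow> norm (K1 x) \<le> C / (1 + x) ^ Suc 4"
    using decaying_antiderivative[OF cf b0] by blast
  have b1: "norm (K1 x) \<le> C / (1 + x) ^ Suc (Suc 3)" if "x \<ge> 0" for x
    using K1(2)[OF that] by (simp add: numeral_eq_Suc)
  obtain K2 where K2: "\<And>x. (K2 has_vector_derivative - K1 x) (at x)" "\<And>x. x \<ge> 0 \<Longrightarrow> norm (K2 x) \<le> C / (1 + x) ^ Suc 3"
    using decaying_antiderivative[OF cont[OF K1(1)] b1] by blast
  have b2: "norm (K2 x) \<le> C / (1 + x) ^ Suc (Suc 2)" if "x \<ge> 0" for x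
    using K2(2)[OF that] by (simp add: numeral_eq_Suc)
  obtain K3 where K3: "\<And>x. (K3 has_vector_derivative - K2 x) (at x)" "\<And>x. x \<ge> 0 \<Longrightarrow> norm (K3 x) \<le> C / (1 + x) ^ Suc 2"
    using decaying_antiderivative[OF cont[OF K2(1)] b2] by blast
  have t1: "((\<lambda>x. of_real (x ^ 2) * K1 x) \<longlongrightarrow> 0) at_top"
    by (rule tendsto_0_of_decay[where p = 2]) (use K1(2) in \<open>auto simp: numeral_eq_Suc\<close>)
  have t2: "((\<lambda>x. of_real (x ^ 1) * K2 x) \<longlongrightarrow> 0) at_top"
    by (rule tendsto_0_of_decay[where p = 2]) (use K2(2) in \<open>auto simp: numeral_eq_Suc\<close>)
  have t3: "((\<lambda>x. of_real (x ^ 0) * K3 x) \<longlongrightarrow> 0) at_top"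
    by (rule tendsto_0_of_decay[where p = 2]) (use K3(2) in \<open>auto simp: numeral_eq_Suc\<close>)
  \<comment> \<open>An antiderivative of u^2/2 times the transform, found by integrating by parts
    three times. It vanishes at infinity and equals \<open>- K3 0\<close> at 0.\<close>
  define W where "W = (\<lambda>x. - (1/2) * (of_real (x ^ 2) * K1 x) - of_real x * K2 x - K3 x)"
  have "(W \<longlongrightarrow> - (1/2) * 0 - 0 - 0) at_top"
    unfolding W_def using t2 t3 by (intro tendsto_intros t1) auto
  then have W0: "(W \<longlongrightarrow> 0) at_top" by simp
  have W': "(W has_vector_derivative of_real (x\<^sup>2 / 2) * fourier g x) (at x)" for x
  proof -
    have q2: "((\<lambda>x::real. complex_of_real (x ^ 2)) has_vector_derivative 2 * of_real x) (at x)"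
    proof -
      have "((\<lambda>z::complex. z ^ 2) has_field_derivative 2 * of_real x) (at (of_real x))"
        by (auto intro!: derivative_eq_intros)
      from has_vector_derivative_real_field[OF this] show ?thesis by simp
    qed
    have q1: "(complex_of_real has_vector_derivative 1) (at x)"
      by (rule has_vector_derivative_real_field[of "\<lambda>z::complex. z"]) (rule DERIV_ident)
    have "(W has_vector_derivative - (1/2) * (of_real (x ^ 2) * - fourier g x + 2 * of_real x * K1 x)
        - (of_real x * - K1 x + 1 * K2 x) - - K2 x) (at x)"
      unfolding W_def
      by (intro has_vector_derivative_diff has_vector_derivative_mult_right has_vector_derivative_mult q1 q2 K1 K2 K3)
    then show ?thesis by (simp add: algebra_simps)
  qed
  have int: "integral {0..real N + 1/2} (\<lambda>u. of_real (u\<^sup>2 / 2) * fourier g u) = W (real N + 1/2) - W 0" for N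
    by (rule integral_unique, rule fundamental_theorem_of_calculus) (simp, rule has_vector_derivative_at_within, rule W')
  have "filterlim (\<lambda>N. 1/2 + real N) at_top sequentially"
    by (intro filterlim_tendsto_add_at_top[OF tendsto_const] filterlim_real_sequentially)
  from filterlim_compose[OF W0 this] have "(\<lambda>N. W (real N + 1/2) - W 0) \<longlonglongrightarrow> 0 - W 0"
    by (intro tendsto_intros) (simp add: add.commute)
  then have lim: "(\<lambda>N::nat. integral {0..real N + 1/2} (\<lambda>u. of_real (u\<^sup>2 / 2) * fourier g u)) \<longlonglongrightarrow> K3 0"
    unfolding int by (simp add: W_def)
  define h1 where "h1 = (\<lambda>t. sincw w1 t * g t)"
  define h2 where "h2 = (\<lambda>t. sincw w2 t * h1 t)"
  have h1: "schwartz h1" unfolding h1_def by (intro schwartz_sincw_mult g)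
  have h2: "schwartz h2" unfolding h2_def by (intro schwartz_sincw_mult h1)
  have fh: "f = (\<lambda>t. sincw w3 t * h2 t)" unfolding f h2_def h1_def by simp
  have fs: "schwartz f" unfolding fh by (intro schwartz_sincw_mult h2)
  have f1: "fourier h1 (x + w1/2) = K1 x - K1 (x + w1)" for x
    using fourier_sincw_difference[of w1 g K1 0 x] w g K1(1) unfolding h1_def by (simp add: schwartz_integrable)
  have diff: "((\<lambda>x. K x - K (x + c)) has_vector_derivative - (K' x - K' (x + c))) (at x)"
    if "\<And>x. (K has_vector_derivative - K' x) (at x)" for K K' :: "real \<Rightarrow> complex" and c x
  proof -
    have "((\<lambda>x. x + c) has_vector_derivative 1) (at x)" by (auto intro!: derivative_eq_intros)
    from vector_diff_chain_at[OF this that] have "((\<lambda>x. K (x + c)) has_vector_derivative - K' (x + c)) (at x)"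
      by (simp add: o_def)
    from has_vector_derivative_diff[OF that this] show ?thesis by simp
  qed
  \<comment> \<open>Differences commute with taking antiderivatives, so all three integrations can
    be done first on the transform of \<open>g\<close> and the differences applied
    afterwards.\<close>
  define D1 where "D1 = (\<lambda>K x. K x - K (x + w1) :: complex)"
  define D2 where "D2 = (\<lambda>K x. D1 K x - D1 K (x + w2))"
  have f2: "fourier h2 (x + w1/2 + w2/2) = D2 K2 x" for x
    using fourier_sincw_difference[of w2 h1 "D1 K2" "w1/2" x] w h1 diff[OF K2(1), of w1]
    unfolding h2_def D2_def f1 by (simp add: schwartz_integrable D1_def)
  have D1K3: "(D1 K3 has_vector_derivative - (D1 K2 x)) (at x)" for x
    unfolding D1_def by (rule diff[OF K3(1)])
  have "(D2 K3 has_vector_derivative - (D2 K2 x)) (at x)" for x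
    unfolding D2_def by (rule diff[OF D1K3])
  moreover have "fourier h2 (x + (w1/2 + w2/2)) = D2 K2 x" for x using f2[of x] by (simp only: add.assoc)
  ultimately have d3: "(D2 K3 has_vector_derivative - fourier h2 (x + (w1/2 + w2/2))) (at x)" for x by simp
  have f3: "fourier f (x + (w1 + w2 + w3)/2) = D2 K3 x - D2 K3 (x + w3)" for x
  proof -
    have "x + (w1 + w2 + w3)/2 = x + (w1/2 + w2/2) + w3/2" by (simp add: add_divide_distrib)
    then show ?thesis
      using fourier_sincw_difference[OF less_imp_le[OF w(3)] schwartz_integrable[OF h2] d3, of x]
      unfolding fh by (simp only:)
  qed
  have K3t: "(K3 \<longlongrightarrow> 0) at_top" using t3 by simp
  have D1t: "(D1 K3 \<longlongrightarrow> 0) at_top"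
    unfolding D1_def using tendsto_diff[OF K3t tendsto_at_top_shift[OF K3t]] by simp
  have D2t: "(D2 K3 \<longlongrightarrow> 0) at_top"
    unfolding D2_def using tendsto_diff[OF D1t tendsto_at_top_shift[OF D1t]] by simp
  have s: "(\<lambda>p. fourier f (lat w1 w2 w3 p + (w1 + w2 + w3)/2)) summable_on UNIV"
    using w by (intro rapid_decay_summable_lat fourier_rapid fs) auto
  note p3 = lattice_peel[OF w(3) D2t f3 s]
  note p2 = telescoping_peel[OF w(2) D1t, of "\<lambda>n::nat. real n * w1", OF p3(1)[unfolded D2_def]]
  have "(\<lambda>n::nat. K3 (0 + real n * w1) - K3 (0 + real n * w1 + w1)) summable_on UNIV"
    using p2(1) by (simp add: D1_def)
  from infsumI[OF telescoping_has_sum[OF w(1) K3t this]]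
  have "(\<Sum>\<^sub>\<infinity>n::nat. D1 K3 (real n * w1)) = K3 0" by (simp add: D1_def)
  then have "(\<Sum>\<^sub>\<infinity>p. fourier f (lat w1 w2 w3 p + (w1 + w2 + w3)/2)) = K3 0"
    using p3(2) p2(2) by (simp only: D2_def)
  with lim show ?thesis by simp
qed

lemma sincw_reflect: "sincw w (- t) = sincw w t"
proof -
  have "sincw w (- t) = integral {- w/2..w/2} (\<lambda>u. exp (2 * pi * \<i> * t * (- u)))"
    unfolding sincw_def by simp
  also have "\<dots> = sincw w t"
    unfolding sincw_def using Henstock_Kurzweil_Integration.integral_reflect_real[of "w/2" "-w/2" "\<lambda>u::real. exp (2 * pi * \<i> * t * u)"] by simp
  finally show ?thesis .
qed

text \<open>The cone and its reflection contribute the two half-line integrals of u^2/2 times the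
  transform of \<open>g\<close>. Since -4 pi^2 u^2 times this transform is the transform of g'',
  inversion at 0 evaluates the integral over the line.\<close>

lemma lattice_pairing_sincs:
  assumes w: "w1 > 0" "w2 > 0" "w3 > 0" and g: "schwartz g"
    and f: "f = (\<lambda>t. sincw w3 t * (sincw w2 t * (sincw w1 t * g t)))"
  shows "lattice_pairing w1 w2 w3 (fourier f) = - (1 / (8 * pi\<^sup>2)) * vderiv (vderiv g) 0"
proof -
  define g' where "g' = (\<lambda>t. g (- t))"
  have g': "schwartz g'" unfolding g'_def by (rule schwartz_reflect[OF g])
  have f': "(\<lambda>t. f (- t)) = (\<lambda>t. sincw w3 t * (sincw w2 t * (sincw w1 t * g' t)))"
    by (simp add: f g'_def sincw_reflect)
  have r: "fourier g' x = fourier g (- x)" "fourier (\<lambda>t. f (- t)) x = fourier f (- x)" for x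
    by (simp_all add: g'_def fourier_reflect)
  define q where "q = (\<lambda>u. of_real (u\<^sup>2 / 2) * fourier g u)"
  have cq: "continuous_on S q" for S unfolding q_def
    by (intro continuous_intros continuous_fourier schwartz_integrable g) auto
  have qe: "q u = - (1 / (8 * pi\<^sup>2)) * fourier (vderiv (vderiv g)) u" for u
  proof -
    have "fourier (vderiv (vderiv g)) u = (2 * pi * \<i> * u) * ((2 * pi * \<i> * u) * fourier g u)"
      by (simp only: fourier_vderiv[OF schwartz_vderiv[OF g]] fourier_vderiv[OF g])
    then show ?thesis by (simp add: q_def field_simps power2_eq_square)
  qed
  have g2: "schwartz (vderiv (vderiv g))" by (intro schwartz_vderiv g)
  have i2: "integrable lborel (fourier (vderiv (vderiv g)))"
    by (metis continuous_fourier fourier_rapid g2 integrable_of_quadratic_decay rapid_decay_bound schwartz_integrable)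
  have iq: "integrable lborel q" unfolding qe using i2 by (intro integrable_mult_right)
  have L1: "(\<lambda>N::nat. integral {- (real N + 1/2)..real N + 1/2} q) \<longlonglongrightarrow> (LINT u|lborel. q u)"
    by (rule symmetric_integral_tendsto[OF cq iq])
  have L2: "(LINT u|lborel. q u) = - (1 / (8 * pi\<^sup>2)) * vderiv (vderiv g) 0"
    unfolding qe integral_mult_right_zero fourier_inversion_at_0[OF g2] ..
  have L3: "(\<lambda>N::nat. integral {- (real N + 1/2)..real N + 1/2} q) \<longlonglongrightarrow> lattice_pairing w1 w2 w3 (fourier f)"
  proof -
    have "integral {- (real N + 1/2)..real N + 1/2} q =
       integral {0..real N + 1/2} q + integral {0..real N + 1/2} (\<lambda>u. of_real (u\<^sup>2 / 2) * fourier g' u)" for N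
    proof -
      have "integral {- (real N + 1/2)..real N + 1/2} q = integral {- (real N + 1/2)..0} q + integral {0..real N + 1/2} q"
        by (intro Henstock_Kurzweil_Integration.integral_combine[symmetric] integrable_continuous_real cq) auto
      also have "integral {- (real N + 1/2)..0} q = integral {0..real N + 1/2} (\<lambda>u. q (- u))"
        using Henstock_Kurzweil_Integration.integral_reflect_real[of "real N + 1/2" 0 "\<lambda>u. q (- u)"] by simp
      finally show ?thesis by (simp add: q_def r)
    qed
    then show ?thesis unfolding lattice_pairing_def
      using tendsto_add[OF lattice_sum_sincs[OF w g f] lattice_sum_sincs[OF w g' f']]
      by (simp only: q_def r)
  qed
  from LIMSEQ_unique[OF L3 L1] show ?thesis unfolding L2 .
qed

subsection \<open>Small denominators and the summation formula\<close>

text \<open>Quantitative form of the absence of common zeros apart from 0: the entry \<bar>t\<bar>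
  of the minimum allows for the common zero at 0, the entry 1/(1 + \<bar>t\<bar>) is the rate of
  badly approximable ratios.\<close>

definition sines_apart :: "real \<Rightarrow> real \<Rightarrow> bool" where
  "sines_apart v w \<longleftrightarrow> (\<exists>c>0. \<forall>t. c * min \<bar>t\<bar> (1 / (1 + \<bar>t\<bar>)) \<le> \<bar>sin (pi * v * t)\<bar> + \<bar>sin (pi * w * t)\<bar>)"

lemma sines_apart_commute: "sines_apart v w \<Longrightarrow> sines_apart w v"
  unfolding sines_apart_def by (simp add: add.commute)

lemma abs_sin_pi_ge: "2 * \<bar>x - of_int (round x)\<bar> \<le> \<bar>sin (pi * x)\<bar>"
proof -
  define m where "m = round x"
  have "\<bar>x - of_int m\<bar> \<le> 1/2" unfolding m_def using of_int_round_abs_le[of x] by (simp add: abs_minus_commute)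
  then have "2 * \<bar>x - of_int m\<bar> \<le> \<bar>sin (pi * (x - of_int m))\<bar>" by (rule two_abs_le_abs_sin_pi)
  also have "sin (pi * (x - of_int m)) = sin (pi * x) * cos (pi * of_int m)"
  proof -
    have "sin (pi * of_int m) = 0" by (simp add: sin_int_times_real mult.commute)
    then show ?thesis by (simp add: right_diff_distrib sin_diff)
  qed
  also have "\<bar>sin (pi * x) * cos (pi * of_int m)\<bar> \<le> \<bar>sin (pi * x)\<bar>"
    unfolding abs_mult by (rule mult_left_le) auto
  finally show ?thesis by (simp add: m_def)
qed

text \<open>Liouville's argument. If m and n are the integers nearest to v t and w t, then (w m - v
  n)(w m + v n) = B m^2 - A n^2 is a nonzero integer, so at least 1 in modulus. The second factor is
  O(1 + \<bar>t\<bar>), and the first is a combination of the two distances to m and n, which bound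
  the sines from below.\<close>

lemma sines_apart_quadratic:
  fixes v w :: real and A B :: int
  assumes v: "v > 0" "v\<^sup>2 = of_int A" and w: "w > 0" "w\<^sup>2 = of_int B"
    and irr: "\<And>m n :: int. B * m\<^sup>2 = A * n\<^sup>2 \<Longrightarrow> m = 0 \<and> n = 0"
  shows "sines_apart v w"
proof -
  define M where "M = 2 * v * w + v + w"
  have M: "M > 0" unfolding M_def using v w by (simp add: add_pos_pos)
  define c where "c = min (2 * v) (2 / ((v + w) * M))"
  have c: "c > 0" unfolding c_def using v w M by simp
  have "c * min \<bar>t\<bar> (1 / (1 + \<bar>t\<bar>)) \<le> \<bar>sin (pi * v * t)\<bar> + \<bar>sin (pi * w * t)\<bar>" for t
  proof -
    define m n where "m = round (v * t)" and "n = round (w * t)"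
    define e1 e2 where "e1 = v * t - of_int m" and "e2 = w * t - of_int n"
    have s: "2 * \<bar>e1\<bar> + 2 * \<bar>e2\<bar> \<le> \<bar>sin (pi * v * t)\<bar> + \<bar>sin (pi * w * t)\<bar>"
      using abs_sin_pi_ge[of "v * t"] abs_sin_pi_ge[of "w * t"]
      by (simp add: e1_def e2_def m_def n_def mult.assoc)
    have small: "\<bar>e1\<bar> \<le> 1/2" "\<bar>e2\<bar> \<le> 1/2"
      using of_int_round_abs_le[of "v * t"] of_int_round_abs_le[of "w * t"]
      by (simp_all add: e1_def e2_def m_def n_def abs_minus_commute)
    show ?thesis
    proof (cases "m = 0 \<and> n = 0")
      case True
      \<comment> \<open>Here the integer B m^2 - A n^2 is 0 and gives nothing, but the distance of v
        t to its nearest integer is v \<bar>t\<bar> itself.\<close>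
      have "c * min \<bar>t\<bar> (1 / (1 + \<bar>t\<bar>)) \<le> (2 * v) * \<bar>t\<bar>"
        using c v by (intro mult_mono) (auto simp: c_def)
      also have "\<dots> = 2 * \<bar>e1\<bar>" using True v by (simp add: e1_def abs_mult)
      finally show ?thesis using s by linarith
    next
      case False
      define x y where "x = w * of_int m - v * of_int n" and "y = w * of_int m + v * of_int n"
      have xy: "x * y = of_int (B * m\<^sup>2 - A * n\<^sup>2)"
        unfolding x_def y_def of_int_diff of_int_mult of_int_power v(2)[symmetric] w(2)[symmetric]
        by (simp add: algebra_simps power2_eq_square)
      have "B * m\<^sup>2 - A * n\<^sup>2 \<noteq> 0" using irr[of m n] False by auto
      then have "1 \<le> \<bar>B * m\<^sup>2 - A * n\<^sup>2\<bar>" by linarith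
      then have "1 \<le> \<bar>x\<bar> * \<bar>y\<bar>" unfolding abs_mult[symmetric] xy by linarith
      also have "\<dots> \<le> \<bar>x\<bar> * (M * (1 + \<bar>t\<bar>))"
      proof (rule mult_left_mono)
        have "y = 2 * v * w * t - w * e1 - v * e2" by (simp add: y_def e1_def e2_def algebra_simps)
        then have "\<bar>y\<bar> \<le> \<bar>2 * v * w * t\<bar> + \<bar>w * e1\<bar> + \<bar>v * e2\<bar>" by linarith
        also have "\<dots> = 2 * v * w * \<bar>t\<bar> + w * \<bar>e1\<bar> + v * \<bar>e2\<bar>" using v w by (simp add: abs_mult)
        also have "\<dots> \<le> 2 * v * w * \<bar>t\<bar> + w * 1 + v * 1"
          using v w small by (intro add_mono mult_left_mono) auto
        also have "\<dots> \<le> M * (1 + \<bar>t\<bar>)" using v w by (simp add: M_def algebra_simps)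
        finally show "\<bar>y\<bar> \<le> M * (1 + \<bar>t\<bar>)" .
      qed auto
      also have "\<dots> \<le> ((v + w) * (\<bar>e1\<bar> + \<bar>e2\<bar>)) * (M * (1 + \<bar>t\<bar>))"
      proof (rule mult_right_mono)
        have "x = v * e2 - w * e1" by (simp add: x_def e1_def e2_def algebra_simps)
        then have "\<bar>x\<bar> \<le> \<bar>v * e2\<bar> + \<bar>w * e1\<bar>" by linarith
        also have "\<dots> = v * \<bar>e2\<bar> + w * \<bar>e1\<bar>" using v w by (simp add: abs_mult)
        also have "\<dots> \<le> (v + w) * (\<bar>e1\<bar> + \<bar>e2\<bar>)" using v w by (simp add: algebra_simps)
        finally show "\<bar>x\<bar> \<le> (v + w) * (\<bar>e1\<bar> + \<bar>e2\<bar>)" .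
      qed (use M in auto)
      finally have "1 \<le> (((v + w) * M) * (1 + \<bar>t\<bar>)) * (\<bar>e1\<bar> + \<bar>e2\<bar>)" by (simp add: mult_ac)
      then have "1 / (((v + w) * M) * (1 + \<bar>t\<bar>)) \<le> \<bar>e1\<bar> + \<bar>e2\<bar>"
        using v w M by (subst pos_divide_le_eq) (auto intro!: mult_pos_pos add_pos_pos simp: mult.commute)
      then have "2 / ((v + w) * M) * (1 / (1 + \<bar>t\<bar>)) \<le> 2 * \<bar>e1\<bar> + 2 * \<bar>e2\<bar>" by simp
      moreover have "c * min \<bar>t\<bar> (1 / (1 + \<bar>t\<bar>)) \<le> 2 / ((v + w) * M) * (1 / (1 + \<bar>t\<bar>))"
        using c v w M by (intro mult_mono) (auto simp: c_def)
      ultimately show ?thesis using s by linarith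
    qed
  qed
  with c show ?thesis unfolding sines_apart_def by blast
qed

text \<open>The exponent of p would be even on the left and odd on the right.\<close>

lemma prime_times_square_eq:
  fixes p u x y :: int
  assumes p: "prime p" and u: "\<not> p dvd u" and eq: "u * x\<^sup>2 = p * y\<^sup>2"
  shows "x = 0 \<and> y = 0"
proof (rule ccontr)
  assume "\<not> ?thesis"
  moreover have "u \<noteq> 0" "p \<noteq> 0" using u p by auto
  ultimately have nz: "x \<noteq> 0" "y \<noteq> 0" using eq by auto
  have pe: "prime_elem p" using p by (rule prime_imp_prime_elem)
  have "multiplicity p (u * x\<^sup>2) = 2 * multiplicity p x"
    using u nz \<open>u \<noteq> 0\<close>
    by (simp add: prime_elem_multiplicity_mult_distrib[OF pe] prime_elem_multiplicity_power_distrib[OF pe] not_dvd_imp_multiplicity_0)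
  moreover have "multiplicity p (p * y\<^sup>2) = 1 + 2 * multiplicity p y"
    using nz \<open>p \<noteq> 0\<close> multiplicity_self[OF \<open>p \<noteq> 0\<close> prime_elem_not_unit[OF pe]]
    by (simp add: prime_elem_multiplicity_mult_distrib[OF pe] prime_elem_multiplicity_power_distrib[OF pe])
  ultimately have "2 * multiplicity p x = 1 + 2 * multiplicity p y" using eq by simp
  then show False by presburger
qed

lemma sines_apart_1_sqrt2: "sines_apart 1 (sqrt 2)"
proof (rule sines_apart_quadratic[where A = 1 and B = 2])
  show "m = 0 \<and> n = 0" if "2 * m\<^sup>2 = 1 * n\<^sup>2" for m n :: int
    using prime_times_square_eq[of 2 1 n m] that by auto
qed auto

lemma sines_apart_1_sqrt3: "sines_apart 1 (sqrt 3)"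
proof (rule sines_apart_quadratic[where A = 1 and B = 3])
  show "m = 0 \<and> n = 0" if "3 * m\<^sup>2 = 1 * n\<^sup>2" for m n :: int
    using prime_times_square_eq[of 3 1 n m] that by auto
qed auto

lemma sines_apart_sqrt2_sqrt3: "sines_apart (sqrt 2) (sqrt 3)"
proof (rule sines_apart_quadratic[where A = 2 and B = 3])
  show "m = 0 \<and> n = 0" if "3 * m\<^sup>2 = 2 * n\<^sup>2" for m n :: int
    using prime_times_square_eq[of 2 3 m n] that by auto
qed auto

text \<open>At t = k/v the sine of frequency v vanishes, so the whole lower bound falls on the other
  one.\<close>

lemma sines_apart_ratio:
  assumes "sines_apart v w" and v: "v > 0"
  obtains c where "c > 0" "\<And>k::int. k \<noteq> 0 \<Longrightarrow> c / (1 + \<bar>of_int k\<bar>) \<le> \<bar>sin (pi * k * (w / v))\<bar>"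
proof -
  obtain c where c: "c > 0" "\<And>t. c * min \<bar>t\<bar> (1 / (1 + \<bar>t\<bar>)) \<le> \<bar>sin (pi * v * t)\<bar> + \<bar>sin (pi * w * t)\<bar>"
    using assms(1) unfolding sines_apart_def by blast
  define m where "m = min (1 / v) (min 1 v)"
  have m: "m > 0" "m \<le> 1 / v" "m \<le> 1" "m \<le> v" using v by (auto simp: m_def)
  show thesis
  proof (rule that[of "c * m"])
    show "c * m > 0" using c m by simp
    fix k :: int assume k: "k \<noteq> 0"
    define K where "K = \<bar>real_of_int k\<bar>"
    have K: "K \<ge> 1" using k by (simp add: K_def)
    define t where "t = of_int k / v"
    have t: "\<bar>t\<bar> = K / v" using v by (simp add: t_def K_def)
    have "m / (1 + K) \<le> min \<bar>t\<bar> (1 / (1 + \<bar>t\<bar>))"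
    proof (rule min.boundedI)
      have "m / (1 + K) \<le> m" using K m by (simp add: divide_le_eq mult_le_cancel_left1)
      also have "\<dots> \<le> 1 / v" by (rule m)
      also have "\<dots> \<le> K / v" using K v by (intro divide_right_mono) auto
      finally show "m / (1 + K) \<le> \<bar>t\<bar>" unfolding t .
      have "m * (1 + K / v) = m + m * K / v" by (simp add: algebra_simps)
      also have "\<dots> \<le> 1 + v * K / v" using m v K by (intro add_mono divide_right_mono mult_right_mono) auto
      also have "\<dots> = 1 + K" using v by simp
      finally have "m * (1 + K / v) \<le> 1 + K" .
      then show "m / (1 + K) \<le> 1 / (1 + \<bar>t\<bar>)" unfolding t using K v
        by (simp add: frac_le_eq divide_simps mult.commute add_pos_pos)
    qed
    then have "c * (m / (1 + K)) \<le> c * min \<bar>t\<bar> (1 / (1 + \<bar>t\<bar>))" using c(1) by (intro mult_left_mono) auto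
    also note c(2)[of t]
    also have "sin (pi * v * t) = 0" using v by (simp add: t_def sin_int_times_real mult.commute)
    also have "pi * w * t = pi * k * (w / v)" by (simp add: t_def)
    finally show "c * m / (1 + \<bar>of_int k\<bar>) \<le> \<bar>sin (pi * k * (w / v))\<bar>" by (simp add: K_def)
  qed
qed

section \<open>The spectral side and the small denominators\<close>

text \<open>One formula for all three families: \<open>b\<close>, \<open>c\<close>, \<open>d\<close>
  arise for the orders (w1, w2, w3), (w2, w1, w3), (w3, w1, w2). At k = 0 the division is by 0, so
  sums over this coefficient exclude that index.\<close>

definition residue_coeff :: "real \<Rightarrow> real \<Rightarrow> real \<Rightarrow> int \<Rightarrow> real" where
  "residue_coeff w1 w2 w3 k = (- 1) powi (k + 1) / (4 * w1 * sin (pi * k * (w2 / w1)) * sin (pi * k * (w3 / w1)))"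

lemma residue_coeff_commute: "residue_coeff w1 w3 w2 = residue_coeff w1 w2 w3"
  by (simp add: residue_coeff_def fun_eq_iff mult_ac)

text \<open>Each sine in the denominator costs a factor 1 + \<bar>k\<bar>, so the coefficients are
  O(k^2), and fourth-order decay of \<open>f\<close> leaves an inverse square.\<close>

lemma residue_coeff_summable:
  fixes f :: "real \<Rightarrow> complex"
  assumes w1: "w1 > 0" and "sines_apart w1 w2" "sines_apart w1 w3" and f: "rapid_decay f"
  shows "(\<lambda>k::int. norm (residue_coeff w1 w2 w3 k * f (of_int k / w1))) summable_on (- {0})"
proof -
  obtain a where a: "a > 0" "\<And>k::int. k \<noteq> 0 \<Longrightarrow> a / (1 + \<bar>of_int k\<bar>) \<le> \<bar>sin (pi * k * (w2 / w1))\<bar>"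
    by (rule sines_apart_ratio[OF assms(2) w1]) (rule that)
  obtain b where b: "b > 0" "\<And>k::int. k \<noteq> 0 \<Longrightarrow> b / (1 + \<bar>of_int k\<bar>) \<le> \<bar>sin (pi * k * (w3 / w1))\<bar>"
    by (rule sines_apart_ratio[OF assms(3) w1]) (rule that)
  obtain C where C: "C \<ge> 0" "\<And>x. norm (f x) \<le> C / (1 + \<bar>x\<bar>) ^ 4"
    by (rule rapid_decay_bound[OF f, where m = 4]) (rule that)
  define m where "m = min 1 (1 / w1)"
  have m: "m > 0" using w1 by (simp add: m_def)
  define E where "E = C / (4 * w1 * a * b * m ^ 4)"
  have bd: "norm (residue_coeff w1 w2 w3 k * f (of_int k / w1)) \<le> E / (1 + \<bar>real_of_int k\<bar>) ^ 2" if k: "k \<in> - {0}" for k :: int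
  proof -
    define K where "K = 1 + \<bar>real_of_int k\<bar>"
    have K: "K > 0" by (simp add: K_def)
    define p where "p = \<bar>sin (pi * k * (w2 / w1))\<bar>"
    define q where "q = \<bar>sin (pi * k * (w3 / w1))\<bar>"
    have pq: "a / K \<le> p" "b / K \<le> q" using a(2) b(2) k by (simp_all add: K_def p_def q_def)
    have "(a / K) * (b / K) \<le> p * q" using pq a b K by (intro mult_mono) (auto simp: p_def)
    then have le: "4 * w1 * ((a / K) * (b / K)) \<le> 4 * w1 * (p * q)" using w1 by (intro mult_left_mono) auto
    have lpos: "4 * w1 * ((a / K) * (b / K)) > 0" using w1 a b K by simp
    have "\<bar>residue_coeff w1 w2 w3 k\<bar> = 1 / (4 * w1 * (p * q))"
      using w1 by (simp add: residue_coeff_def abs_mult power_int_abs p_def q_def mult_ac)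
    also have "\<dots> \<le> 1 / (4 * w1 * ((a / K) * (b / K)))"
      by (rule divide_left_mono[OF le _ mult_pos_pos[OF less_le_trans[OF lpos le] lpos]]) simp
    finally have 1: "\<bar>residue_coeff w1 w2 w3 k\<bar> \<le> K ^ 2 / (4 * w1 * a * b)"
      by (simp add: power2_eq_square mult_ac)
    have "m * K \<le> 1 + \<bar>of_int k / w1\<bar>"
    proof -
      have "m * K = m * 1 + m * \<bar>real_of_int k\<bar>" by (simp add: K_def distrib_left)
      also have "\<dots> \<le> 1 * 1 + (1 / w1) * \<bar>real_of_int k\<bar>"
        using m by (intro add_mono mult_right_mono) (auto simp: m_def)
      finally show ?thesis using w1 by simp
    qed
    then have "(m * K) ^ 4 \<le> (1 + \<bar>of_int k / w1\<bar>) ^ 4" using m K by (intro power_mono) auto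
    then have "C / (1 + \<bar>of_int k / w1\<bar>) ^ 4 \<le> C / (m * K) ^ 4"
      using m K C by (intro divide_left_mono mult_pos_pos zero_less_power add_pos_nonneg) auto
    then have 2: "norm (f (of_int k / w1)) \<le> C / (m * K) ^ 4" using C(2)[of "of_int k / w1"] by linarith
    have "norm (residue_coeff w1 w2 w3 k * f (of_int k / w1)) \<le> K ^ 2 / (4 * w1 * a * b) * (C / (m * K) ^ 4)"
      unfolding norm_mult norm_of_real using 1 2 by (intro mult_mono) auto
    also have "\<dots> = E / K ^ 2"
    proof -
      have e: "(m * K) ^ 4 = m ^ 4 * (K\<^sup>2 * K\<^sup>2)" by (simp add: power_mult_distrib flip: power_add)
      have gen: "L / e * (C / (M * (L * L))) = C / (e * M) / L" if "L \<noteq> 0" for L e M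
        using that by (simp add: divide_simps)
      show ?thesis unfolding e E_def by (rule gen) (use K in simp)
    qed
    finally show ?thesis by (simp add: K_def)
  qed
  have "(\<lambda>k::int. E / (1 + \<bar>real_of_int k\<bar>) ^ 2) summable_on (- {0})"
    by (rule summable_on_subset_banach[OF summable_on_int_inverse_square]) auto
  from summable_on_bounded_by(1)[OF this bd] show ?thesis .
qed

definition residue_sum :: "real \<Rightarrow> real \<Rightarrow> real \<Rightarrow> (real \<Rightarrow> complex) \<Rightarrow> complex" where
  "residue_sum w1 w2 w3 f = (\<Sum>\<^sub>\<infinity>k\<in>- {0}. complex_of_real (residue_coeff w1 w2 w3 k) * f (of_int k / w1))"

lemma residue_sum_add:
  assumes "w1 > 0" "sines_apart w1 w2" "sines_apart w1 w3" "schwartz f" "schwartz g"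
  shows "residue_sum w1 w2 w3 (\<lambda>x. f x + g x) = residue_sum w1 w2 w3 f + residue_sum w1 w2 w3 g"
  unfolding residue_sum_def distrib_left using assms
  by (intro infsum_add; intro abs_summable_summable[OF residue_coeff_summable] schwartz_rapid)

text \<open>Kept for general frequencies so that its symmetry reduces the three products of two
  sines to a single one.\<close>

definition spectral_side :: "real \<Rightarrow> real \<Rightarrow> real \<Rightarrow> (real \<Rightarrow> complex) \<Rightarrow> complex" where
  "spectral_side w1 w2 w3 f = - (1 / (8 * pi\<^sup>2 * (w1 * w2 * w3))) * vderiv (vderiv f) 0
     - ((w1\<^sup>2 + w2\<^sup>2 + w3\<^sup>2) / (24 * (w1 * w2 * w3))) * f 0
     + (residue_sum w1 w2 w3 f + residue_sum w2 w1 w3 f + residue_sum w3 w1 w2 f)"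

lemma residue_sum_commute: "residue_sum w1 w3 w2 f = residue_sum w1 w2 w3 f"
  by (simp add: residue_sum_def residue_coeff_commute)

lemma spectral_side_swap12: "spectral_side w2 w1 w3 f = spectral_side w1 w2 w3 f"
  unfolding spectral_side_def using residue_sum_commute[of w3 w1 w2 f] by (simp add: mult_ac add_ac)

lemma spectral_side_swap13: "spectral_side w3 w2 w1 f = spectral_side w1 w2 w3 f"
  unfolding spectral_side_def
  using residue_sum_commute[of w3 w1 w2 f] residue_sum_commute[of w2 w1 w3 f] residue_sum_commute[of w1 w2 w3 f]
  by (simp add: mult_ac add_ac)

lemma vderiv_add: "schwartz f \<Longrightarrow> schwartz g \<Longrightarrow> vderiv (\<lambda>x. f x + g x) = (\<lambda>x. vderiv f x + vderiv g x)"
  by (intro vderiv_eqI has_vector_derivative_add schwartz_has_vderiv)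

lemma spectral_side_add:
  assumes "w1 > 0" "w2 > 0" "w3 > 0" "sines_apart w1 w2" "sines_apart w1 w3" "sines_apart w2 w3" "schwartz f" "schwartz g"
  shows "spectral_side w1 w2 w3 (\<lambda>x. f x + g x) = spectral_side w1 w2 w3 f + spectral_side w1 w2 w3 g"
proof -
  have 1: "vderiv (vderiv (\<lambda>x. f x + g x)) 0 = vderiv (vderiv f) 0 + vderiv (vderiv g) 0"
    using assms by (simp add: vderiv_add schwartz_vderiv)
  have 2: "residue_sum w1 w2 w3 (\<lambda>x. f x + g x) = residue_sum w1 w2 w3 f + residue_sum w1 w2 w3 g"
    "residue_sum w2 w1 w3 (\<lambda>x. f x + g x) = residue_sum w2 w1 w3 f + residue_sum w2 w1 w3 g"
    "residue_sum w3 w1 w2 (\<lambda>x. f x + g x) = residue_sum w3 w1 w2 f + residue_sum w3 w1 w2 g"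
    using assms by (intro residue_sum_add; auto intro: sines_apart_commute)+
  have "A * (x + y) - B * (u + v) + ((r + r') + (s + s') + (t + t'))
      = (A * x - B * u + (r + s + t)) + (A * y - B * v + (r' + s' + t'))" for A B x y u v r r' s s' t t' :: complex
    by (simp add: algebra_simps)
  then show ?thesis unfolding spectral_side_def 1 2 .
qed

lemma multiplier_vderiv: "multiplier f \<Longrightarrow> multiplier (vderiv f)"
  unfolding multiplier_def by (metis diff_class.simps(2))

lemma vderiv_mult:
  assumes "multiplier u" "schwartz v"
  shows "vderiv (\<lambda>x. u x * v x) = (\<lambda>x. u x * vderiv v x + vderiv u x * v x)"
  using assms by (intro vderiv_eqI has_vector_derivative_mult schwartz_has_vderiv multiplier_has_vderiv)

lemma vderiv2_mult:
  assumes u: "multiplier u" and v: "schwartz v"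
  shows "vderiv (vderiv (\<lambda>x. u x * v x)) x = u x * vderiv (vderiv v) x + 2 * vderiv u x * vderiv v x + vderiv (vderiv u) x * v x"
proof -
  have "vderiv (\<lambda>x. u x * vderiv v x + vderiv u x * v x)
     = (\<lambda>x. (u x * vderiv (vderiv v) x + vderiv u x * vderiv v x) + (vderiv u x * vderiv v x + vderiv (vderiv u) x * v x))"
    using u v by (intro vderiv_eqI has_vector_derivative_add has_vector_derivative_mult schwartz_has_vderiv
        multiplier_has_vderiv schwartz_vderiv multiplier_vderiv)
  then show ?thesis unfolding vderiv_mult[OF u v] by (simp add: algebra_simps)
qed

lemma vderiv_sin: "vderiv (\<lambda>t. of_real (sin (a * t))) = (\<lambda>t. of_real (a * cos (a * t)))"
proof (rule vderiv_eqI)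
  fix x :: real
  have "((\<lambda>z. sin (complex_of_real a * z)) has_field_derivative of_real a * cos (of_real a * of_real x)) (at (of_real x))"
    by (auto intro!: derivative_eq_intros)
  from has_vector_derivative_real_field[OF this]
  show "((\<lambda>t. complex_of_real (sin (a * t))) has_vector_derivative of_real (a * cos (a * x))) (at x)"
    by (simp only: of_real_mult[symmetric] sin_of_real cos_of_real)
qed

lemma sin_pi_int_ratio: "w > 0 \<Longrightarrow> sin (pi * w * (of_int k / w)) = 0"
  by (simp add: sin_int_times_real mult.commute)

lemma residue_sum_eq_0: "(\<And>k::int. k \<noteq> 0 \<Longrightarrow> f (of_int k / w1) = 0) \<Longrightarrow> residue_sum w1 w2 w3 f = 0"
  unfolding residue_sum_def by (rule infsum_0) auto

text \<open>The sines in \<open>f\<close> kill the families of w2 and w3. Poisson summation gives a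
  sum over all k, the residue sum omits k = 0; the missing term -g(0)/(4 w1) is exactly the
  \<delta>'' term, because f''(0) = 2 pi^2 w2 w3 g(0).\<close>

lemma formula_two_sines:
  assumes w: "w1 > 0" "w2 > 0" "w3 > 0" and a: "sines_apart w1 w2" "sines_apart w1 w3"
    and g: "schwartz g" and f: "f = (\<lambda>t. of_real (sin (pi * w3 * t)) * (of_real (sin (pi * w2 * t)) * g t))"
  shows "lattice_pairing w1 w2 w3 (fourier f) = spectral_side w1 w2 w3 f"
proof -
  have z2: "residue_sum w2 w1 w3 f = 0" by (rule residue_sum_eq_0) (simp add: f sin_pi_int_ratio[OF w(2)] del: times_divide_eq_right)
  have z3: "residue_sum w3 w1 w2 f = 0" by (rule residue_sum_eq_0) (simp add: f sin_pi_int_ratio[OF w(3)] del: times_divide_eq_right)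
  have nz: "sin (pi * k * (v / w1)) \<noteq> 0" if v: "sines_apart w1 v" and k: "k \<noteq> 0" for v :: real and k :: int
  proof -
    obtain c where "c > 0" "\<And>k::int. k \<noteq> 0 \<Longrightarrow> c / (1 + \<bar>of_int k\<bar>) \<le> \<bar>sin (pi * k * (v / w1))\<bar>"
      by (rule sines_apart_ratio[OF v w(1)]) (rule that)
    from this(2)[OF k] \<open>c > 0\<close> show ?thesis by (smt (verit) divide_pos_pos)
  qed
  define G where "G = (\<lambda>k::int. (- 1) powi k * g (of_int k / w1))"
  have Gs: "G summable_on UNIV"
  proof -
    have "(\<lambda>k::int. norm (g ((1 / w1) * of_int k))) summable_on UNIV"
      using rapid_decay_summable_int(1)[OF schwartz_rapid[OF schwartz_scale[OF g, of "1 / w1"]]] w by simp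
    then show ?thesis by (rule summable_on_bounded_by(2)) (simp add: G_def norm_mult norm_power_int)
  qed
  have "residue_sum w1 w2 w3 f = (\<Sum>\<^sub>\<infinity>k\<in>- {0}. - (1 / (4 * w1)) * G k)"
    unfolding residue_sum_def
  proof (rule infsum_cong)
    fix k :: int assume k: "k \<in> - {0}"
    have 1: "sin (pi * w2 * (of_int k / w1)) = sin (pi * k * (w2 / w1))" "sin (pi * w3 * (of_int k / w1)) = sin (pi * k * (w3 / w1))"
      by (simp_all add: mult_ac)
    have 2: "sin (pi * k * (w2 / w1)) \<noteq> 0" "sin (pi * k * (w3 / w1)) \<noteq> 0" using nz a k by auto
    have "complex_of_real ((- 1) powi (k + 1)) = - ((- 1) powi k)"
      by (simp add: power_int_add of_real_power_int)
    then show "residue_coeff w1 w2 w3 k * f (of_int k / w1) = - (1 / (4 * w1)) * G k"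
      unfolding f 1 residue_coeff_def G_def of_real_divide of_real_mult using 2 w by (simp add: field_simps)
  qed
  also have "\<dots> = - (1 / (4 * w1)) * infsum G (- {0})" by (rule infsum_cmult_right')
  also have "infsum G (- {0}) = infsum G UNIV - g 0"
  proof -
    have "infsum G (UNIV - {0}) = infsum G UNIV - infsum G {0}" by (intro infsum_Diff Gs) auto
    then show ?thesis by (simp add: G_def Compl_eq_Diff_UNIV)
  qed
  finally have 1: "residue_sum w1 w2 w3 f = - (1 / (4 * w1)) * infsum G UNIV + g 0 / (4 * w1)" by (simp add: diff_divide_distrib)
  define h where "h = (\<lambda>t. of_real (sin (pi * w2 * t)) * g t)"
  have h: "schwartz h" unfolding h_def by (rule schwartz_sin_mult[OF g])
  have fh: "f = (\<lambda>t. of_real (sin (pi * w3 * t)) * h t)" by (simp add: f h_def)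
  have h': "vderiv h 0 = pi * w2 * g 0" unfolding h_def vderiv_mult[OF multiplier_sin g] vderiv_sin by simp
  have f'': "vderiv (vderiv f) 0 = 2 * (pi * w3) * (pi * w2 * g 0)"
    unfolding fh vderiv2_mult[OF multiplier_sin h] vderiv_sin using h' by (simp add: h_def)
  have f0: "f 0 = 0" by (simp add: f)
  have "spectral_side w1 w2 w3 f = - (1 / (4 * w1)) * infsum G UNIV"
    unfolding spectral_side_def f'' f0 z2 z3 1 using w by (simp add: field_simps power2_eq_square)
  then show ?thesis unfolding lattice_pairing_two_sines[OF w g f] G_def by simp
qed

lemma sincw_int_ratio: "w > 0 \<Longrightarrow> k \<noteq> 0 \<Longrightarrow> sincw w (of_int k / w) = 0"
  using sin_eq_sincw[of w "of_int k / w"] sin_pi_int_ratio[of w k] by simp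

text \<open>All residue terms vanish. At 0, with P the product and Q the sum of squares of the
  frequencies, f''(0) = P g''(0) - (pi^2/3) P Q g(0) and f(0) = P g(0); the coefficient Q/(24 P) of
  \<delta> is the one that cancels g(0).\<close>

lemma formula_sincs:
  assumes w: "w1 > 0" "w2 > 0" "w3 > 0" and g: "schwartz g"
    and f: "f = (\<lambda>t. sincw w3 t * (sincw w2 t * (sincw w1 t * g t)))"
  shows "lattice_pairing w1 w2 w3 (fourier f) = spectral_side w1 w2 w3 f"
proof -
  have z: "residue_sum w1 w2 w3 f = 0" "residue_sum w2 w1 w3 f = 0" "residue_sum w3 w1 w2 f = 0"
    using w by (auto intro!: residue_sum_eq_0 simp: f sincw_int_ratio)
  have step: "vderiv (vderiv (\<lambda>t. sincw v t * h t)) 0 = v * vderiv (vderiv h) 0 - pi\<^sup>2 * v ^ 3 / 3 * h 0"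
    if "v > 0" "schwartz h" for v :: real and h :: "real \<Rightarrow> complex"
    using that sincw_vderiv_0[of v] by (subst vderiv2_mult[OF multiplier_sincw]) (auto simp: sincw_0)
  have 1: "schwartz (\<lambda>t. sincw w1 t * g t)" "schwartz (\<lambda>t. sincw w2 t * (sincw w1 t * g t))"
    by (intro schwartz_sincw_mult g)+
  have f'': "vderiv (vderiv f) 0 = w3 * (w2 * (w1 * vderiv (vderiv g) 0 - pi\<^sup>2 * w1 ^ 3 / 3 * g 0) - pi\<^sup>2 * w2 ^ 3 / 3 * (w1 * g 0))
       - pi\<^sup>2 * w3 ^ 3 / 3 * (w2 * (w1 * g 0))"
    unfolding f step[OF w(3) 1(2)] step[OF w(2) 1(1)] step[OF w(1) g] using w by (simp add: sincw_0)
  have f0: "f 0 = w3 * (w2 * (w1 * g 0))" using w by (simp add: f sincw_0)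
  have "spectral_side w1 w2 w3 f = - (1 / (8 * pi\<^sup>2)) * vderiv (vderiv g) 0"
    unfolding spectral_side_def z f'' f0 using w by (simp add: field_simps power2_eq_square power3_eq_cube)
  then show ?thesis unfolding lattice_pairing_sincs[OF w g f] by simp
qed

lemma sincw_of_real:
  assumes "w \<ge> 0" obtains r where "sincw w t = of_real r" "w * \<bar>t\<bar> \<le> 1/2 \<Longrightarrow> 2 * w / pi \<le> \<bar>r\<bar>"
proof (cases "t = 0")
  case True
  have "2 * w / pi \<le> w" using assms pi_gt3 by (simp add: divide_le_eq mult.commute[of 2 w] mult_left_mono)
  then show thesis using that[of w] sincw_0[OF assms] True assms by simp
next
  case False
  define r where "r = sin (pi * w * t) / (pi * t)"
  have "sincw w t = of_real r" using sin_eq_sincw[OF assms, of t] False by (simp add: r_def field_simps)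
  moreover have "2 * w / pi \<le> \<bar>r\<bar>" if "w * \<bar>t\<bar> \<le> 1/2"
  proof -
    have "2 * \<bar>w * t\<bar> \<le> \<bar>sin (pi * (w * t))\<bar>" using that assms by (intro two_abs_le_abs_sin_pi) (simp add: abs_mult)
    then have "2 * w * \<bar>t\<bar> / (pi * \<bar>t\<bar>) \<le> \<bar>sin (pi * w * t)\<bar> / (pi * \<bar>t\<bar>)"
      using assms by (intro divide_right_mono) (auto simp: abs_mult mult.assoc)
    then show ?thesis using False by (simp add: r_def abs_mult)
  qed
  ultimately show thesis using that by blast
qed

definition denom :: "real \<Rightarrow> real \<Rightarrow> real \<Rightarrow> real \<Rightarrow> complex" where
  "denom w1 w2 w3 t = (sincw w3 t * (sincw w2 t * sincw w1 t)) * (sincw w3 t * (sincw w2 t * sincw w1 t))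
    + of_real (sin (pi * w3 * t)) * of_real (sin (pi * w2 * t)) * (of_real (sin (pi * w3 * t)) * of_real (sin (pi * w2 * t)))
    + of_real (sin (pi * w3 * t)) * of_real (sin (pi * w1 * t)) * (of_real (sin (pi * w3 * t)) * of_real (sin (pi * w1 * t)))
    + of_real (sin (pi * w1 * t)) * of_real (sin (pi * w2 * t)) * (of_real (sin (pi * w1 * t)) * of_real (sin (pi * w2 * t)))"

lemma multiplier_denom: "multiplier (denom w1 w2 w3)"
proof -
  have S: "multiplier (\<lambda>t. complex_of_real (sin (pi * v * t)))" for v by (rule multiplier_sin)
  have SS: "multiplier (\<lambda>t. complex_of_real (sin (pi * u * t)) * complex_of_real (sin (pi * v * t)))" for u v
    by (rule multiplier_mult[OF S S])
  have C: "multiplier (\<lambda>t. sincw w3 t * (sincw w2 t * sincw w1 t))"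
    by (rule multiplier_mult[OF multiplier_sincw multiplier_mult[OF multiplier_sincw multiplier_sincw]])
  show ?thesis unfolding denom_def[abs_def]
    by (rule multiplier_add[OF multiplier_add[OF multiplier_add[OF multiplier_mult[OF C C]
          multiplier_mult[OF SS SS]] multiplier_mult[OF SS SS]] multiplier_mult[OF SS SS]])
qed

text \<open>Near 0 the square of the product of sine quotients is bounded below. Elsewhere no two
  sines are both below \<eta>, of order 1/(1 + \<bar>t\<bar>), so some product of two is at least
  \<eta>^2; squaring it produces the exponent 4.\<close>

lemma denom_lower_bound:
  assumes w: "w1 > 0" "w2 > 0" "w3 > 0" and a: "sines_apart w1 w2" "sines_apart w1 w3" "sines_apart w2 w3"
  obtains c where "c > 0" "\<And>t. c \<le> norm (denom w1 w2 w3 t) * (1 + \<bar>t\<bar>) ^ 4"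
proof -
  obtain c12 where c12: "c12 > 0" "\<And>t. c12 * min \<bar>t\<bar> (1 / (1 + \<bar>t\<bar>)) \<le> \<bar>sin (pi * w1 * t)\<bar> + \<bar>sin (pi * w2 * t)\<bar>"
    using a(1) unfolding sines_apart_def by blast
  obtain c13 where c13: "c13 > 0" "\<And>t. c13 * min \<bar>t\<bar> (1 / (1 + \<bar>t\<bar>)) \<le> \<bar>sin (pi * w1 * t)\<bar> + \<bar>sin (pi * w3 * t)\<bar>"
    using a(2) unfolding sines_apart_def by blast
  obtain c23 where c23: "c23 > 0" "\<And>t. c23 * min \<bar>t\<bar> (1 / (1 + \<bar>t\<bar>)) \<le> \<bar>sin (pi * w2 * t)\<bar> + \<bar>sin (pi * w3 * t)\<bar>"
    using a(3) unfolding sines_apart_def by blast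
  define c where "c = min c12 (min c13 c23)"
  have c: "c > 0" "c \<le> c12" "c \<le> c13" "c \<le> c23" using c12 c13 c23 by (auto simp: c_def)
  \<comment> \<open>Chosen so that w_j \<bar>t\<bar> \<le> 1/2 for all three frequencies whenever
    \<bar>t\<bar> \<le> \<delta>, the range of Jordan's inequality.\<close>
  define \<delta> where "\<delta> = 1 / (2 * (w1 + w2 + w3))"
  have \<delta>: "\<delta> > 0" using w by (simp add: \<delta>_def)
  \<comment> \<open>For \<bar>t\<bar> > \<delta> this gives \<epsilon>/(1 + \<bar>t\<bar>) as a
    lower bound of the minimum in \<open>sines_apart\<close>.\<close>
  define \<epsilon> where "\<epsilon> = min \<delta> 1"
  have \<epsilon>: "\<epsilon> > 0" "\<epsilon> \<le> \<delta>" "\<epsilon> \<le> 1" using \<delta> by (auto simp: \<epsilon>_def)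
  define e where "e = (2 * w3 / pi) * ((2 * w2 / pi) * (2 * w1 / pi))"
  have e: "e > 0" using w by (simp add: e_def)
  define E where "E = min (e\<^sup>2) ((c / 2 * \<epsilon>) ^ 4)"
  have "E > 0" using c \<epsilon> e by (simp add: E_def)
  moreover have "E \<le> norm (denom w1 w2 w3 t) * (1 + \<bar>t\<bar>) ^ 4" for t
  proof -
    define s1 s2 s3 where "s1 = sin (pi * w1 * t)" and "s2 = sin (pi * w2 * t)" and "s3 = sin (pi * w3 * t)"
    obtain r1 where r1: "sincw w1 t = of_real r1" "w1 * \<bar>t\<bar> \<le> 1/2 \<Longrightarrow> 2 * w1 / pi \<le> \<bar>r1\<bar>"
      using sincw_of_real[of w1 t] w by auto
    obtain r2 where r2: "sincw w2 t = of_real r2" "w2 * \<bar>t\<bar> \<le> 1/2 \<Longrightarrow> 2 * w2 / pi \<le> \<bar>r2\<bar>"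
      using sincw_of_real[of w2 t] w by auto
    obtain r3 where r3: "sincw w3 t = of_real r3" "w3 * \<bar>t\<bar> \<le> 1/2 \<Longrightarrow> 2 * w3 / pi \<le> \<bar>r3\<bar>"
      using sincw_of_real[of w3 t] w by auto
    define D where "D = (r3 * (r2 * r1))\<^sup>2 + (s3 * s2)\<^sup>2 + (s3 * s1)\<^sup>2 + (s1 * s2)\<^sup>2"
    have "denom w1 w2 w3 t = of_real D"
      by (simp add: denom_def r1(1) r2(1) r3(1) s1_def s2_def s3_def D_def power2_eq_square)
    moreover have "D \<ge> 0" unfolding D_def by (intro add_nonneg_nonneg) auto
    ultimately have nD: "norm (denom w1 w2 w3 t) = D" by simp
    have D: "(r3 * (r2 * r1))\<^sup>2 \<le> D" "(s3 * s2)\<^sup>2 \<le> D" "(s3 * s1)\<^sup>2 \<le> D" "(s1 * s2)\<^sup>2 \<le> D"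
      by (simp_all add: D_def)
    show ?thesis
    proof (cases "\<bar>t\<bar> \<le> \<delta>")
      case True
      have "w * \<bar>t\<bar> \<le> 1/2" if "w \<in> {w1, w2, w3}" for w
      proof -
        have "w * \<bar>t\<bar> \<le> (w1 + w2 + w3) * \<delta>" using True that w by (intro mult_mono) auto
        also have "\<dots> = 1/2" using w by (simp add: \<delta>_def)
        finally show ?thesis .
      qed
      then have "e \<le> \<bar>r3\<bar> * (\<bar>r2\<bar> * \<bar>r1\<bar>)"
        unfolding e_def using w by (intro mult_mono r1(2) r2(2) r3(2)) auto
      then have "e\<^sup>2 \<le> (\<bar>r3\<bar> * (\<bar>r2\<bar> * \<bar>r1\<bar>))\<^sup>2" using e by (intro power_mono) auto
      also have "\<dots> = (r3 * (r2 * r1))\<^sup>2" by (simp add: power_mult_distrib)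
      also have "\<dots> \<le> D * 1" using D by simp
      also have "\<dots> \<le> D * (1 + \<bar>t\<bar>) ^ 4" using \<open>D \<ge> 0\<close> by (intro mult_left_mono one_le_power) auto
      finally show ?thesis unfolding nD E_def by simp
    next
      case False
      define T where "T = 1 + \<bar>t\<bar>"
      have T: "T \<ge> 1" by (simp add: T_def)
      define \<eta> where "\<eta> = c / 2 * \<epsilon> / T"
      have \<eta>: "\<eta> > 0" using c \<epsilon> T by (simp add: \<eta>_def)
      have "\<epsilon> / T \<le> min \<bar>t\<bar> (1 / (1 + \<bar>t\<bar>))"
      proof (rule min.boundedI)
        have "\<epsilon> / T \<le> \<epsilon>" using \<epsilon> T by (simp add: divide_le_eq mult_le_cancel_left1)
        then show "\<epsilon> / T \<le> \<bar>t\<bar>" using \<epsilon> False by linarith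
        show "\<epsilon> / T \<le> 1 / (1 + \<bar>t\<bar>)" unfolding T_def using \<epsilon> by (intro divide_right_mono) auto
      qed
      then have "c' * min \<bar>t\<bar> (1 / (1 + \<bar>t\<bar>)) \<ge> 2 * \<eta>" if "c \<le> c'" for c'
        using mult_mono[OF that, of "\<epsilon> / T" "min \<bar>t\<bar> (1 / (1 + \<bar>t\<bar>))"] c \<epsilon> T that by (simp add: \<eta>_def)
      from this[OF c(2)] this[OF c(3)] this[OF c(4)]
      have s: "2 * \<eta> \<le> \<bar>s1\<bar> + \<bar>s2\<bar>" "2 * \<eta> \<le> \<bar>s1\<bar> + \<bar>s3\<bar>" "2 * \<eta> \<le> \<bar>s2\<bar> + \<bar>s3\<bar>"
        using c12(2)[of t] c13(2)[of t] c23(2)[of t] unfolding s1_def s2_def s3_def by linarith+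
      have sq: "\<eta> ^ 4 \<le> (x * y)\<^sup>2" if "\<eta> \<le> \<bar>x\<bar>" "\<eta> \<le> \<bar>y\<bar>" for x y
      proof -
        have "\<eta>\<^sup>2 * \<eta>\<^sup>2 \<le> \<bar>x\<bar>\<^sup>2 * \<bar>y\<bar>\<^sup>2" using that \<eta> by (intro mult_mono power_mono) auto
        then show ?thesis by (simp add: power_mult_distrib flip: power_add)
      qed
      have "\<eta> ^ 4 \<le> D"
      proof (cases "\<eta> \<le> \<bar>s1\<bar>")
        case True
        then have "\<eta> \<le> \<bar>s2\<bar> \<or> \<eta> \<le> \<bar>s3\<bar>" using s by linarith
        then show ?thesis using order_trans[OF sq[of s1 s2] D(4)] order_trans[OF sq[of s3 s1] D(3)] True by blast
      next
        case False
        then have "\<eta> \<le> \<bar>s2\<bar>" "\<eta> \<le> \<bar>s3\<bar>" using s by linarith+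
        then show ?thesis using order_trans[OF sq[of s3 s2] D(2)] by blast
      qed
      then have "\<eta> ^ 4 * T ^ 4 \<le> D * T ^ 4" using T by (intro mult_right_mono) auto
      also have "\<eta> ^ 4 * T ^ 4 = (c / 2 * \<epsilon>) ^ 4" using T by (simp add: \<eta>_def power_divide)
      finally show ?thesis unfolding nD E_def T_def by simp
    qed
  qed
  ultimately show thesis using that by blast
qed

lemma lattice_pairing_add:
  assumes w: "w1 > 0" "w2 > 0" "w3 > 0" and f: "schwartz f" and g: "schwartz g"
  shows "lattice_pairing w1 w2 w3 (fourier (\<lambda>x. f x + g x)) = lattice_pairing w1 w2 w3 (fourier f) + lattice_pairing w1 w2 w3 (fourier g)"
proof -
  have a: "(w1 + w2 + w3) / 2 \<ge> 0" using w by simp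
  have "fourier (\<lambda>x. f x + g x) = (\<lambda>t. fourier f t + fourier g t)"
    using f g by (intro ext fourier_add schwartz_integrable)
  then show ?thesis unfolding lattice_pairing_def
    using rapid_decay_summable_lat[OF w a fourier_rapid[OF f]] rapid_decay_summable_lat[OF w a fourier_rapid[OF g]]
    by (simp add: infsum_add)
qed

theorem lattice_fourier_formula:
  assumes w: "w1 > 0" "w2 > 0" "w3 > 0" and a: "sines_apart w1 w2" "sines_apart w1 w3" "sines_apart w2 w3"
    and f: "schwartz f"
  shows "lattice_pairing w1 w2 w3 (fourier f) = spectral_side w1 w2 w3 f"
proof -
  define D where "D = denom w1 w2 w3"
  obtain c where c: "c > 0" "\<And>t. c \<le> norm (D t) * (1 + \<bar>t\<bar>) ^ 4"
    using denom_lower_bound[OF w a] unfolding D_def by blast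
  have nz: "D t \<noteq> 0" for t using c(2)[of t] c(1) by auto
  have inv: "multiplier (\<lambda>t. inverse (D t))"
    using c by (intro multiplier_inverse) (auto simp: D_def multiplier_denom)
  define S where "S = (\<lambda>w t. complex_of_real (sin (pi * w * t)))"
  define q0 where "q0 = (\<lambda>t. sincw w3 t * (sincw w2 t * sincw w1 t))"
  have mS: "multiplier (S v)" for v unfolding S_def by (rule multiplier_sin)
  have q0: "multiplier q0" unfolding q0_def by (intro multiplier_mult multiplier_sincw)
  \<comment> \<open>The quotient \<open>f q / D\<close>; multiplying it by \<open>q\<close> again
    and adding over the four \<open>q\<close> restores \<open>f\<close>.\<close>
  define G where "G = (\<lambda>q t. f t * (q t * inverse (D t)))"
  have G: "schwartz (G q)" if "multiplier q" for q
    unfolding G_def by (intro schwartz_times_multiplier f multiplier_mult that inv)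
  define g0 g1 g2 g3 where "g0 = G q0" and "g1 = G (\<lambda>t. S w3 t * S w2 t)"
    and "g2 = G (\<lambda>t. S w3 t * S w1 t)" and "g3 = G (\<lambda>t. S w1 t * S w2 t)"
  have g: "schwartz g0" "schwartz g1" "schwartz g2" "schwartz g3"
    unfolding g0_def g1_def g2_def g3_def by (intro G multiplier_mult q0 mS)+
  define f0 where "f0 = (\<lambda>t. sincw w3 t * (sincw w2 t * (sincw w1 t * g0 t)))"
  define f1 where "f1 = (\<lambda>t. of_real (sin (pi * w3 * t)) * (of_real (sin (pi * w2 * t)) * g1 t))"
  define f2 where "f2 = (\<lambda>t. of_real (sin (pi * w3 * t)) * (of_real (sin (pi * w1 * t)) * g2 t))"
  define f3 where "f3 = (\<lambda>t. of_real (sin (pi * w1 * t)) * (of_real (sin (pi * w2 * t)) * g3 t))"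
  have fs: "schwartz f0" "schwartz f1" "schwartz f2" "schwartz f3"
    unfolding f0_def f1_def f2_def f3_def by (intro schwartz_sincw_mult schwartz_sin_mult g)+
  have split: "f = (\<lambda>t. f0 t + (f1 t + (f2 t + f3 t)))"
  proof
    fix t
    have gen: "A3 * (A2 * (A1 * (x * (A3 * (A2 * A1) * I)))) + (s3 * (s2 * (x * (s3 * s2 * I)))
        + (s3 * (s1 * (x * (s3 * s1 * I))) + s1 * (s2 * (x * (s1 * s2 * I)))))
      = x * I * (A3 * (A2 * A1) * (A3 * (A2 * A1)) + s3 * s2 * (s3 * s2) + s3 * s1 * (s3 * s1) + s1 * s2 * (s1 * s2))"
      for A1 A2 A3 s1 s2 s3 x I :: complex by (simp add: algebra_simps)
    have "f0 t + (f1 t + (f2 t + f3 t)) = f t * inverse (D t) * D t"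
      unfolding f0_def f1_def f2_def f3_def g0_def g1_def g2_def g3_def G_def S_def q0_def
      by (rule trans[OF gen]) (simp only: D_def denom_def)
    then show "f t = f0 t + (f1 t + (f2 t + f3 t))" using nz[of t] by simp
  qed
  have e0: "lattice_pairing w1 w2 w3 (fourier f0) = spectral_side w1 w2 w3 f0"
    by (rule formula_sincs[OF w g(1) f0_def])
  have e1: "lattice_pairing w1 w2 w3 (fourier f1) = spectral_side w1 w2 w3 f1"
    by (rule formula_two_sines[OF w a(1,2) g(2) f1_def])
  have e2: "lattice_pairing w1 w2 w3 (fourier f2) = spectral_side w1 w2 w3 f2"
    using lattice_pairing_swap12[of w1 w2 w3 "fourier f2"] spectral_side_swap12[of w2 w1 w3 f2]
    by (simp only: formula_two_sines[OF w(2,1,3) sines_apart_commute[OF a(1)] a(3) g(3) f2_def])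
  have e3: "lattice_pairing w1 w2 w3 (fourier f3) = spectral_side w1 w2 w3 f3"
    using lattice_pairing_swap13[of w1 w2 w3 "fourier f3"] spectral_side_swap13[of w3 w2 w1 f3]
    by (simp only: formula_two_sines[OF w(3,2,1) sines_apart_commute[OF a(3)] sines_apart_commute[OF a(2)] g(4) f3_def])
  have s3: "schwartz (\<lambda>t. f2 t + f3 t)" by (intro schwartz_add fs)
  have s2: "schwartz (\<lambda>t. f1 t + (f2 t + f3 t))" by (intro schwartz_add fs)
  have "lattice_pairing w1 w2 w3 (fourier (\<lambda>t. f0 t + (f1 t + (f2 t + f3 t))))
      = spectral_side w1 w2 w3 (\<lambda>t. f0 t + (f1 t + (f2 t + f3 t)))"
    unfolding lattice_pairing_add[OF w fs(1) s2] lattice_pairing_add[OF w fs(2) s3] lattice_pairing_add[OF w fs(3,4)]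
      spectral_side_add[OF w a fs(1) s2] spectral_side_add[OF w a fs(2) s3] spectral_side_add[OF w a fs(3,4)]
    by (simp only: e0 e1 e2 e3)
  then show ?thesis unfolding split[symmetric] .
qed

subsection \<open>Bump functions and the support\<close>

text \<open>The polynomial factor and the power \<open>k\<close> make this family closed under differentiation.\<close>

definition bump :: "real \<Rightarrow> real \<Rightarrow> real poly \<Rightarrow> nat \<Rightarrow> real \<Rightarrow> real" where
  "bump c r p k x = (if \<bar>x - c\<bar> < r
     then poly p x * inverse (r\<^sup>2 - (x - c)\<^sup>2) ^ k * exp (- inverse (r\<^sup>2 - (x - c)\<^sup>2)) else 0)"

lemma bump_gap_pos: "\<bar>y\<bar> < r \<Longrightarrow> r\<^sup>2 - y\<^sup>2 > (0::real)"
  by (metis abs_ge_zero diff_gt_0_iff_gt power2_abs power_strict_mono zero_less_numeral)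

text \<open>A single term of the exponential series, of order k + 2, dominates. The two extra powers
  yield d^2, which makes a bump vanish to second order at the edge of its support.\<close>

lemma inverse_power_exp_bound:
  fixes d :: real assumes d: "d > 0"
  shows "inverse d ^ k * exp (- inverse d) \<le> fact (k + 2) * d\<^sup>2"
proof -
  define u where "u = inverse d"
  have u: "u > 0" using d by (simp add: u_def)
  have "u ^ (k + 2) / fact (k + 2) \<le> exp u"
  proof -
    have e: "exp u = (\<Sum>n. inverse (fact n) * u ^ n)" by (simp add: exp_def)
    have "(\<Sum>n\<in>{k + 2}. inverse (fact n) * u ^ n) \<le> exp u"
      unfolding e using u summable_exp[of u] by (intro sum_le_suminf) auto
    moreover have "(\<Sum>n\<in>{k + 2}. inverse (fact n) * u ^ n) = u ^ (k + 2) / fact (k + 2)"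
      by (simp only: sum.insert sum.empty finite.emptyI empty_iff not_False_eq_True add_0_right divide_inverse mult.commute)
    ultimately show ?thesis by (simp only:)
  qed
  then have "u ^ (k + 2) \<le> fact (k + 2) * exp u" by (simp add: divide_le_eq mult.commute)
  then have "u ^ k * u\<^sup>2 * exp (- u) \<le> fact (k + 2) * exp u * exp (- u)"
    by (intro mult_right_mono) (simp_all only: power_add[symmetric] exp_ge_zero)
  also have "\<dots> = fact (k + 2)" by (simp add: exp_minus)
  finally have le: "u ^ k * u\<^sup>2 * exp (- u) * d\<^sup>2 \<le> fact (k + 2) * d\<^sup>2"
    by (rule mult_right_mono) simp
  have "u\<^sup>2 * d\<^sup>2 = 1" using d by (simp add: u_def power_mult_distrib[symmetric])
  moreover have "u ^ k * u\<^sup>2 * exp (- u) * d\<^sup>2 = u ^ k * exp (- u) * (u\<^sup>2 * d\<^sup>2)"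
    by (simp only: mult_ac)
  ultimately have "u ^ k * u\<^sup>2 * exp (- u) * d\<^sup>2 = u ^ k * exp (- u)" by (simp only: mult_1_right)
  with le show ?thesis unfolding u_def[symmetric] by (simp only:)
qed

text \<open>The coefficient list is the gap r^2 - (x - c)^2 as a polynomial in x; it appears when
  all terms are brought to the power k + 2 of the reciprocal gap. Inside the support the usual rules
  apply, outside the function is locally 0, and at the edge it is O((y - x)^2), so its derivative
  there is 0.\<close>

lemma bump_has_derivative:
  assumes r: "r > 0"
  shows "(bump c r p k has_real_derivative
     bump c r (pderiv p * [:r\<^sup>2 - c\<^sup>2, 2 * c, - 1:] ^ 2 + smult (2 * real k) ([:- c, 1:] * p * [:r\<^sup>2 - c\<^sup>2, 2 * c, - 1:])
        - smult 2 ([:- c, 1:] * p)) (k + 2) x) (at x)"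
    (is "(_ has_real_derivative bump c r ?q _ x) _")
proof -
  define d where "d = (\<lambda>x. r\<^sup>2 - (x - c)\<^sup>2)"
  have pd: "poly [:r\<^sup>2 - c\<^sup>2, 2 * c, - 1:] x = d x" for x
    by (simp add: d_def power2_eq_square algebra_simps)
  consider "\<bar>x - c\<bar> < r" | "\<bar>x - c\<bar> > r" | "\<bar>x - c\<bar> = r" by linarith
  then show ?thesis
  proof cases
    case 1
    define g where "g = (\<lambda>x. poly p x * inverse (d x) ^ k * exp (- inverse (d x)))"
    have d0: "d x > 0" unfolding d_def using 1 by (rule bump_gap_pos)
    have dd: "(d has_real_derivative - 2 * (x - c)) (at x)"
      unfolding d_def by (auto intro!: derivative_eq_intros)
    define i where "i = inverse (d x)"
    have di: "((\<lambda>x. inverse (d x)) has_real_derivative 2 * (x - c) * i\<^sup>2) (at x)"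
      using DERIV_inverse'[OF dd] d0 by (simp add: i_def power2_eq_square algebra_simps)
    have dk: "((\<lambda>x. inverse (d x) ^ k) has_real_derivative real k * i ^ (k - 1) * (2 * (x - c) * i\<^sup>2)) (at x)"
      using DERIV_power[OF di, of k] by (simp add: i_def mult_ac)
    have de: "((\<lambda>x. exp (- inverse (d x))) has_real_derivative exp (- i) * - (2 * (x - c) * i\<^sup>2)) (at x)"
      using DERIV_fun_exp[OF DERIV_minus[OF di]] by (simp add: i_def)
    have "(g has_real_derivative
        ((poly (pderiv p) x * i ^ k + real k * i ^ (k - 1) * (2 * (x - c) * i\<^sup>2) * poly p x) * exp (- i)
        + exp (- i) * - (2 * (x - c) * i\<^sup>2) * (poly p x * i ^ k))) (at x)"
      unfolding g_def using DERIV_mult[OF DERIV_mult[OF poly_DERIV[of p x] dk] de] by (simp add: i_def)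
    also have "(poly (pderiv p) x * i ^ k + real k * i ^ (k - 1) * (2 * (x - c) * i\<^sup>2) * poly p x) * exp (- i)
        + exp (- i) * - (2 * (x - c) * i\<^sup>2) * (poly p x * i ^ k)
        = bump c r ?q (k + 2) x"
    proof -
      have id: "i * d x = 1" using d0 by (simp add: i_def)
      have k1: "real k * i ^ (k - 1) * i\<^sup>2 = real k * (i ^ (k + 2) * d x)"
      proof (cases k)
        case (Suc m)
        have "i ^ (k + 2) * d x = i ^ m * i\<^sup>2 * (i * d x)" by (simp add: Suc power2_eq_square)
        then show ?thesis by (simp add: id Suc power2_eq_square)
      qed simp
      have k0: "i ^ k = i ^ (k + 2) * (d x)\<^sup>2"
      proof -
        have "i ^ (k + 2) * (d x)\<^sup>2 = i ^ k * (i * d x)\<^sup>2" by (simp add: power_mult_distrib power_add power2_eq_square)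
        then show ?thesis by (simp add: id)
      qed
      have k2: "i\<^sup>2 * i ^ k = i ^ (k + 2)" by (simp add: power2_eq_square)
      have "bump c r ?q (k + 2) x = (poly (pderiv p) x * (d x)\<^sup>2 + 2 * real k * ((x - c) * poly p x * d x) - 2 * ((x - c) * poly p x)) * i ^ (k + 2) * exp (- i)"
      proof -
        have "poly [:- c, 1:] x = x - c" by simp
        then have "poly ?q x = poly (pderiv p) x * (d x)\<^sup>2 + 2 * real k * ((x - c) * poly p x * d x) - 2 * ((x - c) * poly p x)"
          by (simp only: poly_add poly_diff poly_mult poly_smult poly_power pd)
        moreover have "bump c r ?q (k + 2) x = poly ?q x * i ^ (k + 2) * exp (- i)"
          using 1 unfolding bump_def i_def d_def by (simp only: if_True)
        ultimately show ?thesis by (simp only:)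
      qed
      also have "\<dots> = (poly (pderiv p) x * (i ^ (k + 2) * (d x)\<^sup>2) + (real k * (i ^ (k + 2) * d x)) * (2 * (x - c)) * poly p x) * exp (- i)
         - exp (- i) * (2 * (x - c)) * (poly p x * i ^ (k + 2))" by (simp add: algebra_simps)
      also have "\<dots> = (poly (pderiv p) x * i ^ k + real k * i ^ (k - 1) * (2 * (x - c) * i\<^sup>2) * poly p x) * exp (- i)
        + exp (- i) * - (2 * (x - c) * i\<^sup>2) * (poly p x * i ^ k)"
        unfolding k0[symmetric] k1[symmetric] unfolding k2[symmetric] by (simp add: mult_ac)
      finally show ?thesis by simp
    qed
    finally have "(g has_real_derivative bump c r ?q (k + 2) x) (at x)" .
    moreover have "eventually (\<lambda>y. g y = bump c r p k y) (nhds x)"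
    proof -
      have "eventually (\<lambda>y. y \<in> {c - r<..<c + r}) (nhds x)"
        using 1 by (intro eventually_nhds_in_open) auto
      then show ?thesis by eventually_elim (auto simp: g_def bump_def d_def)
    qed
    ultimately show ?thesis by (subst (asm) DERIV_cong_ev[OF refl _ refl])
  next
    case 2
    have "eventually (\<lambda>y. y \<in> {y. r < \<bar>y - c\<bar>}) (nhds x)"
      using 2 by (intro eventually_nhds_in_open open_Collect_less continuous_intros) auto
    then have "eventually (\<lambda>y. (\<lambda>_. 0) y = bump c r p k y) (nhds x)" by eventually_elim (auto simp: bump_def)
    moreover have "((\<lambda>_. 0) has_real_derivative 0) (at x)" by simp
    moreover have "bump c r ?q (k + 2) x = 0" using 2 by (simp add: bump_def)
    ultimately show ?thesis by (subst (asm) DERIV_cong_ev[OF refl _ refl]) auto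
  next
    case 3
    have "compact (poly p ` {c - r..c + r})" by (intro compact_continuous_image continuous_intros) auto
    then have "bounded (poly p ` {c - r..c + r})" by (rule compact_imp_bounded)
    then obtain M where M: "\<And>y. y \<in> {c - r..c + r} \<Longrightarrow> \<bar>poly p y\<bar> \<le> M"
      unfolding bounded_iff real_norm_def by blast
    have M0: "M \<ge> 0" using M[of c] r by auto
    define B where "B = M * fact (k + 2) * (2 * r)\<^sup>2"
    have B0: "B \<ge> 0" using M0 by (simp add: B_def)
    have bx: "bump c r p k x = 0" using 3 by (simp add: bump_def)
    have bd: "\<bar>bump c r p k y\<bar> \<le> B * (y - x)\<^sup>2" for y
    proof (cases "\<bar>y - c\<bar> < r")
      case True
      have d0: "d y > 0" unfolding d_def using True by (rule bump_gap_pos)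
      have "\<bar>bump c r p k y\<bar> = \<bar>poly p y\<bar> * (inverse (d y) ^ k * exp (- inverse (d y)))"
        using True d0 by (simp add: bump_def abs_mult d_def power_abs)
      also have "\<dots> \<le> M * (fact (k + 2) * (d y)\<^sup>2)"
        using True d0 M0 by (intro mult_mono M inverse_power_exp_bound) auto
      also have "\<dots> \<le> M * (fact (k + 2) * ((2 * r)\<^sup>2 * (y - x)\<^sup>2))"
      proof (intro mult_left_mono)
        \<comment> \<open>The gap at y is the product of the distances to both endpoints; x is one
          endpoint, and the other is less than 2 r away.\<close>
        have "d y \<le> 2 * r * \<bar>y - x\<bar>"
        proof (cases "x - c = r")
          case xr: True
          have "d y = (r + (y - c)) * (x - y)" using xr by (simp add: d_def power2_eq_square algebra_simps)
          also have "\<dots> \<le> (2 * r) * \<bar>y - x\<bar>" using True xr by (intro mult_mono) auto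
          finally show ?thesis .
        next
          case False
          then have xr: "x - c = - r" using 3 by linarith
          then have xe: "x = c - r" by simp
          have "d y = (r - (y - c)) * (y - x)" unfolding xe by (simp add: d_def power2_eq_square algebra_simps)
          also have "\<dots> \<le> (2 * r) * \<bar>y - x\<bar>" using True xr by (intro mult_mono) auto
          finally show ?thesis .
        qed
        then have "(d y)\<^sup>2 \<le> (2 * r * \<bar>y - x\<bar>)\<^sup>2" using d0 by (intro power_mono) auto
        then show "(d y)\<^sup>2 \<le> (2 * r)\<^sup>2 * (y - x)\<^sup>2" by (simp add: power_mult_distrib)
      qed (use M0 in auto)
      finally show ?thesis by (simp add: B_def mult_ac)
    next
      case False then show ?thesis using B0 by (simp add: bump_def)
    qed
    have "(bump c r p k has_real_derivative 0) (at x)"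
      unfolding has_field_derivative_iff bx
    proof (rule Lim_null_comparison)
      have "norm ((bump c r p k y - 0) / (y - x)) \<le> B * \<bar>y - x\<bar>" for y
      proof (cases "y = x")
        case False
        have "\<bar>bump c r p k y\<bar> / \<bar>y - x\<bar> \<le> B * (y - x)\<^sup>2 / \<bar>y - x\<bar>"
          using bd[of y] by (intro divide_right_mono) auto
        also have "\<dots> = B * \<bar>y - x\<bar>"
        proof -
          have e: "(y - x)\<^sup>2 = \<bar>y - x\<bar> * \<bar>y - x\<bar>" by (simp add: power2_eq_square)
          have "B * (m * m) / m = B * m" if "m \<noteq> 0" for m using that by simp
          then show ?thesis unfolding e using False by (metis abs_eq_0 eq_iff_diff_eq_0)
        qed
        finally show ?thesis by simp
      qed simp
      then show "\<forall>\<^sub>F y in at x. norm ((bump c r p k y - 0) / (y - x)) \<le> B * \<bar>y - x\<bar>" by simp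
      have "((\<lambda>y. B * \<bar>y - x\<bar>) \<longlongrightarrow> B * \<bar>x - x\<bar>) (at x)" by (intro tendsto_intros)
      then show "((\<lambda>y. B * \<bar>y - x\<bar>) \<longlongrightarrow> 0) (at x)" by simp
    qed
    moreover have "bump c r ?q (k + 2) x = 0" using 3 by (simp add: bump_def)
    ultimately show ?thesis by simp
  qed
qed

lemma smooth_iff: "smooth f \<longleftrightarrow> (\<forall>n. diff_class (\<lambda>_. True) n f)"
  unfolding smooth_def all_diff_class_iff by blast

lemma smooth_bump:
  assumes r: "r > 0" shows "smooth (\<lambda>x. complex_of_real (bump c r p k x))"
proof -
  have "diff_class (\<lambda>_. True) n (\<lambda>x. complex_of_real (bump c r p k x))" for n
  proof (induction n arbitrary: p k)
    case (Suc n)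
    show ?case
      by (rule diff_class_SucI[OF _ has_vector_derivative_of_real[OF bump_has_derivative[OF r]] Suc]) simp
  qed simp
  then show ?thesis by (simp add: smooth_iff)
qed

lemma vderiv_eq_0_open:
  assumes "open U" "x \<in> U" "\<And>y. y \<in> U \<Longrightarrow> f y = 0" shows "vderiv f x = 0"
proof -
  have "((\<lambda>_. 0) has_vector_derivative 0) (at x)" by simp
  then have "(f has_vector_derivative 0) (at x)"
    by (rule has_vector_derivative_transform_within_open[OF _ assms(1,2)]) (simp add: assms(3))
  then show ?thesis unfolding vderiv_def by (rule vector_derivative_at)
qed

text \<open>Vanishing on the open set \<bar>x\<bar> > R passes to derivatives, and on [-R, R]
  continuity gives the bound.\<close>

lemma smooth_compact_support_schwartz:
  assumes f: "smooth f" and R: "\<And>x. \<bar>x\<bar> > R \<Longrightarrow> f x = 0"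
  shows "schwartz f"
proof -
  have "diff_class rapid_decay n g" if "smooth g" "\<And>x. \<bar>x\<bar> > R \<Longrightarrow> g x = 0" for n g
    using that
  proof (induction n arbitrary: g)
    have rd: "rapid_decay g" if g: "smooth g" "\<And>x. \<bar>x\<bar> > R \<Longrightarrow> g x = 0" for g
      unfolding rapid_decay_def
    proof
      fix m
      have "\<forall>x. g differentiable (at x)" using g(1) unfolding smooth_iff by (metis diff_class.simps(2))
      then have "continuous_on {-R..R} g"
        by (meson continuous_at_imp_continuous_on differentiable_imp_continuous_within)
      then have "bounded (g ` {-R..R})" by (intro compact_imp_bounded compact_continuous_image) auto
      then obtain B where B: "\<And>x. x \<in> {-R..R} \<Longrightarrow> norm (g x) \<le> B" unfolding bounded_iff by blast
      have "norm (g x) * (1 + \<bar>x\<bar>) ^ m \<le> \<bar>B\<bar> * (1 + \<bar>R\<bar>) ^ m" for x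
      proof (cases "\<bar>x\<bar> \<le> R")
        case True
        then have "norm (g x) \<le> \<bar>B\<bar>" using B[of x] by (smt (verit, best) atLeastAtMost_iff)
        then show ?thesis using True by (intro mult_mono power_mono) auto
      next
        case False then show ?thesis by (simp add: g(2))
      qed
      then show "\<exists>C. \<forall>x. norm (g x) * (1 + \<bar>x\<bar>) ^ m \<le> C" by blast
    qed
    case 0 then show ?case by (simp add: rd)
  next
    case (Suc n)
    have "smooth (vderiv g)" "\<forall>x. g differentiable (at x)"
      using Suc.prems(1) unfolding smooth_iff by (metis diff_class.simps(2))+
    moreover have "vderiv g x = 0" if "\<bar>x\<bar> > R" for x
      by (rule vderiv_eq_0_open[of "{x. R < \<bar>x\<bar>}"])
         (use that Suc.prems(2) in \<open>auto intro!: open_Collect_less continuous_intros\<close>)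
    moreover have "diff_class rapid_decay n g" by (rule Suc.IH[OF Suc.prems])
    ultimately show ?case using Suc.IH diff_class_bound by auto
  qed
  with f R show ?thesis by (simp add: schwartz_iff)
qed

lemma schwartz_smooth: "schwartz f \<Longrightarrow> smooth f"
  by (simp add: schwartz_def)

lemma bump_outside: "\<bar>x - c\<bar> \<ge> r \<Longrightarrow> bump c r p k x = 0"
  by (simp add: bump_def)

lemma exists_bump:
  assumes "open V" "x \<in> V"
  obtains \<phi> where "schwartz \<phi>" "\<phi> x \<noteq> 0" "compact (closure {y. \<phi> y \<noteq> 0})" "closure {y. \<phi> y \<noteq> 0} \<subseteq> V"
proof -
  obtain r where r: "r > 0" "cball x r \<subseteq> V" using assms open_contains_cball by blast
  define \<phi> where "\<phi> = (\<lambda>y. complex_of_real (bump x r 1 0 y))"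
  have "{y. \<phi> y \<noteq> 0} \<subseteq> cball x r"
    by (auto simp: \<phi>_def bump_def dist_real_def abs_minus_commute split: if_splits)
  then have cl: "closure {y. \<phi> y \<noteq> 0} \<subseteq> cball x r" by (intro closure_minimal) auto
  have "schwartz \<phi>"
  proof (rule smooth_compact_support_schwartz[where R = "\<bar>x\<bar> + r"])
    show "smooth \<phi>" unfolding \<phi>_def by (rule smooth_bump[OF r(1)])
    show "\<phi> y = 0" if "\<bar>y\<bar> > \<bar>x\<bar> + r" for y
      unfolding \<phi>_def using that by (subst bump_outside) auto
  qed
  moreover have "\<phi> x \<noteq> 0" using r by (simp add: \<phi>_def bump_def)
  moreover have "compact (closure {y. \<phi> y \<noteq> 0})"
    using cl compact_Int_closed[OF compact_cball closed_closure, of x r "{y. \<phi> y \<noteq> 0}"] by (simp add: Int_absorb1)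
  ultimately show thesis using that cl r(2) by blast
qed

section \<open>Frequency sets and the support\<close>

definition freqs :: "real \<Rightarrow> real set" where "freqs w = range (\<lambda>k::int. of_int k / w)"

text \<open>After scaling this is a set of integers, and every set of integers is closed. Removing
  points therefore keeps the set closed, which is used to isolate a frequency.\<close>

lemma closed_freqs_diff:
  assumes w: "w > 0" shows "closed (freqs w - A)"
proof -
  have "freqs w - A = (\<lambda>x. x * w) -` (of_int ` {k::int. of_int k / w \<notin> A})"
    using w by (auto simp: freqs_def image_iff) (metis nonzero_mult_div_cancel_right less_irrefl)+
  then show ?thesis by (simp only:) (intro continuous_closed_vimage closed_of_int_image continuous_intros)
qed

lemma sines_apart_common_zero:
  assumes "sines_apart v w" "v > 0" "w > 0" "x \<in> freqs v" "x \<in> freqs w" shows "x = 0"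
proof -
  obtain c where c: "c > 0" "\<And>t. c * min \<bar>t\<bar> (1 / (1 + \<bar>t\<bar>)) \<le> \<bar>sin (pi * v * t)\<bar> + \<bar>sin (pi * w * t)\<bar>"
    using assms(1) unfolding sines_apart_def by blast
  have "sin (pi * v * x) = 0" if "v > 0" "x \<in> freqs v" for v
    using that by (auto simp: freqs_def sin_pi_int_ratio simp del: times_divide_eq_right)
  then have "sin (pi * v * x) = 0" "sin (pi * w * x) = 0" using assms by auto
  then have "c * min \<bar>x\<bar> (1 / (1 + \<bar>x\<bar>)) \<le> 0" using c(2)[of x] by simp
  then have "min \<bar>x\<bar> (1 / (1 + \<bar>x\<bar>)) \<le> 0" using c(1) by (simp add: mult_le_0_iff)
  moreover have "1 / (1 + \<bar>x\<bar>) > 0" by (simp add: add_pos_nonneg)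
  ultimately show ?thesis by (simp add: min_le_iff_disj)
qed

lemma vderiv2_eq_0_open:
  assumes "open U" "x \<in> U" "\<And>y. y \<in> U \<Longrightarrow> f y = 0" shows "vderiv (vderiv f) x = 0"
  using assms by (intro vderiv_eq_0_open[of U x] vderiv_eq_0_open[OF assms(1) _ assms(3)])

lemma residue_coeff_nonzero:
  assumes w: "w1 > 0" and a: "sines_apart w1 w2" "sines_apart w1 w3" and k: "k \<noteq> 0"
  shows "residue_coeff w1 w2 w3 k \<noteq> 0"
proof -
  have "sin (pi * k * (v / w1)) \<noteq> 0" if v: "sines_apart w1 v" for v :: real
  proof -
    obtain c where c: "c > 0" "\<And>k::int. k \<noteq> 0 \<Longrightarrow> c / (1 + \<bar>of_int k\<bar>) \<le> \<bar>sin (pi * k * (v / w1))\<bar>"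
      by (rule sines_apart_ratio[OF v w]) (rule that)
    have "0 < c / (1 + \<bar>real_of_int k\<bar>)" using c(1) by (simp add: add_pos_nonneg)
    with c(2)[OF k] show ?thesis by auto
  qed
  then show ?thesis using a w by (simp add: residue_coeff_def)
qed

text \<open>The test function vanishes near 0 and at every frequency but x. Since different families
  meet only at 0, exactly one Dirac term survives, and its coefficient is nonzero.\<close>

lemma spectral_side_isolated:
  assumes w: "w1 > 0" "w2 > 0" "w3 > 0" and a: "sines_apart w1 w2" "sines_apart w1 w3" "sines_apart w2 w3"
    and x: "x \<in> freqs w1" "x \<noteq> 0"
    and \<phi>: "\<phi> x \<noteq> 0" "closure {y. \<phi> y \<noteq> 0} \<subseteq> - (freqs w1 - {x} \<union> (freqs w2 - {x}) \<union> (freqs w3 - {x}))"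
  shows "spectral_side w1 w2 w3 \<phi> \<noteq> 0"
proof -
  obtain k0 :: int where k0: "x = of_int k0 / w1" using x(1) by (auto simp: freqs_def)
  have "k0 \<noteq> 0" using k0 x(2) by auto
  have z: "\<phi> y = 0" if "y \<in> freqs w1 \<union> freqs w2 \<union> freqs w3" "y \<noteq> x" for y
    using \<phi>(2) closure_subset[of "{y. \<phi> y \<noteq> 0}"] that by blast
  have f0: "0 \<in> freqs v" for v unfolding freqs_def by (rule range_eqI[of _ _ 0]) simp
  have "0 \<in> - closure {y. \<phi> y \<noteq> 0}" using \<phi>(2) f0[of w1] x(2) by blast
  then have d0: "vderiv (vderiv \<phi>) 0 = 0"
    by (intro vderiv2_eq_0_open[of "- closure {y. \<phi> y \<noteq> 0}"]) (use closure_subset[of "{y. \<phi> y \<noteq> 0}"] in auto)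
  have p0: "\<phi> 0 = 0" using z[of 0] f0 x(2) by auto
  have r2: "residue_sum w2 w1 w3 \<phi> = 0"
  proof (rule residue_sum_eq_0)
    fix k :: int
    have m: "of_int k / w2 \<in> freqs w2" by (auto simp: freqs_def)
    then have "of_int k / w2 \<noteq> x" using sines_apart_common_zero[OF a(1) w(1,2) x(1)] x(2) by auto
    with m show "\<phi> (of_int k / w2) = 0" by (intro z) auto
  qed
  have r3: "residue_sum w3 w1 w2 \<phi> = 0"
  proof (rule residue_sum_eq_0)
    fix k :: int
    have m: "of_int k / w3 \<in> freqs w3" by (auto simp: freqs_def)
    then have "of_int k / w3 \<noteq> x" using sines_apart_common_zero[OF a(2) w(1,3) x(1)] x(2) by auto
    with m show "\<phi> (of_int k / w3) = 0" by (intro z) auto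
  qed
  have "residue_sum w1 w2 w3 \<phi> = (\<Sum>\<^sub>\<infinity>k\<in>{k0}. complex_of_real (residue_coeff w1 w2 w3 k) * \<phi> (of_int k / w1))"
    unfolding residue_sum_def
  proof (rule infsum_cong_neutral)
    fix k :: int assume k: "k \<in> - {0} - {k0}"
    then have "of_int k / w1 \<noteq> x" using w(1) by (simp add: k0)
    then have "\<phi> (of_int k / w1) = 0" by (intro z) (auto simp: freqs_def)
    then show "complex_of_real (residue_coeff w1 w2 w3 k) * \<phi> (of_int k / w1) = 0" by simp
  qed (use \<open>k0 \<noteq> 0\<close> in auto)
  also have "\<dots> = residue_coeff w1 w2 w3 k0 * \<phi> x" by (simp add: k0)
  finally show ?thesis
    using residue_coeff_nonzero[OF w(1) a(1,2) \<open>k0 \<noteq> 0\<close>] \<phi>(1)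
    by (simp add: spectral_side_def d0 p0 r2 r3)
qed

text \<open>Agreement of \<open>u\<close> with the formula is required only on Schwartz functions,
  where functionals have meaning; the test functions in \<open>vanishes_on\<close> are smooth with
  compact support and hence Schwartz.\<close>

theorem spectral_side_support:
  assumes w: "w1 > 0" "w2 > 0" "w3 > 0" and a: "sines_apart w1 w2" "sines_apart w1 w3" "sines_apart w2 w3"
    and u: "\<And>f. schwartz f \<Longrightarrow> u f = spectral_side w1 w2 w3 f"
  shows "distr_supp u = freqs w1 \<union> freqs w2 \<union> freqs w3"
proof (rule antisym)
  define Z where "Z = freqs w1 \<union> freqs w2 \<union> freqs w3"
  have Z: "closed Z" unfolding Z_def using closed_freqs_diff[of _ "{}"] w by (auto intro!: closed_Un)
  have f0: "0 \<in> freqs v" for v unfolding freqs_def by (rule range_eqI[of _ _ 0]) simp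
  have "vanishes_on u (- Z)"
    unfolding vanishes_on_def
  proof (intro allI impI)
    fix \<phi> assume \<phi>: "smooth \<phi>" "compact (closure {x. \<phi> x \<noteq> 0})" "closure {x. \<phi> x \<noteq> 0} \<subseteq> - Z"
    obtain R where R: "\<And>x. x \<in> closure {x. \<phi> x \<noteq> 0} \<Longrightarrow> norm x \<le> R"
      using compact_imp_bounded[OF \<phi>(2)] unfolding bounded_iff by blast
    have "schwartz \<phi>"
      by (rule smooth_compact_support_schwartz[OF \<phi>(1), of R])
         (use R closure_subset[of "{x. \<phi> x \<noteq> 0}"] in \<open>force simp: not_less[symmetric]\<close>)
    have z: "\<phi> y = 0" if "y \<in> Z" for y
      using \<phi>(3) closure_subset[of "{x. \<phi> x \<noteq> 0}"] that by blast
    have "0 \<in> - closure {y. \<phi> y \<noteq> 0}" using \<phi>(3) f0[of w1] by (auto simp: Z_def)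
    then have d0: "vderiv (vderiv \<phi>) 0 = 0"
      by (intro vderiv2_eq_0_open[of "- closure {y. \<phi> y \<noteq> 0}"]) (use closure_subset[of "{y. \<phi> y \<noteq> 0}"] in auto)
    have "residue_sum w1 w2 w3 \<phi> = 0" "residue_sum w2 w1 w3 \<phi> = 0" "residue_sum w3 w1 w2 \<phi> = 0"
      by (intro residue_sum_eq_0 z; auto simp: Z_def freqs_def)+
    then show "u \<phi> = 0" unfolding u[OF \<open>schwartz \<phi>\<close>] spectral_side_def
      using d0 z[of 0] f0 by (simp add: Z_def)
  qed
  then show "distr_supp u \<subseteq> freqs w1 \<union> freqs w2 \<union> freqs w3"
    using Z unfolding distr_supp_def Z_def[symmetric] by (auto simp: open_Compl)
  show "freqs w1 \<union> freqs w2 \<union> freqs w3 \<subseteq> distr_supp u"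
  proof
    fix x assume x: "x \<in> freqs w1 \<union> freqs w2 \<union> freqs w3"
    show "x \<in> distr_supp u"
    proof (rule ccontr)
      assume "x \<notin> distr_supp u"
      then obtain U where U: "open U" "vanishes_on u U" "x \<in> U" unfolding distr_supp_def by blast
      \<comment> \<open>All frequencies other than x. This set is closed, so a bump around x can
        avoid it.\<close>
      define N where "N = freqs w1 - {x} \<union> (freqs w2 - {x}) \<union> (freqs w3 - {x})"
      have "closed N" unfolding N_def using w by (intro closed_Un closed_freqs_diff)
      then have "open (U - N)" using U(1) by (rule open_Diff[rotated])
      moreover have "x \<in> U - N" using U by (simp add: N_def)
      ultimately obtain \<phi> where \<phi>: "schwartz \<phi>" "\<phi> x \<noteq> 0" "compact (closure {y. \<phi> y \<noteq> 0})" "closure {y. \<phi> y \<noteq> 0} \<subseteq> U - N"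
        by (rule exists_bump)
      show False
      proof (cases "x = 0")
        case False
        have "u \<phi> = 0" using U(2) \<phi> unfolding vanishes_on_def by (auto intro: schwartz_smooth)
        moreover have sub: "closure {y. \<phi> y \<noteq> 0} \<subseteq> - N" using \<phi>(4) by blast
        have "spectral_side w1 w2 w3 \<phi> \<noteq> 0"
          using x
        proof (elim UnE)
          assume "x \<in> freqs w1"
          from spectral_side_isolated[where x = x and \<phi> = \<phi>, OF w a this False \<phi>(2)] sub
          show ?thesis by (simp add: N_def)
        next
          assume "x \<in> freqs w2"
          from spectral_side_isolated[where x = x and \<phi> = \<phi>, OF w(2,1,3) sines_apart_commute[OF a(1)] a(3,2) this False \<phi>(2)] sub
          show ?thesis unfolding spectral_side_swap12[of w2] by (simp add: N_def Un_ac)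
        next
          assume "x \<in> freqs w3"
          from spectral_side_isolated[where x = x and \<phi> = \<phi>, OF w(3,2,1) sines_apart_commute[OF a(3)] sines_apart_commute[OF a(2)] sines_apart_commute[OF a(1)] this False \<phi>(2)] sub
          show ?thesis unfolding spectral_side_swap13[of w3] by (simp add: N_def Un_ac)
        qed
        ultimately show False using u[OF \<phi>(1)] by simp
      next
        case True
        txt \<open>At \<open>0\<close> both \<open>\<delta>''\<close> and \<open>\<delta>\<close> occur; the factor \<open>sin\<^sup>2 t\<close> removes the latter.\<close>
        define \<psi> where "\<psi> = (\<lambda>t. complex_of_real (sin (1 * t)) * (of_real (sin (1 * t)) * \<phi> t))"
        have m: "multiplier (\<lambda>t. complex_of_real (sin (1 * t)))" by (rule multiplier_sin)
        have i: "schwartz (\<lambda>t. complex_of_real (sin (1 * t)) * \<phi> t)"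
          using schwartz_times_multiplier[OF \<phi>(1) m] by (simp add: mult.commute)
        have \<psi>: "schwartz \<psi>"
          using schwartz_times_multiplier[OF i m] by (simp add: \<psi>_def mult_ac)
        have sub: "{y. \<psi> y \<noteq> 0} \<subseteq> {y. \<phi> y \<noteq> 0}" by (auto simp: \<psi>_def)
        have cl: "closure {y. \<psi> y \<noteq> 0} \<subseteq> closure {y. \<phi> y \<noteq> 0}" by (rule closure_mono[OF sub])
        have "compact (closure {y. \<psi> y \<noteq> 0})"
          using compact_Int_closed[OF \<phi>(3) closed_closure, of "{y. \<psi> y \<noteq> 0}"] cl by (simp add: Int_absorb1)
        then have "u \<psi> = 0" using U(2) schwartz_smooth[OF \<psi>] cl \<phi>(4) unfolding vanishes_on_def by blast
        moreover have "vderiv (vderiv \<psi>) 0 = 2 * \<phi> 0"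
        proof -
          have "vderiv (\<lambda>t. complex_of_real (sin (1 * t)) * \<phi> t) 0 = \<phi> 0"
            unfolding vderiv_mult[OF m \<phi>(1)] vderiv_sin by simp
          then show ?thesis unfolding \<psi>_def vderiv2_mult[OF m i] vderiv_sin by simp
        qed
        moreover have z: "\<psi> y = 0" if "y \<in> freqs w1 \<union> freqs w2 \<union> freqs w3" for y
        proof (cases "y = 0")
          case True then show ?thesis by (simp add: \<psi>_def)
        next
          case False
          then have "y \<in> N" using that \<open>x = 0\<close> by (auto simp: N_def)
          then show ?thesis using cl \<phi>(4) closure_subset[of "{y. \<psi> y \<noteq> 0}"] by blast
        qed
        have "residue_sum w1 w2 w3 \<psi> = 0" "residue_sum w2 w1 w3 \<psi> = 0" "residue_sum w3 w1 w2 \<psi> = 0"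
          by (intro residue_sum_eq_0 z; auto simp: freqs_def)+
        moreover have "\<psi> 0 = 0" by (simp add: \<psi>_def)
        ultimately show False using u[OF \<psi>] \<phi>(2) w True by (simp add: spectral_side_def)
      qed
    qed
  qed
qed

section \<open>The point set as an injective image of the cone, and the conclusion\<close>

text \<open>Isolating sqrt 3 and squaring leaves a relation in sqrt 2; squaring again equates a
  square with twice a square, so both vanish. Hence A B = 0 and 3 C^2 = A^2 + 2 B^2, and in either
  case one more valuation argument finishes.\<close>

lemma int_independent_1_sqrt2_sqrt3:
  fixes A B C :: int
  assumes "real_of_int A + of_int B * sqrt 2 + of_int C * sqrt 3 = 0"
  shows "A = 0 \<and> B = 0 \<and> C = 0"
proof -
  have "of_int C * sqrt 3 = - (of_int A + of_int B * sqrt 2)" using assms by linarith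
  then have "(of_int C * sqrt 3)\<^sup>2 = (of_int A + of_int B * sqrt 2)\<^sup>2" by (simp only: power2_minus)
  then have 1: "3 * real_of_int C ^ 2 - of_int A ^ 2 - 2 * of_int B ^ 2 = 2 * of_int A * of_int B * sqrt 2"
    by (simp add: power_mult_distrib power2_sum)
  then have "(3 * real_of_int C ^ 2 - of_int A ^ 2 - 2 * of_int B ^ 2)\<^sup>2 = 2 * (2 * of_int A * of_int B) ^ 2"
    by (simp add: power_mult_distrib)
  then have "real_of_int (1 * (3 * C ^ 2 - A ^ 2 - 2 * B ^ 2)\<^sup>2) = of_int (2 * (2 * A * B) ^ 2)" by simp
  then have "1 * (3 * C ^ 2 - A ^ 2 - 2 * B ^ 2)\<^sup>2 = 2 * (2 * A * B) ^ 2" by (simp only: of_int_eq_iff)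
  from prime_times_square_eq[OF _ _ this] have 2: "3 * C ^ 2 = A ^ 2 + 2 * B ^ 2" "A = 0 \<or> B = 0" by auto
  from 2(2) show ?thesis
  proof
    assume "A = 0"
    with 2 have "3 * C ^ 2 = 2 * B ^ 2" by simp
    from prime_times_square_eq[OF _ _ this] \<open>A = 0\<close> show ?thesis by auto
  next
    assume "B = 0"
    with 2 have "1 * A ^ 2 = 3 * C ^ 2" by simp
    from prime_times_square_eq[OF _ _ this] \<open>B = 0\<close> show ?thesis by auto
  qed
qed

lemma inj_lat: "inj (\<lambda>p. lat 1 (sqrt 2) (sqrt 3) p + a)"
proof (rule injI)
  fix p q assume eq: "lat 1 (sqrt 2) (sqrt 3) p + a = lat 1 (sqrt 2) (sqrt 3) q + a"
  obtain i j k where p: "p = ((i, j), k)" by (metis surj_pair)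
  obtain i' j' k' where q: "q = ((i', j'), k')" by (metis surj_pair)
  have "real_of_int (int i - int i') + of_int (int j - int j') * sqrt 2 + of_int (int k - int k') * sqrt 3 = 0"
    using eq by (simp add: p q lat_def algebra_simps)
  from int_independent_1_sqrt2_sqrt3[OF this] show "p = q" by (simp add: p q)
qed

text \<open>The comb sums over a set, so each point counts once. Independence of the frequencies
  makes the parametrisation injective, and \<open>a > 0\<close> separates the two halves.\<close>

lemma dirac_comb_lattice:
  assumes a: "a > 0" and F: "rapid_decay F"
    and L: "\<Lambda>1 = range (\<lambda>p. lat 1 (sqrt 2) (sqrt 3) p + a)"
  shows "dirac_comb (\<Lambda>1 \<union> uminus ` \<Lambda>1) F
    = (\<Sum>\<^sub>\<infinity>p. F (lat 1 (sqrt 2) (sqrt 3) p + a)) + (\<Sum>\<^sub>\<infinity>p. F (- (lat 1 (sqrt 2) (sqrt 3) p + a)))"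
proof -
  let ?l = "\<lambda>p. lat 1 (sqrt 2) (sqrt 3) p + a"
  have pos: "?l p > 0" for p using lat_nonneg[of 1 "sqrt 2" "sqrt 3" p] a by simp
  have s: "(\<lambda>p. F (?l p)) summable_on UNIV" "(\<lambda>p. F (- ?l p)) summable_on UNIV"
    using rapid_decay_summable_lat[of 1 "sqrt 2" "sqrt 3" a F] a F by auto
  have 1: "(F has_sum (\<Sum>\<^sub>\<infinity>p. F (?l p))) \<Lambda>1"
    unfolding L using has_sum_infsum[OF s(1)] by (subst has_sum_reindex[OF inj_lat]) (simp add: o_def)
  have im: "uminus ` \<Lambda>1 = range (\<lambda>p. - ?l p)" unfolding L by (simp only: image_image)
  have inj: "inj (\<lambda>p. - ?l p)" using inj_lat[of a] by (auto simp: inj_on_def)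
  have 2: "(F has_sum (\<Sum>\<^sub>\<infinity>p. F (- ?l p))) (uminus ` \<Lambda>1)"
    unfolding im using has_sum_infsum[OF s(2)] by (subst has_sum_reindex[OF inj]) (simp add: o_def)
  have "\<Lambda>1 \<inter> uminus ` \<Lambda>1 = {}"
  proof -
    have p: "x > 0" if "x \<in> \<Lambda>1" for x using that pos by (auto simp: L)
    have False if "y \<in> \<Lambda>1" "- y \<in> \<Lambda>1" for y using p[OF that(1)] p[OF that(2)] by simp
    then show ?thesis by blast
  qed
  from has_sum_Un_disjoint[OF 1 2 this] show ?thesis
    unfolding dirac_comb_def dirac_def by (rule infsumI)
qed

lemma schwartz_seminorm_ge:
  assumes "schwartz f" shows "norm (x ^ m *\<^sub>R (vderiv ^^ n) f x) \<le> schwartz_seminorm m n f"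
proof -
  have "bounded (range (\<lambda>x. x ^ m *\<^sub>R (vderiv ^^ n) f x))" using assms by (simp add: schwartz_def)
  then have "bdd_above (range (\<lambda>x. norm (x ^ m *\<^sub>R (vderiv ^^ n) f x)))"
    by (auto simp: bounded_iff bdd_above_def)
  then show ?thesis unfolding schwartz_seminorm_def by (intro cSUP_upper) auto
qed

lemma schwartz_seminorm_nonneg: "schwartz f \<Longrightarrow> schwartz_seminorm m n f \<ge> 0"
  using order_trans[OF norm_ge_zero schwartz_seminorm_ge] by blast

text \<open>The decay needed for the cone, with a constant linear in seminorms as continuity of the
  functional requires; 64 is 2^6.\<close>

lemma schwartz_decay_seminorm:
  assumes f: "schwartz f"
  shows "norm (f x) \<le> 64 * (schwartz_seminorm 0 0 f + schwartz_seminorm 6 0 f) / (1 + \<bar>x\<bar>) ^ 6"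
proof -
  have "(1 + \<bar>x\<bar>) ^ 6 \<le> (2 * max 1 \<bar>x\<bar>) ^ 6" by (intro power_mono) auto
  also have "\<dots> \<le> 2 ^ 6 * (1 + \<bar>x\<bar> ^ 6)"
    unfolding power_mult_distrib by (intro mult_left_mono) (auto simp: max_def)
  finally have "norm (f x) * (1 + \<bar>x\<bar>) ^ 6 \<le> norm (f x) * (2 ^ 6 * (1 + \<bar>x\<bar> ^ 6))"
    by (intro mult_left_mono) auto
  also have "\<dots> = 64 * (norm (x ^ 0 *\<^sub>R (vderiv ^^ 0) f x) + norm (x ^ 6 *\<^sub>R (vderiv ^^ 0) f x))"
    by (simp add: algebra_simps power_abs)
  also have "\<dots> \<le> 64 * (schwartz_seminorm 0 0 f + schwartz_seminorm 6 0 f)"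
    using f by (intro mult_left_mono add_mono schwartz_seminorm_ge) auto
  finally show ?thesis by (simp add: pos_le_divide_eq)
qed

lemma tempered_lattice_comb:
  assumes a: "a > 0" and L: "\<Lambda>1 = range (\<lambda>p. lat 1 (sqrt 2) (sqrt 3) p + a)"
  shows "tempered_distribution (dirac_comb (\<Lambda>1 \<union> uminus ` \<Lambda>1))"
  unfolding tempered_distribution_def
proof (intro conjI allI impI)
  let ?l = "\<lambda>p. lat 1 (sqrt 2) (sqrt 3) p + a"
  have w: "(1::real) > 0" "sqrt 2 > 0" "sqrt 3 > 0" by auto
  note dc = dirac_comb_lattice[OF a _ L]
  have s: "(\<lambda>p. f (?l p)) summable_on UNIV" "(\<lambda>p. f (- ?l p)) summable_on UNIV" if "schwartz f" for f
    using rapid_decay_summable_lat[OF w less_imp_le[OF a] schwartz_rapid[OF that]] by auto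
  show "dirac_comb (\<Lambda>1 \<union> uminus ` \<Lambda>1) (\<lambda>x. f x + g x) = dirac_comb (\<Lambda>1 \<union> uminus ` \<Lambda>1) f + dirac_comb (\<Lambda>1 \<union> uminus ` \<Lambda>1) g"
    if "schwartz f" "schwartz g" for f g
    using that s[of f] s[of g] by (simp add: dc schwartz_rapid schwartz_add infsum_add)
  show "dirac_comb (\<Lambda>1 \<union> uminus ` \<Lambda>1) (\<lambda>x. c * f x) = c * dirac_comb (\<Lambda>1 \<union> uminus ` \<Lambda>1) f"
    if "schwartz f" for c f
    using that by (simp add: dc schwartz_rapid schwartz_cmult infsum_cmult_right' distrib_left)
  define S where "S = (\<Sum>\<^sub>\<infinity>p. 1 / (1 + lat 1 (sqrt 2) (sqrt 3) p) ^ 6)"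
  have S: "((\<lambda>p. 1 / (1 + lat 1 (sqrt 2) (sqrt 3) p) ^ 6) has_sum S) UNIV"
    unfolding S_def by (intro has_sum_infsum summable_on_lat w)
  have S0: "S \<ge> 0" unfolding S_def using lat_nonneg[OF w] by (intro infsum_nonneg) simp
  \<comment> \<open>The constant 128 is 64 for each of the two cones.\<close>
  have "norm (dirac_comb (\<Lambda>1 \<union> uminus ` \<Lambda>1) f) \<le> 128 * S * (\<Sum>m\<le>6. \<Sum>n\<le>6. schwartz_seminorm m n f)" if f: "schwartz f" for f
  proof -
    define M where "M = 64 * (schwartz_seminorm 0 0 f + schwartz_seminorm 6 0 f)"
    have M0: "M \<ge> 0" unfolding M_def using schwartz_seminorm_nonneg[OF f] by simp
    have bd: "norm (f x) \<le> M * (1 / (1 + lat 1 (sqrt 2) (sqrt 3) p) ^ 6)" if "\<bar>x\<bar> = ?l p" for x p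
    proof -
      have "M / (1 + \<bar>x\<bar>) ^ 6 \<le> M / (1 + lat 1 (sqrt 2) (sqrt 3) p) ^ 6"
        using that M0 a lat_nonneg[OF w, of p]
        by (intro divide_left_mono power_mono mult_pos_pos zero_less_power) auto
      with schwartz_decay_seminorm[OF f, of x] show ?thesis by (simp add: M_def)
    qed
    have l: "\<bar>?l p\<bar> = ?l p" for p using lat_nonneg[OF w, of p] a by simp
    have "norm (\<Sum>\<^sub>\<infinity>p. f (?l p)) \<le> M * S"
      by (rule norm_infsum_le[OF has_sum_infsum[OF s(1)[OF f]] has_sum_cmult_right[OF S]]) (rule bd, rule l)
    moreover have "norm (\<Sum>\<^sub>\<infinity>p. f (- ?l p)) \<le> M * S"
      by (rule norm_infsum_le[OF has_sum_infsum[OF s(2)[OF f]] has_sum_cmult_right[OF S]]) (rule bd, simp only: abs_minus_cancel l)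
    ultimately have "norm (dirac_comb (\<Lambda>1 \<union> uminus ` \<Lambda>1) f) \<le> M * S + M * S"
      unfolding dc[OF schwartz_rapid[OF f]] by (rule norm_triangle_mono)
    also have "\<dots> = 128 * S * (\<Sum>m\<in>{0, 6}. schwartz_seminorm m 0 f)" by (simp add: M_def algebra_simps)
    also have "\<dots> \<le> 128 * S * (\<Sum>m\<le>6. \<Sum>n\<le>6. schwartz_seminorm m n f)"
    proof (rule mult_left_mono)
      have "(\<Sum>m\<in>{0, 6}. schwartz_seminorm m 0 f) \<le> (\<Sum>m\<le>6. schwartz_seminorm m 0 f)"
        by (intro sum_mono2 schwartz_seminorm_nonneg f) auto
      also have "\<dots> \<le> (\<Sum>m\<le>6. \<Sum>n\<le>6. schwartz_seminorm m n f)"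
        by (intro sum_mono member_le_sum schwartz_seminorm_nonneg f) auto
      finally show "(\<Sum>m\<in>{0, 6}. schwartz_seminorm m 0 f) \<le> (\<Sum>m\<le>6. \<Sum>n\<le>6. schwartz_seminorm m n f)" .
    qed (use S0 in simp)
    finally show ?thesis .
  qed
  then show "\<exists>C N. \<forall>f. schwartz f \<longrightarrow> norm (dirac_comb (\<Lambda>1 \<union> uminus ` \<Lambda>1) f) \<le> C * (\<Sum>m\<le>N. \<Sum>n\<le>N. schwartz_seminorm m n f)"
    by blast
qed

theorem theorem1p1:
  fixes \<omega>\<^sub>1 \<omega>\<^sub>2 \<omega>\<^sub>3 a P Q :: real
    and \<Lambda>\<^sub>1 \<Lambda> :: "real set"
    and b c d :: "int \<Rightarrow> real"
    and T :: "int \<Rightarrow> functional"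
  assumes "\<omega>\<^sub>1 = 1" and "\<omega>\<^sub>2 = sqrt 2" and "\<omega>\<^sub>3 = sqrt 3"
    and "a = (\<omega>\<^sub>1 + \<omega>\<^sub>2 + \<omega>\<^sub>3) / 2"
    and "\<Lambda>\<^sub>1 = {a + real n\<^sub>1 * \<omega>\<^sub>1 + real n\<^sub>2 * \<omega>\<^sub>2 + real n\<^sub>3 * \<omega>\<^sub>3 | n\<^sub>1 n\<^sub>2 n\<^sub>3 :: nat. True}"
    and "\<Lambda> = \<Lambda>\<^sub>1 \<union> uminus ` \<Lambda>\<^sub>1"
    and "P = \<omega>\<^sub>1 * \<omega>\<^sub>2 * \<omega>\<^sub>3" and "Q = \<omega>\<^sub>1\<^sup>2 + \<omega>\<^sub>2\<^sup>2 + \<omega>\<^sub>3\<^sup>2"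
    and "\<And>k. k \<noteq> 0 \<Longrightarrow>
      b k = (- 1) powi (k + 1) / (4 * \<omega>\<^sub>1 * sin (pi * k * (\<omega>\<^sub>2 / \<omega>\<^sub>1)) * sin (pi * k * (\<omega>\<^sub>3 / \<omega>\<^sub>1)))"
    and "\<And>k. k \<noteq> 0 \<Longrightarrow>
      c k = (- 1) powi (k + 1) / (4 * \<omega>\<^sub>2 * sin (pi * k * (\<omega>\<^sub>1 / \<omega>\<^sub>2)) * sin (pi * k * (\<omega>\<^sub>3 / \<omega>\<^sub>2)))"
    and "\<And>k. k \<noteq> 0 \<Longrightarrow>
      d k = (- 1) powi (k + 1) / (4 * \<omega>\<^sub>3 * sin (pi * k * (\<omega>\<^sub>1 / \<omega>\<^sub>3)) * sin (pi * k * (\<omega>\<^sub>2 / \<omega>\<^sub>3)))"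
    and "\<And>k f. T k f =
      b k *\<^sub>R dirac (real_of_int k) f + c k *\<^sub>R dirac (k / sqrt 2) f + d k *\<^sub>R dirac (k / sqrt 3) f"
  shows "tempered_distribution (dirac_comb \<Lambda>)
    \<and> (\<forall>f. schwartz f \<longrightarrow>
          (\<lambda>k. norm (T k f)) summable_on (- {0})
        \<and> distr_fourier (dirac_comb \<Lambda>) f
            = - (1 / (8 * pi\<^sup>2 * P)) *\<^sub>R distr_deriv (distr_deriv (dirac 0)) f
              - (Q / (24 * P)) *\<^sub>R dirac 0 f
              + (\<Sum>\<^sub>\<infinity>k\<in>- {0}. T k f))
    \<and> distr_supp (distr_fourier (dirac_comb \<Lambda>))
        = \<int> \<union> {real_of_int k / sqrt 2 | k. True} \<union> {real_of_int k / sqrt 3 | k. True}"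
proof -
  note w = assms(1-3)
  have pos: "\<omega>\<^sub>1 > 0" "\<omega>\<^sub>2 > 0" "\<omega>\<^sub>3 > 0" unfolding w by auto
  have ap: "sines_apart \<omega>\<^sub>1 \<omega>\<^sub>2" "sines_apart \<omega>\<^sub>1 \<omega>\<^sub>3" "sines_apart \<omega>\<^sub>2 \<omega>\<^sub>3"
    unfolding w by (rule sines_apart_1_sqrt2 sines_apart_1_sqrt3 sines_apart_sqrt2_sqrt3)+
  note ap' = ap[THEN sines_apart_commute]
  have a: "a > 0" using pos by (simp add: assms(4))
  have L: "\<Lambda>\<^sub>1 = range (\<lambda>p. lat 1 (sqrt 2) (sqrt 3) p + a)"
  proof -
    have "x \<in> range (\<lambda>p. lat 1 (sqrt 2) (sqrt 3) p + a)" if "x = a + real i * \<omega>\<^sub>1 + real j * \<omega>\<^sub>2 + real k * \<omega>\<^sub>3" for x i j k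
      by (rule range_eqI[of _ _ "((i, j), k)"]) (simp add: that lat_def w)
    moreover have "lat 1 (sqrt 2) (sqrt 3) p + a = a + real (fst (fst p)) * \<omega>\<^sub>1 + real (snd (fst p)) * \<omega>\<^sub>2 + real (snd p) * \<omega>\<^sub>3" for p
      by (simp add: lat_def w)
    ultimately show ?thesis unfolding assms(5) by blast
  qed
  have F: "distr_fourier (dirac_comb \<Lambda>) f = spectral_side \<omega>\<^sub>1 \<omega>\<^sub>2 \<omega>\<^sub>3 f" if f: "schwartz f" for f
  proof -
    have "distr_fourier (dirac_comb \<Lambda>) f = lattice_pairing \<omega>\<^sub>1 \<omega>\<^sub>2 \<omega>\<^sub>3 (fourier f)"
      unfolding distr_fourier_def assms(6) dirac_comb_lattice[OF a fourier_rapid[OF f] L] lattice_pairing_def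
      by (simp only: w assms(4))
    also have "\<dots> = spectral_side \<omega>\<^sub>1 \<omega>\<^sub>2 \<omega>\<^sub>3 f" by (rule lattice_fourier_formula[OF pos ap f])
    finally show ?thesis .
  qed
  have formula: "(\<lambda>k. norm (T k f)) summable_on (- {0}) \<and> distr_fourier (dirac_comb \<Lambda>) f
       = - (1 / (8 * pi\<^sup>2 * P)) *\<^sub>R distr_deriv (distr_deriv (dirac 0)) f
         - (Q / (24 * P)) *\<^sub>R dirac 0 f + (\<Sum>\<^sub>\<infinity>k\<in>- {0}. T k f)" if f: "schwartz f" for f
  proof -
    define t1 t2 t3 where "t1 = (\<lambda>k::int. complex_of_real (residue_coeff \<omega>\<^sub>1 \<omega>\<^sub>2 \<omega>\<^sub>3 k) * f (of_int k / \<omega>\<^sub>1))"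
      and "t2 = (\<lambda>k::int. complex_of_real (residue_coeff \<omega>\<^sub>2 \<omega>\<^sub>1 \<omega>\<^sub>3 k) * f (of_int k / \<omega>\<^sub>2))"
      and "t3 = (\<lambda>k::int. complex_of_real (residue_coeff \<omega>\<^sub>3 \<omega>\<^sub>1 \<omega>\<^sub>2 k) * f (of_int k / \<omega>\<^sub>3))"
    \<comment> \<open>The three coefficient sequences are prescribed only for k \<noteq> 0, hence
      the restriction.\<close>
    have T: "T k f = t1 k + t2 k + t3 k" if "k \<in> - {0}" for k
    proof -
      have k: "k \<noteq> 0" using that by simp
      have "b k = residue_coeff \<omega>\<^sub>1 \<omega>\<^sub>2 \<omega>\<^sub>3 k" "c k = residue_coeff \<omega>\<^sub>2 \<omega>\<^sub>1 \<omega>\<^sub>3 k" "d k = residue_coeff \<omega>\<^sub>3 \<omega>\<^sub>1 \<omega>\<^sub>2 k"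
        using assms(9-11)[OF k] by (simp_all only: residue_coeff_def)
      then show ?thesis
        by (simp add: assms(12) t1_def t2_def t3_def dirac_def scaleR_conv_of_real w)
    qed
    have n: "(\<lambda>k. norm (t1 k)) summable_on (- {0})" "(\<lambda>k. norm (t2 k)) summable_on (- {0})" "(\<lambda>k. norm (t3 k)) summable_on (- {0})"
      unfolding t1_def t2_def t3_def
      by (rule residue_coeff_summable, (rule pos ap ap' schwartz_rapid[OF f])+)+
    note s = n[THEN abs_summable_summable]
    have "(\<lambda>k. norm (t1 k) + norm (t2 k) + norm (t3 k)) summable_on (- {0})" by (intro summable_on_add n)
    then have "(\<lambda>k. norm (T k f)) summable_on (- {0})"
    \<comment> \<open>Each of the three families is absolutely summable separately, so no
      cancellation between nearby frequencies is involved.\<close>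
    proof (rule summable_on_bounded_by(1))
      show "norm (T k f) \<le> norm (t1 k) + norm (t2 k) + norm (t3 k)" if "k \<in> - {0}" for k
        unfolding T[OF that] by (rule norm_triangle_le[OF add_right_mono[OF norm_triangle_ineq]])
    qed
    moreover have "(\<Sum>\<^sub>\<infinity>k\<in>- {0}. T k f) = residue_sum \<omega>\<^sub>1 \<omega>\<^sub>2 \<omega>\<^sub>3 f + residue_sum \<omega>\<^sub>2 \<omega>\<^sub>1 \<omega>\<^sub>3 f + residue_sum \<omega>\<^sub>3 \<omega>\<^sub>1 \<omega>\<^sub>2 f"
    proof -
      have "(\<Sum>\<^sub>\<infinity>k\<in>- {0}. T k f) = (\<Sum>\<^sub>\<infinity>k\<in>- {0}. t1 k + t2 k + t3 k)" by (rule infsum_cong) (rule T)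
      also have "\<dots> = infsum t1 (- {0}) + infsum t2 (- {0}) + infsum t3 (- {0})"
        using s by (simp add: infsum_add summable_on_add)
      finally show ?thesis by (simp add: residue_sum_def t1_def t2_def t3_def)
    qed
    \<comment> \<open>The signs of the two applications of \<open>distr_deriv\<close> cancel,
      leaving f''(0).\<close>
    ultimately show ?thesis unfolding F[OF f] spectral_side_def distr_deriv_def dirac_def assms(7,8)
      by (simp add: scaleR_conv_of_real)
  qed
  have "tempered_distribution (dirac_comb \<Lambda>)" unfolding assms(6) by (rule tempered_lattice_comb[OF a L])
  moreover have "distr_supp (distr_fourier (dirac_comb \<Lambda>)) = freqs \<omega>\<^sub>1 \<union> freqs \<omega>\<^sub>2 \<union> freqs \<omega>\<^sub>3"
    by (rule spectral_side_support[OF pos ap F])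
  moreover have "freqs \<omega>\<^sub>1 \<union> freqs \<omega>\<^sub>2 \<union> freqs \<omega>\<^sub>3 = \<int> \<union> {real_of_int k / sqrt 2 | k. True} \<union> {real_of_int k / sqrt 3 | k. True}"
    unfolding freqs_def w Ints_def by auto
  ultimately show ?thesis using formula by simp
qed

end
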